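(* For $c\in\mathbb{R}$ let $\rho_c\colon\mathbb{C}^2\to\mathbb{R}$ be the function $$\rho_c(z_1,z_2)=\rho_c(x_1+iy_1,x_2+iy_2)=x_1^2+x_2^2-c\,(y_1^2+y_2^2).$$ (1) Let $c<1$, let $M\in\mathbb{R}$, and let $d$ be a metric on $\mathbb{C}^2$. Let $h\colon\overline U\to\mathbb{C}^2$ be a continuous map which is holomorphic on $U$ and satisfies $\rho_c(h(e^{i\theta}))>M$ for all $e^{i\theta}\in T$. Then for any pair of numbers $0<r<1$, $\epsilon>0$, and for any finite set $A\subset U$, there exists a proper holomorphic map $f\colon U\to\mathbb{C}^2$ satisfying (i) $\lim_{|\zeta|\to1}\rho_c(f(\zeta))=+\infty$, (ii) $\rho_c(f(\zeta))>\rho_c(h(\zeta))-\epsilon$ for $\zeta\in U$, (iii) $d\bigl(f(\zeta),h(\zeta)\bigr)<\epsilon$ for $|\zeta|\le r$, and (iv) $f(\zeta)=h(\zeta)$ for $\zeta\in A$. (2) If $c\ge1$, then for every proper holomorphic map $f\colon U\to\mathbb{C}^2$ the function $\rho_c\circ f$ is unbounded from below on $U$; hence there exists no proper holomorphic map $f\colon U\to\mathbb{C}^2$ with $\lim_{|\zeta|\to1}\rho_c(f(\zeta))=+\infty$.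
   Context: $U=\{\zeta\in\mathbb{C}:|\zeta|<1\}$ is the open unit disc, $\overline U$ its closure, and $T=\{|\zeta|=1\}$ the unit circle. A metric on $\mathbb{C}^2$ means a distance function inducing the usual topology. A map $f\colon U\to\mathbb{C}^2$ is proper if preimages of compact sets are compact, equivalently $|f(\zeta)|\to\infty$ as $|\zeta|\to1$. *)

theory Defs
  imports "HOL-Complex_Analysis.Complex_Analysis"
begin

abbreviation unit_disc :: "complex set" where
  "unit_disc \<equiv> ball 0 1"

definition rho :: "real \<Rightarrow> complex \<times> complex \<Rightarrow> real" where
  "rho c z = (Re (fst z))\<^sup>2 + (Re (snd z))\<^sup>2 - c * ((Im (fst z))\<^sup>2 + (Im (snd z))\<^sup>2)"

text \<open>The library's \<open>holomorphic_on\<close> covers only scalar-valued functions; a map into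
  \<open>\<complex>\<^sup>2\<close> is holomorphic iff both components are.\<close>

definition holomorphic_map_on :: "(complex \<Rightarrow> complex \<times> complex) \<Rightarrow> complex set \<Rightarrow> bool" where
  "holomorphic_map_on f S \<longleftrightarrow>
     (\<lambda>\<zeta>. fst (f \<zeta>)) holomorphic_on S \<and> (\<lambda>\<zeta>. snd (f \<zeta>)) holomorphic_on S"

text \<open>Only the values of \<open>f\<close> on the disc matter: the preimage is taken in the disc.\<close>

definition proper_on_disc :: "(complex \<Rightarrow> complex \<times> complex) \<Rightarrow> bool" where
  "proper_on_disc f \<longleftrightarrow> (\<forall>K. compact K \<longrightarrow> compact {\<zeta> \<in> unit_disc. f \<zeta> \<in> K})"

text \<open>The filter of \<open>|\<zeta>| \<rightarrow> 1\<close> for \<open>\<zeta>\<close> in the open disc, i.e. generated by the annuli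
  \<open>1 - \<delta> < |\<zeta>| < 1\<close>; convergence along it is uniform over all directions.\<close>

definition at_disc_boundary :: "complex filter" where
  "at_disc_boundary = filtercomap norm (at_left (1::real))"

text \<open>A distance function on \<open>\<complex>\<^sup>2\<close>, not necessarily the Euclidean one, that induces the usual
  topology.\<close>

definition compatible_metric :: "(complex \<times> complex \<Rightarrow> complex \<times> complex \<Rightarrow> real) \<Rightarrow> bool" where
  "compatible_metric d \<longleftrightarrow>
     Metric_space UNIV d \<and> Metric_space.mtopology UNIV d = euclidean"

end

theory Submission
  imports Defs
begin

text \<open>
  Throughout, \<open>x\<close> and \<open>y\<close> are the vectors of real and imaginary parts of a point of \<open>\<complex>\<^sup>2\<close>.

  For \<open>c \<ge> 1\<close>, a lower bound for \<open>rho c \<circ> f\<close> bounds from below the real part of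
  \<open>f\<^sub>1\<^sup>2 + f\<^sub>2\<^sup>2 = u v\<close>, where \<open>u = f\<^sub>1 + i f\<^sub>2\<close> and \<open>v = f\<^sub>1 - i f\<^sub>2\<close>. Properness makes
  \<open>|u|\<^sup>2 + |v|\<^sup>2\<close> tend to infinity at the circle. Adding a constant to \<open>u v\<close> gives \<open>G\<close> with \<open>Re G \<ge> 1\<close>.
  Near the circle, where \<open>|u| = |v|\<close> the function \<open>G\<close> is large, whereas \<open>|G| \<le> |G 0|\<close> at some point
  of every concentric circle. On the set where \<open>|v| < |u|\<close>, say, \<open>v\<close> multiplied by high powers of
  \<open>S \<zeta>\<^sup>m / G\<close> obeys the maximum principle with a bound that does not depend on the power; so \<open>v\<close>
  vanishes wherever that quotient exceeds one in modulus, hence identically. The other one would then be a proper holomorphic function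
  from the disc to \<open>\<complex>\<close>, and the same maximum principle applied to its inverse excludes this.

  For \<open>c < 1\<close>, the boundary of a given disc \<open>h\<close> is pushed up again and again. Write
  \<open>rho k w = (1 - k) / 2 * |w|\<^sup>2 + (1 + k) / 2 * Re (w\<^sub>1\<^sup>2 + w\<^sub>2\<^sup>2)\<close>. Suppose that a function \<open>\<tau>\<close> satisfies
  \<open>\<tau> (z + w) \<ge> \<tau> z + Re (\<Lambda> z \<cdot> w) + rho k w\<close> for some \<open>k < 1\<close>. The conic
  \<open>\<Lambda> z \<cdot> w + (1 + k) / 2 * (w\<^sub>1\<^sup>2 + w\<^sub>2\<^sup>2) = 0\<close> is parametrised by \<open>\<complex>\<close> through exponentials, and along
  it \<open>\<tau> (z + w)\<close> exceeds \<open>\<tau> z\<close> by at least a positive multiple of \<open>|w|\<^sup>2\<close>: no point of it loses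
  height. Adding to \<open>h \<zeta>\<close> the point of the conic at \<open>z = h \<zeta>\<close> with parameter \<open>\<zeta>\<^sup>N P \<zeta>\<close> raises \<open>\<tau>\<close>
  on the circle by at least a multiple of \<open>|\<Lambda>|\<^sup>2\<close>, and for large \<open>N\<close> it hardly changes \<open>h\<close> on
  compact subsets of the disc. Since
  \<open>\<Lambda> (h \<zeta>)\<close> is only continuous in \<open>\<zeta>\<close>, it is replaced by a Laurent polynomial on the circle, whose poles
  the factor \<open>\<zeta>\<^sup>N\<close> cancels; a polynomial \<open>P\<close> vanishing on \<open>A\<close> gives the interpolation. This is
  \<open>push_step\<close>, and a sequence of such steps converges to the desired map (\<open>push_to_infinity\<close>)
  as long as \<open>\<Lambda>\<close> stays away from \<open>0\<close>.

  For \<open>c \<le> 0\<close> one can take \<open>\<tau> = rho c\<close>, once a small perturbation has moved \<open>h\<close> off \<open>x = 0\<close> on the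
  circle, so that \<open>rho c > 0\<close> there. For \<open>0 < c < 1\<close> the origin is a saddle point of \<open>rho c\<close> and
  has to be passed. The boundary is first raised to \<open>rho c > - c R\<^sup>2\<close>, with \<open>R\<close> small, and is then moved
  off \<open>x = 0\<close>. From there on \<open>rho c\<close> is replaced by \<open>tau k c R\<close>, which differs from it by at
  most a constant multiple of \<open>R\<^sup>2\<close>. This function is \<open>|x|\<^sup>2\<close> where \<open>|y| \<le> R\<close>; it is positive at all
  the points reached (\<open>tau_rho_bounds\<close>) and satisfies \<open>|\<Lambda>|\<^sup>2 \<ge> 4 \<tau>\<close>, so nothing obstructs the
  remaining ascent.
\<close>

section \<open>The boundary of the disc, and continuity near compact images\<close>

lemma eventually_at_disc_boundary:
  "eventually P at_disc_boundary \<longleftrightarrow> (\<exists>b<1. \<forall>\<zeta>. b < norm \<zeta> \<and> norm \<zeta> < 1 \<longrightarrow> P \<zeta>)"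
proof -
  have "eventually P at_disc_boundary \<longleftrightarrow>
     (\<exists>Q. (\<exists>b<1. \<forall>y>b. y < 1 \<longrightarrow> Q y) \<and> (\<forall>\<zeta>. Q (norm \<zeta>) \<longrightarrow> P \<zeta>))"
    unfolding at_disc_boundary_def eventually_filtercomap
    using eventually_at_left[of "0::real" 1] by simp
  also have "\<dots> \<longleftrightarrow> (\<exists>b<1. \<forall>\<zeta>. b < norm \<zeta> \<and> norm \<zeta> < 1 \<longrightarrow> P \<zeta>)"
  proof
    assume "\<exists>b<1. \<forall>\<zeta>. b < norm \<zeta> \<and> norm \<zeta> < 1 \<longrightarrow> P \<zeta>"
    then obtain b where "b<1" "\<forall>\<zeta>. b < norm \<zeta> \<and> norm \<zeta> < 1 \<longrightarrow> P \<zeta>" by blast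
    then show "\<exists>Q. (\<exists>b<1. \<forall>y>b. y < 1 \<longrightarrow> Q y) \<and> (\<forall>\<zeta>. Q (norm \<zeta>) \<longrightarrow> P \<zeta>)"
      by (intro exI[of _ "\<lambda>y. b < y \<and> y < 1"]) auto
  qed blast
  finally show ?thesis .
qed

lemma compact_subset_disc_radius:
  fixes K :: "complex set"
  assumes "compact K" "K \<subseteq> unit_disc"
  obtains r where "0 < r" "r < 1" "K \<subseteq> ball 0 r"
proof (cases "K = {}")
  case True
  then show ?thesis using that[of "1/2"] by auto
next
  case False
  have "continuous_on K norm" by (intro continuous_intros)
  then obtain x where x: "x \<in> K" "\<And>y. y \<in> K \<Longrightarrow> norm y \<le> norm x"
    using continuous_attains_sup[OF assms(1) False] by metis
  have "norm x < 1" using x(1) assms(2) by auto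
  then obtain r where "norm x < r" "r < 1" using dense by blast
  moreover have "0 < r" using calculation(1) norm_ge_zero[of x] by linarith
  moreover have "K \<subseteq> ball 0 r" using x(2) calculation(1) by (auto, meson le_less_trans)
  ultimately show ?thesis using that by blast
qed

lemma compact_image_norm_bound:
  assumes "compact (f ` S)"
  obtains M where "\<And>x. x \<in> S \<Longrightarrow> norm (f x) \<le> M"
  using compact_imp_bounded[OF assms] unfolding bounded_iff by blast

lemma boundary_collar:
  fixes \<tau> :: "'a::topological_space \<Rightarrow> real"
  assumes h: "continuous_on (cball (0::complex) 1) h" and t: "continuous_on UNIV \<tau>"
    and m: "\<And>\<zeta>. norm \<zeta> = 1 \<Longrightarrow> \<tau> (h \<zeta>) > m" and r0: "r0 < 1"
  obtains r where "r0 \<le> r" "0 < r" "r < 1" "\<And>\<zeta>. r \<le> norm \<zeta> \<Longrightarrow> norm \<zeta> \<le> 1 \<Longrightarrow> \<tau> (h \<zeta>) > m"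
proof -
  let ?K = "cball 0 1 \<inter> (\<lambda>\<zeta>. \<tau> (h \<zeta>)) -` {..m}"
  have "continuous_on (cball 0 1) (\<lambda>\<zeta>. \<tau> (h \<zeta>))"
    by (rule continuous_on_compose2[OF t h]) auto
  then have "closed ?K" by (rule continuous_closed_preimage) auto
  then have "compact ?K" using compact_Int_closed[OF compact_cball, of ?K 0 1] by (simp add: Int_absorb1)
  moreover have "?K \<subseteq> unit_disc"
  proof
    fix \<zeta> assume "\<zeta> \<in> ?K"
    then have "norm \<zeta> \<le> 1" "\<tau> (h \<zeta>) \<le> m" by auto
    then show "\<zeta> \<in> unit_disc" using m[of \<zeta>] by (cases "norm \<zeta> = 1") auto
  qed
  ultimately obtain r where r: "0 < r" "r < 1" "?K \<subseteq> ball 0 r" by (rule compact_subset_disc_radius)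
  have "\<tau> (h \<zeta>) > m" if "max r r0 \<le> norm \<zeta>" "norm \<zeta> \<le> 1" for \<zeta>
    using subsetD[OF r(3), of \<zeta>] that by force
  moreover have "r0 \<le> max r r0" "0 < max r r0" "max r r0 < 1" using r r0 by auto
  ultimately show ?thesis using that by blast
qed

lemma sphere_gap:
  fixes \<tau> :: "'a::topological_space \<Rightarrow> real"
  assumes h: "continuous_on (cball (0::complex) 1) h" and t: "continuous_on UNIV \<tau>"
    and m: "\<And>\<zeta>. norm \<zeta> = 1 \<Longrightarrow> \<tau> (h \<zeta>) > m"
  obtains \<delta> where "\<delta> > 0" "\<And>\<zeta>. norm \<zeta> = 1 \<Longrightarrow> \<tau> (h \<zeta>) > m + \<delta>"
proof -
  have "continuous_on (sphere 0 1) h" by (rule continuous_on_subset[OF h]) auto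
  then have "continuous_on (sphere 0 1) (\<lambda>\<zeta>. \<tau> (h \<zeta>))"
    by (rule continuous_on_compose2[OF t]) auto
  moreover have "sphere (0::complex) 1 \<noteq> {}" by (auto intro!: exI[of _ 1])
  ultimately obtain z where z: "z \<in> sphere 0 1" "\<And>\<zeta>. \<zeta> \<in> sphere 0 1 \<Longrightarrow> \<tau> (h z) \<le> \<tau> (h \<zeta>)"
    using continuous_attains_inf[OF compact_sphere] by blast
  have "\<tau> (h z) > m" using m z by auto
  moreover have "\<tau> (h \<zeta>) > m + (\<tau> (h z) - m) / 2" if "norm \<zeta> = 1" for \<zeta>
  proof -
    have "\<tau> (h z) \<le> \<tau> (h \<zeta>)" using z(2) that by simp
    moreover have "m + (\<tau> (h z) - m) / 2 < \<tau> (h z)" using \<open>\<tau> (h z) > m\<close> by (simp add: field_simps)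
    ultimately show ?thesis by linarith
  qed
  ultimately show ?thesis using that[of "(\<tau> (h z) - m) / 2"] by simp
qed

lemma continuous_near_compact_image:
  fixes \<tau> :: "'a::heine_borel \<Rightarrow> real" and h :: "'b::metric_space \<Rightarrow> 'a"
  assumes K: "compact K" and h: "continuous_on K h" and t: "continuous_on UNIV \<tau>" and e: "e > 0"
  obtains \<delta> where "\<delta> > 0" "\<And>x w. x \<in> K \<Longrightarrow> dist w (h x) < \<delta> \<Longrightarrow> \<bar>\<tau> w - \<tau> (h x)\<bar> < e"
proof -
  let ?G = "(\<lambda>x. {w. \<bar>\<tau> w - \<tau> x\<bar> < e / 2}) ` (h ` K)"
  have "compact (h ` K)" by (rule compact_continuous_image[OF h K])
  moreover have "h ` K \<subseteq> \<Union>?G" using e by auto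
  moreover have "open G" if "G \<in> ?G" for G
    using that t by (auto intro!: open_Collect_less continuous_intros)
  ultimately obtain d where d: "d > 0" "\<forall>x\<in>h ` K. \<exists>G\<in>?G. ball x d \<subseteq> G"
    using Heine_Borel_lemma[of "h ` K" ?G] by metis
  show ?thesis
  proof (rule that[OF d(1)])
    fix x w assume x: "x \<in> K" "dist w (h x) < d"
    then obtain y where "ball (h x) d \<subseteq> {w. \<bar>\<tau> w - \<tau> y\<bar> < e / 2}" using d(2) by blast
    then have "\<bar>\<tau> w - \<tau> y\<bar> < e / 2" "\<bar>\<tau> (h x) - \<tau> y\<bar> < e / 2" using x d(1) by (auto simp: dist_commute subset_iff)
    then show "\<bar>\<tau> w - \<tau> (h x)\<bar> < e" by linarith
  qed
qed

text \<open>
  On a compact set a topologically equivalent metric is uniformly controlled by the Euclidean one: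
  take a Lebesgue number of the cover by the open balls of \<open>d\<close>.
\<close>
lemma compatible_metric_near_compact_image:
  assumes d: "compatible_metric d" and K: "compact K" and h: "continuous_on K h" and e: "e > 0"
  obtains \<delta> where "\<delta> > 0" "\<And>x w. x \<in> K \<Longrightarrow> dist w (h x) < \<delta> \<Longrightarrow> d w (h x) < e"
proof -
  interpret Metric_space UNIV d using d by (simp add: compatible_metric_def)
  have top: "mtopology = euclidean" using d by (simp add: compatible_metric_def)
  let ?G = "(\<lambda>x. mball x (e / 2)) ` (h ` K)"
  have "compact (h ` K)" by (rule compact_continuous_image[OF h K])
  moreover have "h ` K \<subseteq> \<Union>?G" using e by auto
  moreover have "open G" if "G \<in> ?G" for G
    using that openin_mball unfolding top by auto
  ultimately obtain \<delta> where \<delta>: "\<delta> > 0" "\<forall>x\<in>h ` K. \<exists>G\<in>?G. ball x \<delta> \<subseteq> G"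
    using Heine_Borel_lemma[of "h ` K" ?G] by metis
  show ?thesis
  proof (rule that[OF \<delta>(1)])
    fix x w assume x: "x \<in> K" "dist w (h x) < \<delta>"
    then obtain y where y: "ball (h x) \<delta> \<subseteq> mball y (e / 2)" using \<delta>(2) by blast
    have "w \<in> mball y (e / 2)" "h x \<in> mball y (e / 2)"
      using x \<delta>(1) by (intro subsetD[OF y]; simp add: dist_commute)+
    then have "d y w < e / 2" "d y (h x) < e / 2" by auto
    then show "d w (h x) < e" using triangle[of w y "h x"] commute[of w y] by auto
  qed
qed

lemma holomorphic_map_on_imp_continuous_on:
  assumes "holomorphic_map_on f S"
  shows "continuous_on S f"
  using assms continuous_on_Pair[of S "\<lambda>\<zeta>. fst (f \<zeta>)" "\<lambda>\<zeta>. snd (f \<zeta>)"]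
  by (auto simp: holomorphic_map_on_def dest: holomorphic_on_imp_continuous_on)

lemma continuous_rho: "continuous_on UNIV (rho c)"
  unfolding rho_def by (intro continuous_intros)

lemma proper_if_rho_tends_to_infinity:
  assumes f: "holomorphic_map_on f unit_disc" and lim: "filterlim (\<lambda>\<zeta>. rho c (f \<zeta>)) at_top at_disc_boundary"
  shows "proper_on_disc f"
  unfolding proper_on_disc_def
proof (intro allI impI)
  fix K :: "(complex \<times> complex) set" assume K: "compact K"
  have "compact (rho c ` K)" by (intro compact_continuous_image continuous_on_subset[OF continuous_rho] K) auto
  then obtain B where B: "\<And>z. z \<in> K \<Longrightarrow> norm (rho c z) \<le> B" by (rule compact_image_norm_bound) blast
  have "\<forall>\<^sub>F \<zeta> in at_disc_boundary. rho c (f \<zeta>) > B" using lim by (simp add: filterlim_at_top_dense)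
  then obtain b where b: "b < 1" "\<And>\<zeta>. b < norm \<zeta> \<Longrightarrow> norm \<zeta> < 1 \<Longrightarrow> rho c (f \<zeta>) > B"
    unfolding eventually_at_disc_boundary by blast
  have cf: "continuous_on unit_disc f"
    by (rule holomorphic_map_on_imp_continuous_on[OF f])
  have eq: "{\<zeta> \<in> unit_disc. f \<zeta> \<in> K} = cball 0 b \<inter> f -` K"
  proof (intro set_eqI iffI)
    fix \<zeta> assume *: "\<zeta> \<in> {\<zeta> \<in> unit_disc. f \<zeta> \<in> K}"
    then have "rho c (f \<zeta>) \<le> B" using B[of "f \<zeta>"] by (auto simp: abs_le_iff)
    then have "\<not> b < norm \<zeta>" using b(2)[of \<zeta>] * by auto
    then show "\<zeta> \<in> cball 0 b \<inter> f -` K" using * by auto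
  qed (use b(1) in auto)
  have "closed (cball 0 b \<inter> f -` K)"
    using b(1) K by (intro continuous_closed_preimage continuous_on_subset[OF cf] compact_imp_closed) auto
  then have "compact (cball 0 b \<inter> (cball 0 b \<inter> f -` K))" by (rule compact_Int_closed[OF compact_cball])
  then show "compact {\<zeta> \<in> unit_disc. f \<zeta> \<in> K}" unfolding eq by (simp add: Int_absorb1)
qed

section \<open>Proper discs on which rho is bounded below do not exist for c at least 1\<close>

lemma proper_on_disc_leaves_balls:
  assumes "proper_on_disc f"
  obtains r where "0 < r" "r < 1" "\<And>\<zeta>. r \<le> norm \<zeta> \<Longrightarrow> norm \<zeta> < 1 \<Longrightarrow> norm (f \<zeta>) > R"
proof -
  have "compact {\<zeta> \<in> unit_disc. f \<zeta> \<in> cball 0 R}"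
    using assms compact_cball[of "0::complex \<times> complex" R] by (simp only: proper_on_disc_def)
  moreover have "{\<zeta> \<in> unit_disc. f \<zeta> \<in> cball 0 R} \<subseteq> unit_disc" by auto
  ultimately obtain r where
    r: "0 < r" "r < 1" "{\<zeta> \<in> unit_disc. f \<zeta> \<in> cball 0 R} \<subseteq> ball 0 r"
    by (rule compact_subset_disc_radius)
  have "norm (f \<zeta>) > R" if "r \<le> norm \<zeta>" "norm \<zeta> < 1" for \<zeta>
    using subsetD[OF r(3), of \<zeta>] that by force
  with r(1,2) show ?thesis by (rule that)
qed

text \<open>
  A maximum principle with a free exponent: all the functions \<open>v q\<^sup>n\<close> with \<open>n \<ge> 1\<close> satisfy the same bound on the
  boundary of \<open>\<Omega>\<close>, so \<open>v\<close> must vanish where \<open>q\<^sup>n\<close> is unbounded in \<open>n\<close>. On the part of the boundary lying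
  on the unit circle, \<open>q\<close> may exceed one, but there \<open>v q\<close> tends to zero.
\<close>
lemma vanishes_where_multiplier_exceeds_one:
  fixes v q :: "complex \<Rightarrow> complex"
  assumes \<Omega>: "open \<Omega>" "\<Omega> \<subseteq> unit_disc"
    and hol: "v holomorphic_on \<Omega>" "q holomorphic_on \<Omega>"
    and cont: "continuous_on (closure \<Omega> \<inter> unit_disc) v" "continuous_on (closure \<Omega> \<inter> unit_disc) q"
    and fr: "\<And>\<zeta>. \<zeta> \<in> frontier \<Omega> \<Longrightarrow> norm \<zeta> < 1 \<Longrightarrow> norm (q \<zeta>) \<le> 1 \<and> norm (v \<zeta> * q \<zeta>) \<le> B"
    and S: "\<And>\<zeta>. \<zeta> \<in> closure \<Omega> \<Longrightarrow> norm \<zeta> < 1 \<Longrightarrow> norm (q \<zeta>) \<le> S"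
    and lim: "\<And>e. e > 0 \<Longrightarrow> \<exists>r<1. \<forall>\<zeta>\<in>closure \<Omega>. r \<le> norm \<zeta> \<and> norm \<zeta> < 1 \<longrightarrow> norm (v \<zeta> * q \<zeta>) \<le> e"
    and p: "p \<in> \<Omega>" "norm (q p) > 1"
  shows "v p = 0"
proof -
  define B' where "B' = max B 1"
  define S' where "S' = max S 1"
  have bound: "norm (v p * q p * q p ^ n) \<le> B'" for n
  proof -
    have "B' / S' ^ n > 0" by (auto simp: B'_def S'_def)
    from lim[OF this] obtain r where r: "r < 1"
      "\<And>\<zeta>. \<lbrakk>\<zeta>\<in>closure \<Omega>; r \<le> norm \<zeta>; norm \<zeta> < 1\<rbrakk> \<Longrightarrow> norm (v \<zeta> * q \<zeta>) \<le> B' / S' ^ n" by blast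
    have "norm p < 1" using p \<Omega> by auto
    then obtain t where t: "max r (norm p) < t" "t < 1" using r dense[of "max r (norm p)" 1] by auto
    let ?X = "\<Omega> \<inter> ball 0 t"
    have cl: "closure ?X \<subseteq> closure \<Omega> \<inter> unit_disc"
    proof -
      have "closure ?X \<subseteq> closure \<Omega>" "closure ?X \<subseteq> cball 0 t"
        by (rule closure_mono closure_minimal; auto)+
      then show ?thesis using t by fastforce
    qed
    show ?thesis
    proof (rule maximum_modulus_frontier[where f="\<lambda>\<zeta>. v \<zeta> * q \<zeta> * q \<zeta> ^ n" and S="?X"])
      show "(\<lambda>\<zeta>. v \<zeta> * q \<zeta> * q \<zeta> ^ n) holomorphic_on interior ?X"
        using \<Omega>(1) by (intro holomorphic_intros holomorphic_on_subset[OF hol(1)] holomorphic_on_subset[OF hol(2)])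
           (auto simp: interior_open open_Int)
      show "continuous_on (closure ?X) (\<lambda>\<zeta>. v \<zeta> * q \<zeta> * q \<zeta> ^ n)"
        by (intro continuous_intros continuous_on_subset[OF cont(1) cl] continuous_on_subset[OF cont(2) cl])
      show "bounded ?X" using bounded_ball bounded_Int by blast
      show "p \<in> ?X" using p t by auto
      fix z assume z: "z \<in> frontier ?X"
      then have zc: "z \<in> closure \<Omega>" "norm z < 1" "z \<in> closure ?X"
        using cl by (auto simp: frontier_def)
      show "norm (v z * q z * q z ^ n) \<le> B'"
      proof (cases "norm z < t")
        case True
        have "z \<in> frontier \<Omega>"
          using z True \<Omega>(1) zc by (auto simp: frontier_def interior_open open_Int)
        then have "norm (q z) \<le> 1" "norm (v z * q z) \<le> B" using fr zc by auto
        then have "norm (v z * q z) * norm (q z) ^ n \<le> B' * 1"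
          by (intro mult_mono power_le_one) (auto simp: B'_def)
        then show ?thesis by (simp add: norm_mult norm_power)
      next
        case False
        then have "norm (v z * q z) \<le> B' / S' ^ n" using r(2) zc t by auto
        moreover have "norm (q z) ^ n \<le> S' ^ n"
          using S[OF zc(1,2)] by (intro power_mono) (auto simp: S'_def)
        ultimately have "norm (v z * q z) * norm (q z) ^ n \<le> B' / S' ^ n * S' ^ n"
          by (intro mult_mono) (auto simp: B'_def S'_def)
        also have "\<dots> = B'" by (auto simp: S'_def)
        finally show ?thesis by (simp add: norm_mult norm_power)
      qed
    qed
  qed
  show ?thesis
  proof (rule ccontr)
    assume "v p \<noteq> 0"
    then have pos: "norm (v p * q p) > 0" using p by auto
    obtain n where "B' / norm (v p * q p) < norm (q p) ^ n"
      using real_arch_pow[OF p(2)] by blast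
    then have "B' < norm (v p * q p * q p ^ n)"
      using pos by (simp add: field_simps norm_mult norm_power)
    with bound[of n] show False by simp
  qed
qed

lemma power_above_near_one:
  fixes a :: real
  assumes "a < 1" "r0 < 1"
  obtains \<rho> where "r0 < \<rho>" "0 < \<rho>" "\<rho> < 1" "a < \<rho> ^ m"
proof -
  have "((\<lambda>x::real. x ^ m) \<longlongrightarrow> 1 ^ m) (at_left 1)" by (intro tendsto_intros)
  then have "eventually (\<lambda>x. a < x ^ m) (at_left 1)"
    using assms by (auto intro: order_tendstoD)
  moreover have "eventually (\<lambda>x. max r0 0 < x \<and> x < 1) (at_left (1::real))"
    using eventually_at_left_real[of "max r0 0" 1] assms by simp
  ultimately have "eventually (\<lambda>x. a < x ^ m \<and> max r0 0 < x \<and> x < 1) (at_left (1::real))"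
    by eventually_elim auto
  then obtain x where "a < x ^ m \<and> max r0 0 < x \<and> x < 1"
    using eventually_happens[of _ "at_left (1::real)"] trivial_limit_at_left_real by blast
  then show ?thesis using that[of x] by auto
qed

text \<open>
  The inverse of such a function tends to zero at the circle. In an annulus without zeros of \<open>u\<close> it can be multiplied by
  powers of \<open>2 \<zeta>\<^sup>m\<close>, which is at most one on the inner circle and exceeds one near the unit circle.
\<close>
lemma no_proper_holomorphic_function_on_disc:
  assumes "u holomorphic_on unit_disc"
  shows "\<not> (\<forall>R. \<exists>r<1. \<forall>\<zeta>. r \<le> norm \<zeta> \<and> norm \<zeta> < 1 \<longrightarrow> norm (u \<zeta>) > R)"
proof
  assume lim: "\<forall>R. \<exists>r<1. \<forall>\<zeta>. r \<le> norm \<zeta> \<and> norm \<zeta> < 1 \<longrightarrow> norm (u \<zeta>) > R"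
  then obtain r where r: "r < 1" "\<And>\<zeta>. r \<le> norm \<zeta> \<Longrightarrow> norm \<zeta> < 1 \<Longrightarrow> norm (u \<zeta>) > 1" by metis
  obtain r0 where r0: "max r 0 < r0" "r0 < 1" using dense[of "max r 0" 1] r by auto
  obtain m where m: "r0 ^ m < 1/2" using real_arch_pow_inv[of "1/2" r0] r0 by auto
  obtain \<rho> where \<rho>: "r0 < \<rho>" "0 < \<rho>" "\<rho> < 1" "1/2 < \<rho> ^ m"
    using power_above_near_one[of "1/2" r0 m] r0 by auto
  let ?\<Omega> = "unit_disc - cball 0 r0"
  have cl: "closure ?\<Omega> \<subseteq> - ball 0 r0" by (rule closure_minimal) auto
  have big: "norm (u \<zeta>) > 1" if "\<zeta> \<in> closure ?\<Omega>" "norm \<zeta> < 1" for \<zeta>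
    using r(2)[of \<zeta>] cl that r0 by fastforce
  have hol: "(\<lambda>\<zeta>. inverse (u \<zeta>)) holomorphic_on ?\<Omega>"
    using r r0 by (intro holomorphic_intros holomorphic_on_subset[OF assms]) force+
  have "inverse (u (of_real \<rho>)) = 0"
  proof (rule vanishes_where_multiplier_exceeds_one[where \<Omega>="?\<Omega>" and p="of_real \<rho>"
       and v="\<lambda>\<zeta>. inverse (u \<zeta>)" and q="\<lambda>\<zeta>. 2 * \<zeta> ^ m" and B=2 and S=2])
    have "continuous_on unit_disc u" using assms holomorphic_on_imp_continuous_on by blast
    then show "continuous_on (closure ?\<Omega> \<inter> unit_disc) (\<lambda>\<zeta>. inverse (u \<zeta>))"
      using big by (intro continuous_intros) (auto intro: continuous_on_subset, force)
    have le1: "norm \<zeta> ^ m \<le> 1" if "norm \<zeta> < 1" for \<zeta> :: complex using that by (simp add: power_le_one)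
    show "norm (2 * \<zeta> ^ m) \<le> 1 \<and> norm (inverse (u \<zeta>) * (2 * \<zeta> ^ m)) \<le> 2"
      if \<zeta>: "\<zeta> \<in> frontier ?\<Omega>" "norm \<zeta> < 1" for \<zeta>
    proof -
      have "\<zeta> \<notin> ?\<Omega>" using \<zeta> frontier_disjoint_eq[of ?\<Omega>] by (auto simp: open_Diff)
      then have "norm \<zeta> \<le> r0" using \<zeta> by auto
      then have "norm \<zeta> ^ m \<le> r0 ^ m" by (intro power_mono) auto
      moreover have "norm (inverse (u \<zeta>)) \<le> 1" using big[of \<zeta>] \<zeta>
        by (auto simp: frontier_def norm_inverse intro!: inverse_le_1_iff[THEN iffD2])
      ultimately have "norm (2 * \<zeta> ^ m) \<le> 1" "norm (inverse (u \<zeta>)) \<le> 1"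
        using m by (auto simp: norm_mult norm_power)
      then show ?thesis using mult_mono[of "norm (inverse (u \<zeta>))" 1 "norm (2 * \<zeta> ^ m)" 1]
        by (simp only: norm_mult) auto
    qed
    show "\<exists>r<1. \<forall>\<zeta>\<in>closure ?\<Omega>. r \<le> norm \<zeta> \<and> norm \<zeta> < 1 \<longrightarrow>
              norm (inverse (u \<zeta>) * (2 * \<zeta> ^ m)) \<le> e" if "e > 0" for e
    proof -
      obtain t where t: "t < 1" "\<And>\<zeta>. t \<le> norm \<zeta> \<Longrightarrow> norm \<zeta> < 1 \<Longrightarrow> norm (u \<zeta>) > 2 / e" using lim by metis
      have "norm (inverse (u \<zeta>) * (2 * \<zeta> ^ m)) \<le> e" if \<zeta>: "t \<le> norm \<zeta>" "norm \<zeta> < 1" for \<zeta>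
      proof -
        have "2 < e * norm (u \<zeta>)" using t(2)[OF \<zeta>] \<open>e > 0\<close> by (simp add: field_simps)
        moreover have "norm (u \<zeta>) > 0" using t(2)[OF \<zeta>] divide_pos_pos[of 2 e] \<open>e > 0\<close> by linarith
        moreover have "e * 1 \<ge> 0" using that \<open>e > 0\<close> by simp
        ultimately have "2 * norm \<zeta> ^ m / norm (u \<zeta>) \<le> e" using le1[OF \<zeta>(2)]
          by (simp add: divide_le_eq)
        then show ?thesis by (simp add: norm_mult norm_inverse norm_power norm_divide divide_inverse mult_ac)
      qed
      then show ?thesis using t(1) by blast
    qed
    show "norm (2 * \<zeta> ^ m) \<le> 2" if "norm \<zeta> < 1" for \<zeta> :: complex
      using le1[OF that] by (simp add: norm_mult norm_power)
    show "open ?\<Omega>" by (simp add: open_Diff)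
    show "(\<lambda>\<zeta>. 2 * \<zeta> ^ m) holomorphic_on ?\<Omega>" by (intro holomorphic_intros)
    show "continuous_on (closure ?\<Omega> \<inter> unit_disc) (\<lambda>\<zeta>. 2 * \<zeta> ^ m)" by (intro continuous_intros)
    show "of_real \<rho> \<in> ?\<Omega>" "norm (2 * of_real \<rho> ^ m :: complex) > 1"
      using \<rho> r0 by (simp_all add: norm_mult norm_power)
  qed (use hol in simp_all)
  then show False using r(2)[of "of_real \<rho>"] \<rho> r0 by auto
qed

text \<open>
  An elementary substitute for the boundary value theorems of Fatou and Privalov. By those, \<open>u v\<close>
  would have finite limits almost everywhere on the circle, so one of \<open>u\<close>, \<open>v\<close> would tend to zero
  on a set of positive measure and vanish identically. Here the exceptional set of boundary
  points is absorbed by the factor \<open>1 / G\<close>.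
\<close>
lemma no_proper_pair_with_Re_product_bounded_below:
  fixes u v :: "complex \<Rightarrow> complex"
  assumes hol: "u holomorphic_on unit_disc" "v holomorphic_on unit_disc"
    and lower: "\<And>\<zeta>. norm \<zeta> < 1 \<Longrightarrow> Re (u \<zeta> * v \<zeta>) \<ge> - C"
    and lim: "\<And>R. \<exists>r<1. \<forall>\<zeta>. r \<le> norm \<zeta> \<and> norm \<zeta> < 1 \<longrightarrow> (norm (u \<zeta>))\<^sup>2 + (norm (v \<zeta>))\<^sup>2 > R"
  shows False
proof -
  define C' where "C' = max C 0"
  define D where "D = C' + 2"
  define G where "G = (\<lambda>\<zeta>. u \<zeta> * v \<zeta> + of_real (C' + 1))"
  have D: "D \<ge> 2" by (simp add: D_def C'_def)
  have G1: "norm (G \<zeta>) \<ge> 1" if "norm \<zeta> < 1" for \<zeta>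
  proof -
    have "1 \<le> Re (G \<zeta>)" using lower[OF that] by (simp add: G_def C'_def)
    also have "\<dots> \<le> norm (G \<zeta>)" by (rule complex_Re_le_cmod)
    finally show ?thesis .
  qed
  have prod_le: "norm (u \<zeta>) * norm (v \<zeta>) \<le> D * norm (G \<zeta>)" if "norm \<zeta> < 1" for \<zeta>
  proof -
    have "u \<zeta> * v \<zeta> = G \<zeta> - of_real (C' + 1)" by (simp add: G_def)
    then have "norm (u \<zeta> * v \<zeta>) \<le> norm (G \<zeta>) + norm (of_real (C' + 1) :: complex)"
      using norm_triangle_ineq4 by metis
    also have "norm (of_real (C' + 1) :: complex) = C' + 1" by (simp only: norm_of_real) (simp add: C'_def)
    also have "norm (G \<zeta>) + (C' + 1) \<le> norm (G \<zeta>) + (C' + 1) * norm (G \<zeta>)"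
      using G1[OF that] mult_left_mono[of 1 "norm (G \<zeta>)" "C' + 1"] by (simp add: C'_def)
    finally show ?thesis by (simp add: norm_mult D_def algebra_simps)
  qed
  \<comment> \<open>Any \<open>S\<close> above \<open>|G 0|\<close> would do: it separates the values of \<open>G\<close> where \<open>|u| = |v|\<close> from the
    small values of \<open>G\<close> found on every concentric circle.\<close>
  define S where "S = norm (G 0) + 1"
  have S: "S > 1"
  proof -
    have "norm (G 0) \<ge> 1" by (rule G1) simp
    then show ?thesis unfolding S_def by linarith
  qed
  obtain r where r: "r < 1" "\<And>\<zeta>. r \<le> norm \<zeta> \<Longrightarrow> norm \<zeta> < 1 \<Longrightarrow> (norm (u \<zeta>))\<^sup>2 + (norm (v \<zeta>))\<^sup>2 > 2 * (D * S)"
    using lim by metis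
  obtain r0 where r0: "max r 0 < r0" "r0 < 1" using dense[of "max r 0" 1] r by auto
  have equal_norms: "norm (G \<zeta>) > S" if "norm (u \<zeta>) = norm (v \<zeta>)" "r0 \<le> norm \<zeta>" "norm \<zeta> < 1" for \<zeta>
  proof -
    have "D * S < norm (u \<zeta>) * norm (v \<zeta>)"
      using r(2)[of \<zeta>] that r0 by (simp add: power2_eq_square)
    also have "\<dots> \<le> D * norm (G \<zeta>)" by (rule prod_le[OF that(3)])
    finally show ?thesis using D by simp
  qed
  obtain m where m: "r0 ^ m < 1 / S" using real_arch_pow_inv[of "1/S" r0] r0 S by auto
  \<comment> \<open>On the inner circle \<open>|\<zeta>| = r0\<close> the power of \<open>\<zeta>\<close> compensates \<open>S\<close>, and where \<open>|u| = |v|\<close> the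
    denominator does; close to the unit circle \<open>|q| > 1\<close> wherever \<open>|G| \<le> |G 0|\<close>.\<close>
  define q where "q = (\<lambda>\<zeta>. of_real S * \<zeta> ^ m / G \<zeta>)"
  have holG: "G holomorphic_on unit_disc" unfolding G_def by (intro holomorphic_intros hol)
  have Gnz: "G \<zeta> \<noteq> 0" if "norm \<zeta> < 1" for \<zeta> using G1[OF that] by auto
  have holq: "q holomorphic_on unit_disc" unfolding q_def by (intro holomorphic_intros holG) (auto simp: Gnz)
  have qS: "norm (q \<zeta>) \<le> S" "norm (q \<zeta>) \<le> S / norm (G \<zeta>)" if "norm \<zeta> < 1" for \<zeta>
  proof -
    have "norm \<zeta> ^ m \<le> 1" using that by (simp add: power_le_one)
    then have "S * norm \<zeta> ^ m \<le> S * 1" using S by (intro mult_left_mono) auto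
    then show *: "norm (q \<zeta>) \<le> S / norm (G \<zeta>)"
      using S by (simp add: q_def norm_divide norm_mult norm_power divide_right_mono)
    have "S / norm (G \<zeta>) \<le> S / 1" using S G1[OF that] by (intro divide_left_mono) auto
    then show "norm (q \<zeta>) \<le> S" using * by simp
  qed
  \<comment> \<open>Stated for \<open>a\<close>, \<open>b\<close> to be used for \<open>u\<close>, \<open>v\<close> in either order.\<close>
  have vanish: "b p = 0"
    if ab: "a holomorphic_on unit_disc" "b holomorphic_on unit_disc"
      "\<And>\<zeta>. norm (a \<zeta>) * norm (b \<zeta>) = norm (u \<zeta>) * norm (v \<zeta>)"
      "\<And>\<zeta>. (norm (a \<zeta>))\<^sup>2 + (norm (b \<zeta>))\<^sup>2 = (norm (u \<zeta>))\<^sup>2 + (norm (v \<zeta>))\<^sup>2"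
      "\<And>\<zeta>. norm (a \<zeta>) = norm (b \<zeta>) \<Longrightarrow> norm (u \<zeta>) = norm (v \<zeta>)"
      and p: "r0 < norm p" "norm p < 1" "norm (b p) < norm (a p)" "norm (q p) > 1" for a b p
  proof (rule vanishes_where_multiplier_exceeds_one[where
        \<Omega>="{\<zeta>\<in>unit_disc - cball 0 r0. norm (b \<zeta>) < norm (a \<zeta>)}" and q=q and p=p and v=b and B="D * S" and S=S])
    let ?\<Omega> = "{\<zeta>\<in>unit_disc - cball 0 r0. norm (b \<zeta>) < norm (a \<zeta>)}"
    have cab: "continuous_on unit_disc a" "continuous_on unit_disc b" "continuous_on unit_disc q"
      using ab(1,2) holq by (auto intro: holomorphic_on_imp_continuous_on)
    show op: "open ?\<Omega>"
    proof -
      have "open ((unit_disc - cball 0 r0) \<inter> (\<lambda>\<zeta>. norm (a \<zeta>) - norm (b \<zeta>)) -` {0<..})"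
        by (rule continuous_open_preimage; (intro continuous_intros open_Diff)?)
           (auto intro: continuous_on_subset[OF cab(1)] continuous_on_subset[OF cab(2)])
      moreover have "(unit_disc - cball 0 r0) \<inter> (\<lambda>\<zeta>. norm (a \<zeta>) - norm (b \<zeta>)) -` {0<..} = ?\<Omega>" by auto
      ultimately show ?thesis by simp
    qed
    have clos: "r0 \<le> norm \<zeta> \<and> norm (b \<zeta>) \<le> norm (a \<zeta>)" if \<zeta>: "\<zeta> \<in> closure ?\<Omega>" "norm \<zeta> < 1" for \<zeta>
    proof -
      obtain x where x: "\<And>n. x n \<in> ?\<Omega>" "x \<longlonglongrightarrow> \<zeta>" using \<zeta>(1) unfolding closure_sequential by blast
      have "r0 \<le> norm \<zeta>"
        by (rule tendsto_lowerbound[OF tendsto_norm[OF x(2)]]) (use x(1) in \<open>auto simp: not_le intro!: always_eventually less_imp_le\<close>)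
      moreover have "isCont a \<zeta>" "isCont b \<zeta>"
        using cab \<zeta>(2) by (auto simp: continuous_on_eq_continuous_at)
      then have "(\<lambda>n. norm (a (x n)) - norm (b (x n))) \<longlonglongrightarrow> norm (a \<zeta>) - norm (b \<zeta>)"
        using x(2) by (intro tendsto_intros isCont_tendsto_compose[of \<zeta> a] isCont_tendsto_compose[of \<zeta> b])
      then have "0 \<le> norm (a \<zeta>) - norm (b \<zeta>)"
        by (rule tendsto_lowerbound) (use x(1) in \<open>auto simp: less_imp_le intro!: always_eventually\<close>)
      ultimately show ?thesis by simp
    qed
    have bsq: "(norm (b \<zeta>))\<^sup>2 \<le> D * norm (G \<zeta>)" if "\<zeta> \<in> closure ?\<Omega>" "norm \<zeta> < 1" for \<zeta>
    proof -
      have "(norm (b \<zeta>))\<^sup>2 \<le> norm (a \<zeta>) * norm (b \<zeta>)"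
        using clos[OF that] by (simp add: power2_eq_square mult_right_mono)
      then show ?thesis using prod_le[OF that(2)] ab(3) by simp
    qed
    have bq: "norm (b \<zeta> * q \<zeta>) \<le> norm (b \<zeta>) * (S / norm (G \<zeta>))" if "norm \<zeta> < 1" for \<zeta>
      unfolding norm_mult using qS(2)[OF that] by (intro mult_left_mono) auto
    show "norm (q \<zeta>) \<le> 1 \<and> norm (b \<zeta> * q \<zeta>) \<le> D * S"
      if \<zeta>: "\<zeta> \<in> frontier ?\<Omega>" "norm \<zeta> < 1" for \<zeta>
    proof
      have cl: "\<zeta> \<in> closure ?\<Omega>" using \<zeta> by (simp add: frontier_def)
      have "\<zeta> \<notin> ?\<Omega>" using \<zeta> op by (simp add: frontier_def interior_open)
      then have "norm \<zeta> = r0 \<or> norm (a \<zeta>) = norm (b \<zeta>)" using clos[OF cl \<zeta>(2)] \<zeta>(2) by auto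
      then show "norm (q \<zeta>) \<le> 1"
      proof
        assume "norm \<zeta> = r0"
        then have "norm (q \<zeta>) = S * r0 ^ m / norm (G \<zeta>)"
          using S by (simp add: q_def norm_divide norm_mult norm_power)
        also have "\<dots> \<le> 1 / 1" using m S G1[OF \<zeta>(2)] r0 by (intro frac_le) (auto simp: field_simps)
        finally show ?thesis by simp
      next
        assume "norm (a \<zeta>) = norm (b \<zeta>)"
        then have "norm (G \<zeta>) > S" using equal_norms[of \<zeta>] ab(5) clos[OF cl \<zeta>(2)] \<zeta>(2) by blast
        then have "S / norm (G \<zeta>) \<le> 1" using S by (subst divide_le_eq_1) linarith
        then show ?thesis using qS(2)[OF \<zeta>(2)] by linarith
      qed
      have "D * norm (G \<zeta>) * 1 \<le> D * norm (G \<zeta>) * (D * norm (G \<zeta>))"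
        using D G1[OF \<zeta>(2)] mult_mono[of 1 D 1 "norm (G \<zeta>)"] by (intro mult_left_mono) auto
      then have "(norm (b \<zeta>))\<^sup>2 \<le> (D * norm (G \<zeta>))\<^sup>2"
        using bsq[OF cl \<zeta>(2)] unfolding power2_eq_square[of "D * norm (G \<zeta>)"] by linarith
      moreover have "0 \<le> D * norm (G \<zeta>)" using D by simp
      ultimately have "norm (b \<zeta>) \<le> D * norm (G \<zeta>)" by (rule power2_le_imp_le)
      then have "norm (b \<zeta>) * (S / norm (G \<zeta>)) \<le> D * norm (G \<zeta>) * (S / norm (G \<zeta>))"
        using S by (intro mult_right_mono) auto
      also have "\<dots> = D * S" using Gnz[OF \<zeta>(2)] by simp
      finally show "norm (b \<zeta> * q \<zeta>) \<le> D * S" using bq[OF \<zeta>(2)] by linarith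
    qed
    show "\<exists>r<1. \<forall>\<zeta>\<in>closure ?\<Omega>. r \<le> norm \<zeta> \<and> norm \<zeta> < 1 \<longrightarrow> norm (b \<zeta> * q \<zeta>) \<le> e" if e: "e > 0" for e
    proof -
      obtain t where t: "t < 1"
        "\<And>\<zeta>. t \<le> norm \<zeta> \<Longrightarrow> norm \<zeta> < 1 \<Longrightarrow> (norm (u \<zeta>))\<^sup>2 + (norm (v \<zeta>))\<^sup>2 > 2 * (S * D / e)\<^sup>2"
        using lim by metis
      have "norm (b \<zeta> * q \<zeta>) \<le> e" if \<zeta>: "\<zeta> \<in> closure ?\<Omega>" "t \<le> norm \<zeta>" "norm \<zeta> < 1" for \<zeta>
      proof -
        have "(norm (b \<zeta>))\<^sup>2 \<le> (norm (a \<zeta>))\<^sup>2" using clos[OF \<zeta>(1,3)] by (intro power_mono) auto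
        then have "(S * D / e)\<^sup>2 < (norm (a \<zeta>))\<^sup>2" using t(2)[OF \<zeta>(2,3)] ab(4)[of \<zeta>] by linarith
        then have a: "S * D / e < norm (a \<zeta>)" by (rule power2_less_imp_less) auto
        then have *: "S * D < e * norm (a \<zeta>)" using e by (simp add: field_simps)
        have Gp: "norm (G \<zeta>) > 0" using Gnz[OF \<zeta>(3)] by simp
        have "norm (b \<zeta>) * S * D \<le> norm (b \<zeta>) * (e * norm (a \<zeta>))"
          using * by (simp add: mult.assoc mult_left_mono)
        also have "\<dots> \<le> e * (D * norm (G \<zeta>))"
          using prod_le[OF \<zeta>(3)] ab(3)[of \<zeta>] e by (simp add: mult_ac)
        finally have "norm (b \<zeta>) * S \<le> e * norm (G \<zeta>)" using D by (simp add: mult_ac)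
        then have "norm (b \<zeta>) * (S / norm (G \<zeta>)) \<le> e" using Gp by (simp add: field_simps)
        then show ?thesis using bq[OF \<zeta>(3)] by linarith
      qed
      then show ?thesis using t(1) by blast
    qed
    show "b holomorphic_on ?\<Omega>" "q holomorphic_on ?\<Omega>"
      by (auto intro: holomorphic_on_subset[OF ab(2)] holomorphic_on_subset[OF holq])
    show "continuous_on (closure ?\<Omega> \<inter> unit_disc) b" "continuous_on (closure ?\<Omega> \<inter> unit_disc) q"
      by (auto intro: continuous_on_subset[OF cab(2)] continuous_on_subset[OF cab(3)])
  qed (use p qS(1) in auto)
  define a where "a = norm (G 0) / S"
  have "a < 1"
  proof -
    have "norm (G 0) < S" by (simp add: S_def)
    then show ?thesis using S by (simp add: a_def)
  qed
  from power_above_near_one[OF this r0(2), of m]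
  obtain \<rho> where \<rho>: "r0 < \<rho>" "0 < \<rho>" "\<rho> < 1" "a < \<rho> ^ m" by blast
  \<comment> \<open>The minimum principle for the zero-free function \<open>G\<close>.\<close>
  obtain p where p: "norm p = \<rho>" "norm (G p) \<le> norm (G 0)"
  proof (rule ccontr)
    assume "\<not> thesis"
    with that have less: "norm (G 0) < norm (G z)" if "norm z = \<rho>" for z using that not_less by blast
    have sub: "cball 0 \<rho> \<subseteq> unit_disc" using \<rho> by auto
    have hol: "(\<lambda>z. inverse (G z)) holomorphic_on unit_disc" using Gnz by (intro holomorphic_intros holG) auto
    have cs: "continuous_on (sphere (0::complex) \<rho>) (\<lambda>z. norm (inverse (G z)))"
      using sub by (intro continuous_intros continuous_on_subset[OF holomorphic_on_imp_continuous_on[OF hol]]) auto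
    have "sphere (0::complex) \<rho> \<noteq> {}" using \<rho>(2) by (auto intro!: exI[of _ "of_real \<rho>"])
    then obtain z0 where z0: "z0 \<in> sphere 0 \<rho>" "\<And>z. z \<in> sphere 0 \<rho> \<Longrightarrow> norm (inverse (G z)) \<le> norm (inverse (G z0))"
      using continuous_attains_sup[OF compact_sphere _ cs] by blast
    have le: "norm (inverse (G 0)) \<le> norm (inverse (G z0))"
    proof (rule maximum_modulus_frontier[where f="\<lambda>z. inverse (G z)" and S="cball 0 \<rho>"])
      show "(\<lambda>z. inverse (G z)) holomorphic_on interior (cball 0 \<rho>)"
        using \<rho> by (intro holomorphic_on_subset[OF hol]) auto
      show "continuous_on (closure (cball 0 \<rho>)) (\<lambda>z. inverse (G z))"
        using sub by (intro continuous_on_subset[OF holomorphic_on_imp_continuous_on[OF hol]]) auto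
    qed (use z0 \<rho> in \<open>auto simp: frontier_cball\<close>)
    have "norm (G z0) > norm (G 0)" using less z0 by auto
    moreover have "norm (G 0) > 0" using Gnz[of 0] by simp
    ultimately have "norm (inverse (G z0)) < norm (inverse (G 0))"
      unfolding norm_inverse by (rule less_imp_inverse_less)
    with le show False by simp
  qed
  have pd: "norm p < 1" "r0 < norm p" using p \<rho> by auto
  have q1: "norm (q p) > 1"
  proof -
    have "norm (G 0) < S * \<rho> ^ m" using \<rho>(4) S by (simp add: a_def field_simps)
    then have "norm (G p) < S * \<rho> ^ m" using p by linarith
    then show ?thesis using S p Gnz[OF pd(1)] by (simp add: q_def norm_divide norm_mult norm_power)
  qed
  have ne: "norm (u p) \<noteq> norm (v p)" using equal_norms[of p] p \<rho> by (auto simp: S_def)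
  have zero: False
    if ab: "a holomorphic_on unit_disc" "b holomorphic_on unit_disc"
      "\<And>\<zeta>. norm (a \<zeta>) * norm (b \<zeta>) = norm (u \<zeta>) * norm (v \<zeta>)"
      "\<And>\<zeta>. (norm (a \<zeta>))\<^sup>2 + (norm (b \<zeta>))\<^sup>2 = (norm (u \<zeta>))\<^sup>2 + (norm (v \<zeta>))\<^sup>2"
      "\<And>\<zeta>. norm (a \<zeta>) = norm (b \<zeta>) \<Longrightarrow> norm (u \<zeta>) = norm (v \<zeta>)"
      and lt: "norm (b p) < norm (a p)" for a b
  proof -
    let ?W = "(unit_disc - cball 0 r0) \<inter> (\<lambda>\<zeta>. (norm (a \<zeta>) - norm (b \<zeta>), norm (q \<zeta>))) -` ({0<..} \<times> {1<..})"
    have cab: "continuous_on unit_disc a" "continuous_on unit_disc b" "continuous_on unit_disc q"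
      using ab(1,2) holq by (auto intro: holomorphic_on_imp_continuous_on)
    have opW: "open ?W"
      by (rule continuous_open_preimage; (intro continuous_intros open_Diff open_Times)?)
         (auto intro: continuous_on_subset[OF cab(1)] continuous_on_subset[OF cab(2)] continuous_on_subset[OF cab(3)])
    have pW: "p \<in> ?W" using lt q1 pd by auto
    have b0: "b \<zeta> = 0" if "norm \<zeta> < 1" for \<zeta>
    proof (rule analytic_continuation_open[of ?W unit_disc b "\<lambda>_. 0"])
      show "?W \<noteq> {}" using pW by blast
      show "b z = 0" if "z \<in> ?W" for z using vanish[OF ab, of z] that by auto
    qed (use opW ab(2) that in auto)
    have "\<exists>r<1. \<forall>\<zeta>. r \<le> norm \<zeta> \<and> norm \<zeta> < 1 \<longrightarrow> norm (a \<zeta>) > R" for R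
    proof -
      obtain t where t: "t < 1"
        "\<And>\<zeta>. t \<le> norm \<zeta> \<Longrightarrow> norm \<zeta> < 1 \<Longrightarrow> (norm (u \<zeta>))\<^sup>2 + (norm (v \<zeta>))\<^sup>2 > R\<^sup>2"
        using lim by metis
      have "norm (a \<zeta>) > R" if "t \<le> norm \<zeta>" "norm \<zeta> < 1" for \<zeta>
        using t(2)[OF that] ab(4)[of \<zeta>] b0[OF that(2)] by (intro power2_less_imp_less[of R]) auto
      then show ?thesis using t(1) by blast
    qed
    then show False using no_proper_holomorphic_function_on_disc[OF ab(1)] by blast
  qed
  show False
  proof (cases "norm (v p) < norm (u p)")
    case True
    then show False by (intro zero[of u v] hol) auto
  next
    case False
    then show False using ne by (intro zero[of v u] hol) (auto simp: mult_ac add_ac)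
  qed
qed

text \<open>Since \<open>c \<ge> 1\<close>, \<open>rho c\<close> is at most \<open>rho 1\<close>, the real part of \<open>z\<^sub>1\<^sup>2 + z\<^sub>2\<^sup>2 = (z\<^sub>1 + i z\<^sub>2) (z\<^sub>1 - i z\<^sub>2)\<close>.\<close>
lemma rho_comp_unbounded_below:
  assumes f: "holomorphic_map_on f unit_disc" "proper_on_disc f" and c: "c \<ge> 1"
  shows "\<not> bdd_below ((\<lambda>\<zeta>. rho c (f \<zeta>)) ` unit_disc)"
proof
  assume "bdd_below ((\<lambda>\<zeta>. rho c (f \<zeta>)) ` unit_disc)"
  then obtain C where C: "\<And>\<zeta>. norm \<zeta> < 1 \<Longrightarrow> C \<le> rho c (f \<zeta>)"
    unfolding bdd_below_def by fastforce
  let ?u = "\<lambda>\<zeta>. fst (f \<zeta>) + \<i> * snd (f \<zeta>)" and ?v = "\<lambda>\<zeta>. fst (f \<zeta>) - \<i> * snd (f \<zeta>)"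
  show False
  proof (rule no_proper_pair_with_Re_product_bounded_below[of ?u ?v "- C"])
    show "?u holomorphic_on unit_disc" "?v holomorphic_on unit_disc"
      using f(1) unfolding holomorphic_map_on_def by (auto intro!: holomorphic_intros)
    show "Re (?u \<zeta> * ?v \<zeta>) \<ge> - (- C)" if "norm \<zeta> < 1" for \<zeta>
    proof -
      have "rho c (f \<zeta>) \<le> rho 1 (f \<zeta>)" unfolding rho_def using mult_right_mono[OF c, of "(Im (fst (f \<zeta>)))\<^sup>2 + (Im (snd (f \<zeta>)))\<^sup>2"] by simp
      also have "rho 1 (f \<zeta>) = Re (?u \<zeta> * ?v \<zeta>)" by (simp add: rho_def power2_eq_square algebra_simps)
      finally show ?thesis using C[OF that] by simp
    qed
    fix R
    obtain r where r: "r < 1" "\<And>\<zeta>. r \<le> norm \<zeta> \<Longrightarrow> norm \<zeta> < 1 \<Longrightarrow> norm (f \<zeta>) > sqrt \<bar>R\<bar>"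
      using proper_on_disc_leaves_balls[OF f(2), of "sqrt \<bar>R\<bar>"] by metis
    have "(norm (?u \<zeta>))\<^sup>2 + (norm (?v \<zeta>))\<^sup>2 > R" if "r \<le> norm \<zeta>" "norm \<zeta> < 1" for \<zeta>
    proof -
      have "\<bar>R\<bar> < (norm (f \<zeta>))\<^sup>2" using power_strict_mono[OF r(2)[OF that], of 2] by simp
      also have "(norm (f \<zeta>))\<^sup>2 = (norm (fst (f \<zeta>)))\<^sup>2 + (norm (snd (f \<zeta>)))\<^sup>2"
        by (simp add: norm_prod_def)
      also have "\<dots> \<le> 2 * \<dots>" by simp
      also have "\<dots> = (norm (?u \<zeta>))\<^sup>2 + (norm (?v \<zeta>))\<^sup>2"
        unfolding cmod_power2 by (simp add: power2_eq_square algebra_simps)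
      finally show ?thesis by simp
    qed
    then show "\<exists>r<1. \<forall>\<zeta>. r \<le> norm \<zeta> \<and> norm \<zeta> < 1 \<longrightarrow> (norm (?u \<zeta>))\<^sup>2 + (norm (?v \<zeta>))\<^sup>2 > R"
      using r(1) by blast
  qed
qed

section \<open>Conics along which rho grows\<close>

definition bilin :: "complex \<times> complex \<Rightarrow> complex \<times> complex \<Rightarrow> complex" where
  "bilin l w = fst l * fst w + snd l * snd w"

text \<open>
  The vector \<open>w\<close> with \<open>w\<^sub>1 + i w\<^sub>2 = p\<close> and \<open>w\<^sub>1 - i w\<^sub>2 = q\<close>. In these coordinates
  \<open>w\<^sub>1\<^sup>2 + w\<^sub>2\<^sup>2\<close> is the product \<open>p q\<close>.
\<close>
definition isotropic_vec :: "complex \<Rightarrow> complex \<Rightarrow> complex \<times> complex" where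
  "isotropic_vec p q = ((p + q) / 2, \<i> * (q - p) / 2)"

text \<open>
  With \<open>\<alpha> = (l\<^sub>1 - i l\<^sub>2) / 2\<close> and \<open>\<beta> = (l\<^sub>1 + i l\<^sub>2) / 2\<close>, the conic \<open>l \<cdot> w + b (w\<^sub>1\<^sup>2 + w\<^sub>2\<^sup>2) = 0\<close>
  reads \<open>\<alpha> p + \<beta> q + b p q = 0\<close>. As \<open>(p + \<beta> / b) (q + \<alpha> / b)\<close> is constant on it, it has the
  entire parametrisation below, which passes through \<open>w = 0\<close> at \<open>s = 0\<close>.
\<close>
definition conic :: "real \<Rightarrow> complex \<times> complex \<Rightarrow> complex \<Rightarrow> complex \<times> complex" where
  "conic b l s = isotropic_vec ((fst l + \<i> * snd l) / (2 * of_real b) * (exp s - 1))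
                          ((fst l - \<i> * snd l) / (2 * of_real b) * (exp (- s) - 1))"

lemma norm_isotropic_vec: "(norm (isotropic_vec p q))\<^sup>2 = ((norm p)\<^sup>2 + (norm q)\<^sup>2) / 2"
proof -
  have "(norm (isotropic_vec p q))\<^sup>2 = (norm ((p + q) / 2))\<^sup>2 + (norm (\<i> * (q - p) / 2))\<^sup>2"
    by (simp add: isotropic_vec_def norm_prod_def)
  also have "\<dots> = ((norm (p + q))\<^sup>2 + (norm (q - p))\<^sup>2) / 4"
    by (simp add: norm_divide norm_mult power_divide)
  also have "\<dots> = ((norm p)\<^sup>2 + (norm q)\<^sup>2) / 2"
    unfolding cmod_power2 by (simp add: power2_eq_square algebra_simps)
  finally show ?thesis .
qed

lemma rho_eq_norm_plus_square:
  "rho k w = (1 - k) / 2 * (norm w)\<^sup>2 + (1 + k) / 2 * Re ((fst w)\<^sup>2 + (snd w)\<^sup>2)"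
proof -
  have n: "(norm w)\<^sup>2 = (norm (fst w))\<^sup>2 + (norm (snd w))\<^sup>2" by (simp add: norm_prod_def)
  show ?thesis
    unfolding n cmod_power2 rho_def by (simp add: power2_eq_square field_simps)
qed

lemma isotropic_vec_square: "(fst (isotropic_vec p q))\<^sup>2 + (snd (isotropic_vec p q))\<^sup>2 = p * q"
  by (simp add: isotropic_vec_def power2_eq_square field_simps)

lemma bilin_isotropic_vec: "bilin l (isotropic_vec p q) = (fst l - \<i> * snd l) / 2 * p + (fst l + \<i> * snd l) / 2 * q"
  by (simp add: bilin_def isotropic_vec_def algebra_simps add_divide_distrib diff_divide_distrib)

lemma bilin_conic:
  assumes "k > -1"
  shows "Re (bilin l (conic ((1 + k) / 2) l s)) + rho k (conic ((1 + k) / 2) l s)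
    = (1 - k) / 2 * (norm (conic ((1 + k) / 2) l s))\<^sup>2"
proof -
  define b :: complex where "b = of_real ((1 + k) / 2)"
  define w where "w = conic ((1 + k) / 2) l s"
  define \<alpha> where "\<alpha> = (fst l - \<i> * snd l) / 2"
  define \<beta> where "\<beta> = (fst l + \<i> * snd l) / 2"
  have b: "b \<noteq> 0" using assms by (simp only: b_def of_real_eq_0_iff) simp
  define p q where "p = \<beta> / b * (exp s - 1)" and "q = \<alpha> / b * (exp (-s) - 1)"
  have w: "w = isotropic_vec p q" by (simp add: w_def conic_def p_def q_def \<alpha>_def \<beta>_def b_def)
  have "bilin l w + b * ((fst w)\<^sup>2 + (snd w)\<^sup>2) = \<alpha> * p + \<beta> * q + b * p * q"
    unfolding w bilin_isotropic_vec isotropic_vec_square by (simp add: \<alpha>_def \<beta>_def)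
  moreover have "\<alpha> * p + \<beta> * q + b * p * q = 0"
  proof -
    have "\<alpha> * p + \<beta> * q + b * p * q = \<alpha> * \<beta> / b * ((exp s - 1) + (exp (-s) - 1) + (exp s - 1) * (exp (-s) - 1))"
      using b by (simp add: p_def q_def field_simps)
    also have "(exp s - 1) + (exp (-s) - 1) + (exp s - 1) * (exp (-s) - 1) = 0"
      by (simp add: algebra_simps flip: exp_add)
    finally show ?thesis by simp
  qed
  ultimately have "bilin l w + b * ((fst w)\<^sup>2 + (snd w)\<^sup>2) = 0" by simp
  then have "Re (bilin l w + b * ((fst w)\<^sup>2 + (snd w)\<^sup>2)) = 0" by simp
  then have "Re (bilin l w) + (1 + k) / 2 * Re ((fst w)\<^sup>2 + (snd w)\<^sup>2) = 0"
    by (simp add: b_def del: of_real_divide of_real_add)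
  then show ?thesis unfolding rho_eq_norm_plus_square[of k] by (simp add: w_def)
qed

lemma norm_exp_minus_one_ge:
  fixes s :: complex
  assumes "norm s \<le> 1 / 4"
  shows "norm (exp s - 1) \<ge> norm s / 4"
proof -
  have "\<bar>Re s\<bar> \<le> 1 / 4" using assms abs_Re_le_cmod[of s] by linarith
  then have "exp \<bar>Re s\<bar> \<le> exp (1 / 2)" by simp
  also have "exp (1 / 2) \<le> (2::real)" by (rule exp_half_le2)
  finally have e: "exp \<bar>Re s\<bar> \<le> 2" .
  have "norm (exp s - (\<Sum>i\<le>1. s ^ i / fact i)) \<le> exp \<bar>Re s\<bar> * (norm s ^ Suc 1) / fact 1"
    by (rule Taylor_exp)
  then have "norm (exp s - 1 - s) \<le> exp \<bar>Re s\<bar> * (norm s * norm s)"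
    by (simp add: diff_diff_eq)
  also have "\<dots> \<le> 2 * (1 / 4 * norm s)"
    using assms e by (intro mult_mono mult_right_mono) auto
  finally have "norm (exp s - 1 - s) \<le> norm s / 2" by simp
  moreover have "norm s \<le> norm (exp s - 1) + norm (exp s - 1 - s)"
    using norm_triangle_ineq4[of "exp s - 1" "exp s - 1 - s"] by simp
  ultimately show ?thesis using norm_ge_zero[of s] by linarith
qed

text \<open>
  Near \<open>s = 0\<close> both exponential factors are comparable to \<open>s\<close>. The bound degenerates only for
  \<open>l = 0\<close>, that is, at critical points of the function to be pushed.
\<close>
lemma norm_conic_ge:
  assumes "b > 0" "norm s \<le> 1 / 4"
  shows "(norm (conic b l s))\<^sup>2 \<ge> (norm l * norm s)\<^sup>2 / (64 * b\<^sup>2)"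
proof -
  let ?P = "fst l + \<i> * snd l" and ?Q = "fst l - \<i> * snd l"
  have e: "(norm s / 4)\<^sup>2 \<le> (norm (exp s - 1))\<^sup>2" "(norm s / 4)\<^sup>2 \<le> (norm (exp (- s) - 1))\<^sup>2"
    using norm_exp_minus_one_ge[of s] norm_exp_minus_one_ge[of "- s"] assms by (auto intro!: power_mono)
  have "(norm (conic b l s))\<^sup>2 = ((norm ?P)\<^sup>2 * (norm (exp s - 1))\<^sup>2 + (norm ?Q)\<^sup>2 * (norm (exp (- s) - 1))\<^sup>2) / (8 * b\<^sup>2)"
    unfolding conic_def norm_isotropic_vec norm_mult norm_divide power_mult_distrib power_divide
    using assms(1) by (simp add: add_divide_distrib)
  also have "\<dots> \<ge> ((norm ?P)\<^sup>2 * (norm s / 4)\<^sup>2 + (norm ?Q)\<^sup>2 * (norm s / 4)\<^sup>2) / (8 * b\<^sup>2)"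
    by (intro divide_right_mono add_mono mult_left_mono e) auto
  also have "((norm ?P)\<^sup>2 * (norm s / 4)\<^sup>2 + (norm ?Q)\<^sup>2 * (norm s / 4)\<^sup>2) / (8 * b\<^sup>2)
      = ((norm ?P)\<^sup>2 + (norm ?Q)\<^sup>2) * ((norm s)\<^sup>2 / (128 * b\<^sup>2))"
    by (simp add: power_divide field_simps)
  also have "(norm ?P)\<^sup>2 + (norm ?Q)\<^sup>2 = 2 * ((norm (fst l))\<^sup>2 + (norm (snd l))\<^sup>2)"
    unfolding cmod_power2 by (simp add: power2_eq_square algebra_simps)
  also have "(norm (fst l))\<^sup>2 + (norm (snd l))\<^sup>2 = (norm l)\<^sup>2" by (simp add: norm_prod_def)
  finally show ?thesis by (simp add: power_mult_distrib mult_ac)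
qed

section \<open>A perturbation of rho without critical points of positive value\<close>

definition re_part :: "complex \<times> complex \<Rightarrow> real \<times> real" where
  "re_part z = (Re (fst z), Re (snd z))"
definition im_part :: "complex \<times> complex \<Rightarrow> real \<times> real" where
  "im_part z = (Im (fst z), Im (snd z))"

lemma rho_parts: "rho c z = (norm (re_part z))\<^sup>2 - c * (norm (im_part z))\<^sup>2"
  by (simp add: rho_def re_part_def im_part_def norm_prod_def)

text \<open>Its norm is the distance to the ball, and twice this vector is the gradient of the squared distance.\<close>
definition excess :: "real \<Rightarrow> real \<times> real \<Rightarrow> real \<times> real" where
  "excess R y = y - closest_point (cball 0 R) y"

text \<open>
  Expand \<open>|u' - u|\<^sup>2 \<ge> 0\<close> for the two excess vectors; the error term has the right sign because
  the nearest point makes an obtuse angle with every other point of the ball.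
\<close>
lemma dist_sq_convex:
  assumes "R \<ge> 0"
  shows "(norm (excess R y'))\<^sup>2 \<ge> (norm (excess R y))\<^sup>2 + 2 * (excess R y \<bullet> (y' - y))"
proof -
  let ?P = "closest_point (cball 0 R) y" and ?P' = "closest_point (cball 0 R) y'"
  have "?P' \<in> cball 0 R" using assms by (intro closest_point_in_set) auto
  then have *: "(y - ?P) \<bullet> (?P' - ?P) \<le> 0" by (intro closest_point_dot) auto
  let ?u = "excess R y" and ?u' = "excess R y'"
  have "0 \<le> (norm (?u' - ?u))\<^sup>2" by simp
  also have "\<dots> = (norm ?u')\<^sup>2 - (norm ?u)\<^sup>2 - 2 * (?u \<bullet> (?u' - ?u))"
    by (simp add: power2_norm_eq_inner inner_diff inner_commute)
  also have "?u \<bullet> (?u' - ?u) = ?u \<bullet> (y' - y) - ?u \<bullet> (?P' - ?P)"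
    by (simp add: excess_def inner_diff)
  finally show ?thesis using * by (simp add: excess_def)
qed

text \<open>
  The expression \<open>|y'|\<^sup>2 - |y' - P|\<^sup>2\<close> is affine in \<open>y'\<close> for every fixed \<open>P\<close>, and the left-hand side is its
  supremum over \<open>P\<close> in the ball.
\<close>
lemma norm_sq_minus_dist_sq_convex:
  assumes "R \<ge> 0"
  shows "(norm y')\<^sup>2 - (norm (excess R y'))\<^sup>2
     \<ge> (norm y)\<^sup>2 - (norm (excess R y))\<^sup>2 + 2 * ((y - excess R y) \<bullet> (y' - y))"
proof -
  let ?P = "closest_point (cball 0 R) y"
  have "?P \<in> cball 0 R" using assms by (intro closest_point_in_set) auto
  then have "dist y' (closest_point (cball 0 R) y') \<le> dist y' ?P" by (intro closest_point_le) auto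
  then have "(norm (excess R y'))\<^sup>2 \<le> (norm (y' - ?P))\<^sup>2"
    by (auto simp: excess_def dist_norm intro: power_mono)
  also have "\<dots> = (norm y')\<^sup>2 - (norm y)\<^sup>2 + (norm (y - ?P))\<^sup>2 - 2 * (?P \<bullet> (y' - y))"
    by (simp add: power2_norm_eq_inner inner_diff inner_commute)
  finally show ?thesis by (simp add: excess_def)
qed

lemma norm_excess:
  assumes "R \<ge> 0"
  shows "norm (excess R y) = max 0 (norm y - R)"
proof -
  let ?P = "closest_point (cball 0 R) y"
  have P: "norm ?P \<le> R" using closest_point_in_set[of "cball 0 R" y] assms by auto
  show ?thesis
  proof (cases "norm y \<le> R")
    case True
    then have "?P = y" by (intro closest_point_self) auto
    then show ?thesis using True by (simp add: excess_def)
  next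
    case False
    let ?q = "(R / norm y) *\<^sub>R y"
    have "?q \<in> cball 0 R" using assms False by auto
    then have "dist y ?P \<le> dist y ?q" by (intro closest_point_le) auto
    also have "y - ?q = (1 - R / norm y) *\<^sub>R y" by (simp add: algebra_simps)
    then have "dist y ?q = \<bar>1 - R / norm y\<bar> * norm y" by (simp add: dist_norm)
    also have "\<dots> = norm y - R"
    proof -
      have "1 - R / norm y \<ge> 0" using False assms by (simp add: divide_le_eq)
      moreover have "norm y \<noteq> 0" using False assms by linarith
      ultimately show ?thesis by (simp add: left_diff_distrib)
    qed
    finally have "norm (excess R y) \<le> norm y - R" by (simp add: excess_def dist_norm)
    moreover have "norm y \<le> norm (excess R y) + norm ?P"
      using norm_triangle_ineq[of "y - ?P" ?P] by (simp add: excess_def)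
    ultimately show ?thesis using P False by simp
  qed
qed

lemma continuous_excess: "R \<ge> 0 \<Longrightarrow> continuous_on UNIV (excess R)"
  unfolding excess_def by (intro continuous_intros continuous_on_closest_point) auto

text \<open>
  The function is \<open>|x|\<^sup>2\<close> for \<open>|y| \<le> R\<close> and agrees with \<open>rho c\<close> up to an additive constant for
  \<open>|y| \<ge> k R / (k - c)\<close>. In between, \<open>|x|\<^sup>2 - k (|y| - R)\<^sup>2\<close> joins the two with continuous gradient;
  the second radius is the one that makes this possible. The join bends downwards in \<open>y\<close> no faster
  than \<open>- k |y|\<^sup>2\<close>, so for \<open>k < 1\<close> the function stays strictly plurisubharmonic.
\<close>
definition tau :: "real \<Rightarrow> real \<Rightarrow> real \<Rightarrow> complex \<times> complex \<Rightarrow> real" where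
  "tau k c R z = (norm (re_part z))\<^sup>2 - k * (norm (excess R (im_part z)))\<^sup>2
      + (k - c) * (norm (excess (k * R / (k - c)) (im_part z)))\<^sup>2"

text \<open>Minus one half of the gradient of \<open>tau k c R\<close> with respect to \<open>y\<close>.\<close>
definition tau_im_grad :: "real \<Rightarrow> real \<Rightarrow> real \<Rightarrow> complex \<times> complex \<Rightarrow> real \<times> real" where
  "tau_im_grad k c R z = k *\<^sub>R excess R (im_part z) - (k - c) *\<^sub>R excess (k * R / (k - c)) (im_part z)"

text \<open>
  The vector \<open>\<Lambda>\<close> for which \<open>Re (\<Lambda> \<cdot> w)\<close> is the derivative of \<open>tau k c R\<close> in the direction \<open>w\<close>; the
  imaginary parts enter with the sign that the complex bilinear product produces.
\<close>
definition tau_grad :: "real \<Rightarrow> real \<Rightarrow> real \<Rightarrow> complex \<times> complex \<Rightarrow> complex \<times> complex" where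
  "tau_grad k c R z = (let g = tau_im_grad k c R z in
     (2 * Complex (Re (fst z)) (fst g), 2 * Complex (Re (snd z)) (snd g)))"

text \<open>
  Adding \<open>k |y|\<^sup>2\<close> to \<open>tau k c R\<close> leaves \<open>|x|\<^sup>2\<close> plus a convex function of \<open>y\<close>; the latter lies above its tangents, and
  the two quadratic terms contribute exactly \<open>rho k w\<close>.
\<close>
lemma tau_lower:
  assumes "0 \<le> k" "c < k" "0 \<le> R"
  shows "tau k c R (z + w) \<ge> tau k c R z + Re (bilin (tau_grad k c R z) w) + rho k w"
proof -
  let ?R' = "k * R / (k - c)"
  let ?y = "im_part z" and ?v = "im_part w"
  have R': "?R' \<ge> 0" using assms by simp
  have im: "im_part (z + w) = ?y + ?v" "re_part (z + w) = re_part z + re_part w"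
    by (auto simp: im_part_def re_part_def)
  define g where "g = tau_im_grad k c R z"
  have 1: "k * ((norm (?y + ?v))\<^sup>2 - (norm (excess R (?y + ?v)))\<^sup>2)
    \<ge> k * ((norm ?y)\<^sup>2 - (norm (excess R ?y))\<^sup>2 + 2 * ((?y - excess R ?y) \<bullet> ?v))"
    using norm_sq_minus_dist_sq_convex[OF assms(3), of ?y "?y + ?v"] assms(1) by (intro mult_left_mono) auto
  have 2: "(k - c) * (norm (excess ?R' (?y + ?v)))\<^sup>2
    \<ge> (k - c) * ((norm (excess ?R' ?y))\<^sup>2 + 2 * (excess ?R' ?y \<bullet> ?v))"
    using dist_sq_convex[OF R', of ?y "?y + ?v"] assms(2) by (intro mult_left_mono) auto
  have 3: "(norm (re_part z + re_part w))\<^sup>2 = (norm (re_part z))\<^sup>2 + 2 * (re_part z \<bullet> re_part w) + (norm (re_part w))\<^sup>2"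
    by (simp add: power2_norm_eq_inner inner_add inner_commute)
  have 4: "(norm (?y + ?v))\<^sup>2 = (norm ?y)\<^sup>2 + 2 * (?y \<bullet> ?v) + (norm ?v)\<^sup>2"
    by (simp add: power2_norm_eq_inner inner_add inner_commute)
  have 5: "Re (bilin (tau_grad k c R z) w) = 2 * (re_part z \<bullet> re_part w) - 2 * (g \<bullet> ?v)"
    by (simp add: bilin_def tau_grad_def Let_def re_part_def im_part_def inner_prod_def g_def)
  have 6: "g \<bullet> ?v = k * (excess R ?y \<bullet> ?v) - (k - c) * (excess ?R' ?y \<bullet> ?v)"
    by (simp add: g_def tau_im_grad_def inner_diff_left)
  show ?thesis
    unfolding tau_def im rho_parts[of k w] 3 5 6
    using 1 2 4 by (simp add: inner_diff_left algebra_simps)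
qed

lemma continuous_tau:
  assumes "0 \<le> k" "c < k" "0 \<le> R"
  shows "continuous_on UNIV (tau k c R)" "continuous_on UNIV (tau_grad k c R)"
proof -
  have "k * R / (k - c) \<ge> 0" using assms by simp
  note e = continuous_on_compose2[OF continuous_excess[OF assms(3)]]
    continuous_on_compose2[OF continuous_excess[OF this]]
  show "continuous_on UNIV (tau k c R)"
    unfolding tau_def im_part_def re_part_def by (intro continuous_intros e) auto
  have *: "continuous_on UNIV (tau_im_grad k c R)"
    unfolding tau_im_grad_def im_part_def by (intro continuous_intros e) auto
  show "continuous_on UNIV (tau_grad k c R)"
    unfolding tau_grad_def Let_def Complex_eq by (intro continuous_intros * )
qed

lemma norm_tau_grad:
  "(norm (tau_grad k c R z))\<^sup>2 = 4 * (norm (re_part z))\<^sup>2 + 4 * (norm (tau_im_grad k c R z))\<^sup>2"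
  by (simp add: tau_grad_def Let_def norm_prod_def re_part_def norm_mult power_mult_distrib cmod_power2 algebra_simps)

lemma excess_0 [simp]: "excess 0 y = y"
  using closest_point_in_set[of "cball 0 0" y] by (simp add: excess_def)

lemma tau_0: "k \<noteq> c \<Longrightarrow> tau k c 0 z = rho c z"
  by (simp add: tau_def rho_parts algebra_simps)

lemma norm_tau_grad_0: "(norm (tau_grad k c 0 z))\<^sup>2 = 4 * ((norm (re_part z))\<^sup>2 + c\<^sup>2 * (norm (im_part z))\<^sup>2)"
proof -
  have "tau_im_grad k c 0 z = c *\<^sub>R im_part z" by (simp add: tau_im_grad_def algebra_simps)
  then show ?thesis unfolding norm_tau_grad by (simp add: power_mult_distrib)
qed

text \<open>
  With \<open>r\<close> for \<open>|y|\<close>, \<open>G\<close> is the term that \<open>tau k c R\<close> subtracts from \<open>|x|\<^sup>2\<close> in place of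
  \<open>c |y|\<^sup>2\<close>. For \<open>R < r \<le> k R / (k - c)\<close> the last bound holds because
  the two sides differ by \<open>(k - c) (r - k R / (k - c))\<^sup>2\<close>.
\<close>
lemma im_penalty_bounds:
  fixes k c R r :: real
  assumes "0 < c" "c < k" "0 \<le> R" "0 \<le> r"
  defines "G \<equiv> k * (max 0 (r - R))\<^sup>2 - (k - c) * (max 0 (r - k * R / (k - c)))\<^sup>2"
  shows "0 \<le> G" "G \<le> max 0 (c * (r\<^sup>2 - R\<^sup>2))" "G \<ge> c * r\<^sup>2 - k * c * R\<^sup>2 / (k - c)"
proof -
  let ?R = "k * R / (k - c)"
  have kc: "k - c > 0" using assms by simp
  have key: "k * (r - R)\<^sup>2 - (k - c) * (r - ?R)\<^sup>2 = c * r\<^sup>2 - k * c * R\<^sup>2 / (k - c)"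
  proof -
    have 1: "(k - c) * ?R = k * R" using kc by simp
    have "(k - c) * (r - Q)\<^sup>2 = (k - c) * r\<^sup>2 - 2 * r * ((k - c) * Q) + (k - c) * Q * Q" for Q
      by (simp add: power2_eq_square algebra_simps)
    from this[of ?R]
    have "(k - c) * (r - ?R)\<^sup>2 = (k - c) * r\<^sup>2 - 2 * r * (k * R) + k * R * ?R" unfolding 1 .
    then have "k * (r - R)\<^sup>2 - (k - c) * (r - ?R)\<^sup>2
        = k * (r - R)\<^sup>2 - ((k - c) * r\<^sup>2 - 2 * r * (k * R) + k * R * ?R)" by (rule arg_cong)
    also have "\<dots> = c * r\<^sup>2 + k * R\<^sup>2 - k * R * ?R"
      unfolding power2_eq_square by (simp only: algebra_simps)
    also have "k * R * ?R = k * k * (R\<^sup>2 / (k - c))" by (simp add: power2_eq_square)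
    also have "k * R\<^sup>2 = k * (k - c) * (R\<^sup>2 / (k - c))" using kc by simp
    finally have "k * (r - R)\<^sup>2 - (k - c) * (r - ?R)\<^sup>2
        = c * r\<^sup>2 + k * (k - c) * (R\<^sup>2 / (k - c)) - k * k * (R\<^sup>2 / (k - c))" .
    also have "\<dots> = c * r\<^sup>2 - k * c * (R\<^sup>2 / (k - c))" by (simp only: algebra_simps)
    finally show ?thesis by simp
  qed
  have RR: "R \<le> ?R" using assms kc by (simp add: field_simps mult_right_mono)
  have eta: "c * R\<^sup>2 \<le> k * c * R\<^sup>2 / (k - c)" using assms kc by (simp add: field_simps)
  consider "r \<le> R" | "R < r" "r \<le> ?R" | "?R < r" by linarith
  then have "0 \<le> G \<and> G \<le> max 0 (c * (r\<^sup>2 - R\<^sup>2)) \<and> G \<ge> c * r\<^sup>2 - k * c * R\<^sup>2 / (k - c)"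
  proof cases
    case 1
    then have "G = 0" using RR by (simp add: G_def)
    moreover have "c * r\<^sup>2 \<le> c * R\<^sup>2" using 1 assms by (intro mult_left_mono power_mono) auto
    ultimately show ?thesis using eta by auto
  next
    case 2
    then have G: "G = k * (r - R)\<^sup>2" by (simp add: G_def)
    have "(k - c) * r \<le> k * R" using 2(2) kc by (simp add: pos_le_divide_eq mult.commute)
    moreover have "0 \<le> c * R" using assms by simp
    ultimately have "k * (r - R) \<le> c * (r + R)"
      unfolding left_diff_distrib right_diff_distrib distrib_left by linarith
    then have "k * (r - R) * (r - R) \<le> c * (r + R) * (r - R)" using 2 by (intro mult_right_mono) auto
    then have "G \<le> c * (r\<^sup>2 - R\<^sup>2)" by (simp add: G power2_eq_square algebra_simps)
    moreover have "0 \<le> (k - c) * (r - ?R)\<^sup>2" using kc by simp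
    then have "G \<ge> c * r\<^sup>2 - k * c * R\<^sup>2 / (k - c)" using key G by linarith
    moreover have "0 \<le> G" using G assms by simp
    ultimately show ?thesis by auto
  next
    case 3
    then have "G = c * r\<^sup>2 - k * c * R\<^sup>2 / (k - c)" using key RR by (simp add: G_def)
    moreover have "c * r\<^sup>2 \<ge> k * c * R\<^sup>2 / (k - c)"
    proof -
      have "c * r\<^sup>2 \<ge> c * ?R\<^sup>2" using 3 RR assms by (intro mult_left_mono power_mono) auto
      also have "c * ?R\<^sup>2 = k * c * R\<^sup>2 / (k - c) * (k / (k - c))" by (simp add: power2_eq_square)
      moreover have "k * c * R\<^sup>2 / (k - c) * (k / (k - c)) \<ge> k * c * R\<^sup>2 / (k - c) * 1"
        using kc assms by (intro mult_left_mono) (auto simp: field_simps)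
      ultimately show ?thesis by simp
    qed
    ultimately show ?thesis using eta by (auto simp: algebra_simps max_def)
  qed
  then show "0 \<le> G" "G \<le> max 0 (c * (r\<^sup>2 - R\<^sup>2))" "G \<ge> c * r\<^sup>2 - k * c * R\<^sup>2 / (k - c)" by auto
qed

text \<open>
  The last claim is the reason for introducing \<open>tau\<close>: points slightly below the saddle of \<open>rho c\<close>
  already lie above the critical level \<open>0\<close> of \<open>tau k c R\<close>, provided that they avoid \<open>x = 0\<close>.
\<close>
lemma tau_rho_bounds:
  assumes "0 < c" "c < k" "0 \<le> R"
  shows "rho c z \<le> tau k c R z" "tau k c R z \<le> rho c z + k * c * R\<^sup>2 / (k - c)"
    "tau k c R z \<le> (norm (re_part z))\<^sup>2"
    "re_part z \<noteq> 0 \<Longrightarrow> rho c z > - c * R\<^sup>2 \<Longrightarrow> tau k c R z > 0"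
proof -
  define G where "G = k * (max 0 (norm (im_part z) - R))\<^sup>2 - (k - c) * (max 0 (norm (im_part z) - k * R / (k - c)))\<^sup>2"
  have tG: "tau k c R z = (norm (re_part z))\<^sup>2 - G"
    using assms by (simp add: tau_def G_def norm_excess)
  note b = im_penalty_bounds[OF assms norm_ge_zero[of "im_part z"], folded G_def]
  have "c * ((norm (im_part z))\<^sup>2 - R\<^sup>2) \<le> c * (norm (im_part z))\<^sup>2" using assms by simp
  moreover have "0 \<le> c * (norm (im_part z))\<^sup>2" using assms by simp
  ultimately show "rho c z \<le> tau k c R z" using b(2) by (simp add: tG rho_parts)
  show "tau k c R z \<le> rho c z + k * c * R\<^sup>2 / (k - c)" using b(3) by (simp add: tG rho_parts)
  show "tau k c R z \<le> (norm (re_part z))\<^sup>2" using b(1) by (simp add: tG)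
  assume *: "re_part z \<noteq> 0" "rho c z > - c * R\<^sup>2"
  have "(norm (re_part z))\<^sup>2 > 0" using *(1) by simp
  moreover have "(norm (re_part z))\<^sup>2 > c * ((norm (im_part z))\<^sup>2 - R\<^sup>2)"
    using *(2) by (simp add: rho_parts algebra_simps)
  ultimately show "tau k c R z > 0" using b(2) unfolding tG by linarith
qed

section \<open>Laurent polynomial approximation on the circle\<close>

text \<open>On the circle \<open>cnj \<zeta> = 1 / \<zeta>\<close>, so the real and imaginary parts of \<open>\<zeta>\<close> are Laurent polynomials.\<close>
lemma real_polynomial_function_laurent:
  fixes g :: "complex \<Rightarrow> real"
  assumes "real_polynomial_function g"
  shows "\<exists>n B. B holomorphic_on UNIV \<and> (\<forall>\<zeta>\<in>sphere 0 1. of_real (g \<zeta>) * \<zeta> ^ n = B \<zeta>)"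
  using assms
proof induction
  case (linear f)
  then interpret f: bounded_linear f .
  define B where "B = (\<lambda>\<zeta>. of_real (f 1) * ((\<zeta>\<^sup>2 + 1) / 2) + of_real (f \<i>) * (- \<i> * (\<zeta>\<^sup>2 - 1) / 2))"
  have "of_real (f \<zeta>) * \<zeta> ^ 1 = B \<zeta>" if "norm \<zeta> = 1" for \<zeta>
  proof -
    have c: "cnj \<zeta> * \<zeta> = 1" using complex_norm_square[of \<zeta>] that by (simp add: mult.commute)
    have "\<zeta> = Re \<zeta> *\<^sub>R 1 + Im \<zeta> *\<^sub>R \<i>" by (simp add: complex_eq_iff)
    then have "f \<zeta> = Re \<zeta> * f 1 + Im \<zeta> * f \<i>" by (metis f.add f.scaleR real_scaleR_def)
    then have "of_real (f \<zeta>) * \<zeta> = of_real (f 1) * (of_real (Re \<zeta>) * \<zeta>) + of_real (f \<i>) * (of_real (Im \<zeta>) * \<zeta>)"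
      by (simp add: algebra_simps)
    also have "of_real (Re \<zeta>) * \<zeta> = (\<zeta>\<^sup>2 + cnj \<zeta> * \<zeta>) / 2"
      unfolding power2_eq_square by (simp flip: distrib_right add: complex_add_cnj)
    also have "of_real (Im \<zeta>) * \<zeta> = - \<i> * (\<zeta>\<^sup>2 - cnj \<zeta> * \<zeta>) / 2"
      unfolding power2_eq_square by (simp flip: left_diff_distrib add: complex_diff_cnj)
        (simp add: algebra_simps)
    finally show ?thesis unfolding c B_def by simp
  qed
  moreover have "B holomorphic_on UNIV" unfolding B_def by (intro holomorphic_intros) auto
  ultimately show ?case by (intro exI[of _ 1] exI[of _ B]) auto
next
  case (const c)
  show ?case by (intro exI[of _ 0] exI[of _ "\<lambda>_. of_real c"]) auto
next
  case (add f g)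
  then obtain m A n B where "A holomorphic_on UNIV" "\<forall>\<zeta>\<in>sphere 0 1. of_real (f \<zeta>) * \<zeta> ^ m = A \<zeta>"
    "B holomorphic_on UNIV" "\<forall>\<zeta>\<in>sphere 0 1. of_real (g \<zeta>) * \<zeta> ^ n = B \<zeta>" by blast
  then show ?case
    by (intro exI[of _ "m + n"] exI[of _ "\<lambda>\<zeta>. A \<zeta> * \<zeta> ^ n + B \<zeta> * \<zeta> ^ m"] conjI holomorphic_intros ballI)
       (auto simp: power_add algebra_simps dest!: bspec)
next
  case (mult f g)
  then obtain m A n B where "A holomorphic_on UNIV" "\<forall>\<zeta>\<in>sphere 0 1. of_real (f \<zeta>) * \<zeta> ^ m = A \<zeta>"
    "B holomorphic_on UNIV" "\<forall>\<zeta>\<in>sphere 0 1. of_real (g \<zeta>) * \<zeta> ^ n = B \<zeta>" by blast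
  then show ?case
    by (intro exI[of _ "m + n"] exI[of _ "\<lambda>\<zeta>. A \<zeta> * B \<zeta>"] conjI holomorphic_intros ballI)
       (auto simp: power_add algebra_simps dest!: bspec)
qed

lemma circle_laurent_approximation:
  fixes \<phi> :: "complex \<Rightarrow> complex"
  assumes "continuous_on (sphere 0 1) \<phi>" "e > 0"
  obtains n B where "B holomorphic_on UNIV" "\<And>\<zeta>. \<zeta> \<in> sphere 0 1 \<Longrightarrow> norm (B \<zeta> / \<zeta> ^ n - \<phi> \<zeta>) < e"
proof -
  obtain g where g: "polynomial_function g" "\<And>\<zeta>. \<zeta> \<in> sphere 0 1 \<Longrightarrow> norm (\<phi> \<zeta> - g \<zeta>) < e"
    using Stone_Weierstrass_polynomial_function[OF compact_sphere assms] by blast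
  have "real_polynomial_function (\<lambda>\<zeta>. Re (g \<zeta>))" "real_polynomial_function (\<lambda>\<zeta>. Im (g \<zeta>))"
    using g(1) bounded_linear_Re bounded_linear_Im unfolding polynomial_function_def o_def by blast+
  then obtain m A n B where AB: "A holomorphic_on UNIV" "\<forall>\<zeta>\<in>sphere 0 1. of_real (Re (g \<zeta>)) * \<zeta> ^ m = A \<zeta>"
    "B holomorphic_on UNIV" "\<forall>\<zeta>\<in>sphere 0 1. of_real (Im (g \<zeta>)) * \<zeta> ^ n = B \<zeta>"
    using real_polynomial_function_laurent by metis
  define C where "C = (\<lambda>\<zeta>. A \<zeta> * \<zeta> ^ n + \<i> * (B \<zeta> * \<zeta> ^ m))"
  show ?thesis
  proof (rule that[of C "m + n"])
    show "C holomorphic_on UNIV" unfolding C_def by (intro holomorphic_intros AB)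
    fix \<zeta> :: complex assume \<zeta>: "\<zeta> \<in> sphere 0 1"
    then have nz: "\<zeta> \<noteq> 0" by auto
    have "C \<zeta> = (of_real (Re (g \<zeta>)) * \<zeta> ^ m) * \<zeta> ^ n + \<i> * ((of_real (Im (g \<zeta>)) * \<zeta> ^ n) * \<zeta> ^ m)"
      using AB \<zeta> by (simp add: C_def)
    also have "\<dots> = (of_real (Re (g \<zeta>)) + \<i> * of_real (Im (g \<zeta>))) * \<zeta> ^ (m + n)"
      by (simp add: power_add algebra_simps)
    also have "of_real (Re (g \<zeta>)) + \<i> * of_real (Im (g \<zeta>)) = g \<zeta>" by (rule complex_eq[symmetric])
    finally have "C \<zeta> / \<zeta> ^ (m + n) = g \<zeta>" using nz by simp
    then show "norm (C \<zeta> / \<zeta> ^ (m + n) - \<phi> \<zeta>) < e" using g(2)[OF \<zeta>] by (simp add: norm_minus_commute)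
  qed
qed

lemma circle_laurent_approximation_pair:
  fixes L :: "complex \<Rightarrow> complex \<times> complex"
  assumes L: "continuous_on (sphere 0 1) L" and "e > 0"
  obtains n A B where "A holomorphic_on UNIV" "B holomorphic_on UNIV"
    "\<And>\<zeta>. \<zeta> \<in> sphere 0 1 \<Longrightarrow> dist (A \<zeta> / \<zeta> ^ n, B \<zeta> / \<zeta> ^ n) (L \<zeta>) < e"
proof -
  have e2: "e / 2 > 0" using assms by simp
  obtain m A where A: "A holomorphic_on UNIV" "\<And>\<zeta>. \<zeta> \<in> sphere 0 1 \<Longrightarrow> norm (A \<zeta> / \<zeta> ^ m - fst (L \<zeta>)) < e / 2"
    using circle_laurent_approximation[OF continuous_on_fst[OF L] e2] by metis
  obtain n B where B: "B holomorphic_on UNIV" "\<And>\<zeta>. \<zeta> \<in> sphere 0 1 \<Longrightarrow> norm (B \<zeta> / \<zeta> ^ n - snd (L \<zeta>)) < e / 2"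
    using circle_laurent_approximation[OF continuous_on_snd[OF L] e2] by metis
  show ?thesis
  proof (rule that[of "\<lambda>\<zeta>. A \<zeta> * \<zeta> ^ n" "\<lambda>\<zeta>. B \<zeta> * \<zeta> ^ m" "m + n"])
    fix \<zeta> :: complex assume \<zeta>: "\<zeta> \<in> sphere 0 1"
    then have nz: "\<zeta> \<noteq> 0" by auto
    have eq: "A \<zeta> * \<zeta> ^ n / \<zeta> ^ (m + n) = A \<zeta> / \<zeta> ^ m" "B \<zeta> * \<zeta> ^ m / \<zeta> ^ (m + n) = B \<zeta> / \<zeta> ^ n"
      using nz by (simp_all add: power_add)
    have "norm ((A \<zeta> / \<zeta> ^ m, B \<zeta> / \<zeta> ^ n) - L \<zeta>) \<le> norm (A \<zeta> / \<zeta> ^ m - fst (L \<zeta>)) + norm (B \<zeta> / \<zeta> ^ n - snd (L \<zeta>))"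
      using norm_Pair_le[of "A \<zeta> / \<zeta> ^ m - fst (L \<zeta>)" "B \<zeta> / \<zeta> ^ n - snd (L \<zeta>)"]
      by (cases "L \<zeta>") simp
    then show "dist (A \<zeta> * \<zeta> ^ n / \<zeta> ^ (m + n), B \<zeta> * \<zeta> ^ m / \<zeta> ^ (m + n)) (L \<zeta>) < e"
      using A(2)[OF \<zeta>] B(2)[OF \<zeta>] unfolding eq dist_norm by linarith
  qed (intro holomorphic_intros A B)+
qed

section \<open>Pushing the boundary of a disc upwards\<close>

definition disc_map :: "(complex \<Rightarrow> complex \<times> complex) \<Rightarrow> bool" where
  "disc_map h \<longleftrightarrow> continuous_on (cball 0 1) h \<and> holomorphic_map_on h unit_disc"

lemma exp_minus_one_factor:
  obtains E :: "complex \<Rightarrow> complex" where "E holomorphic_on UNIV" "\<And>s. exp s - 1 = s * E s"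
proof -
  let ?E = "\<lambda>z::complex. if z = 0 then deriv exp 0 else (exp z - exp 0) / (z - 0)"
  have "?E holomorphic_on UNIV" by (rule pole_lemma) (auto intro: holomorphic_intros)
  moreover have "exp s - 1 = s * ?E s" for s by auto
  ultimately show ?thesis by (rule that)
qed

lemma norm_isotropic_vec_scale: "norm (isotropic_vec (c * p) (c * q)) = norm c * norm (isotropic_vec p q)"
proof (rule power2_eq_imp_eq)
  show "(norm (isotropic_vec (c * p) (c * q)))\<^sup>2 = (norm c * norm (isotropic_vec p q))\<^sup>2"
    by (simp add: norm_isotropic_vec norm_mult power_mult_distrib algebra_simps)
qed auto

lemma continuous_on_isotropic_vec [continuous_intros]:
  "continuous_on S f \<Longrightarrow> continuous_on S g \<Longrightarrow> continuous_on S (\<lambda>x. isotropic_vec (f x) (g x))"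
  unfolding isotropic_vec_def by (intro continuous_intros) auto

lemma continuous_on_conic [continuous_intros]:
  "continuous_on S f \<Longrightarrow> continuous_on S g \<Longrightarrow> continuous_on S (\<lambda>x. conic b (f x) (g x))"
  unfolding conic_def divide_inverse by (intro continuous_intros)

text \<open>The product of the coefficient \<open>(1 - k) / 2\<close> of \<open>|w|\<^sup>2\<close> with the constant of \<open>norm_conic_ge\<close> for \<open>|s| = \<kappa>\<close>.\<close>
definition push_gain :: "real \<Rightarrow> real \<Rightarrow> real" where
  "push_gain k \<kappa> = (1 - k) * \<kappa>\<^sup>2 / (128 * ((1 + k) / 2)\<^sup>2)"

text \<open>
  The weight \<open>P\<close> multiplies the conic parameter: its zeros are points where a push changes nothing,
  the upper bound keeps the parameter in the range of \<open>norm_conic_ge\<close>, and \<open>\<kappa>\<close> guarantees a gain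
  on the circle.
\<close>
definition disc_weight :: "(complex \<Rightarrow> complex) \<Rightarrow> real \<Rightarrow> bool" where
  "disc_weight P \<kappa> \<longleftrightarrow> P holomorphic_on UNIV \<and> \<kappa> > 0 \<and>
     (\<forall>\<zeta>\<in>cball 0 1. norm (P \<zeta>) \<le> 1 / 4) \<and> (\<forall>\<zeta>\<in>sphere 0 1. \<kappa> \<le> norm (P \<zeta>))"

lemma disc_weight_exists:
  assumes "finite A" "A \<subseteq> unit_disc"
  obtains P \<kappa> where "disc_weight P \<kappa>" "\<And>a. a \<in> A \<Longrightarrow> P a = 0"
proof -
  define P :: "complex \<Rightarrow> complex" where "P = (\<lambda>\<zeta>. 1 / 4 * (\<Prod>a\<in>A. (\<zeta> - a) / 2))"
  have hol: "P holomorphic_on UNIV" unfolding P_def by (intro holomorphic_intros) auto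
  have le: "norm (P \<zeta>) \<le> 1 / 4" if "norm \<zeta> \<le> 1" for \<zeta>
  proof -
    have "norm ((\<zeta> - a) / 2) \<le> 1" if "a \<in> A" for a
      using norm_triangle_ineq4[of \<zeta> a] assms(2) that \<open>norm \<zeta> \<le> 1\<close> by (force simp: norm_divide)
    then have "(\<Prod>a\<in>A. norm ((\<zeta> - a) / 2)) \<le> 1" by (intro prod_le_1) auto
    then show ?thesis unfolding P_def norm_mult prod_norm[symmetric] by simp
  qed
  have "continuous_on (sphere 0 1) (\<lambda>\<zeta>. norm (P \<zeta>))"
    using hol by (intro continuous_intros holomorphic_on_imp_continuous_on) (auto intro: holomorphic_on_subset)
  moreover have "sphere (0::complex) 1 \<noteq> {}" by (auto intro!: exI[of _ 1])
  ultimately obtain z where z: "z \<in> sphere 0 1" "\<And>\<zeta>. \<zeta> \<in> sphere 0 1 \<Longrightarrow> norm (P z) \<le> norm (P \<zeta>)"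
    using continuous_attains_inf[OF compact_sphere] by blast
  have "P z \<noteq> 0" using z(1) assms by (auto simp: P_def)
  then have "disc_weight P (norm (P z))" using hol le z by (auto simp: disc_weight_def)
  moreover have "P a = 0" if "a \<in> A" for a using that assms(1) by (auto simp: P_def)
  ultimately show ?thesis by (rule that)
qed

text \<open>
  On the disc of radius \<open>rr n\<close> the steps from the \<open>n\<close>-th on form a geometric series, so the
  convergence is locally uniform in the open disc.
\<close>
lemma limit_of_disc_maps:
  fixes H :: "nat \<Rightarrow> complex \<Rightarrow> complex \<times> complex"
  assumes hol: "\<And>n. holomorphic_map_on (H n) unit_disc"
    and rr: "\<And>n. rr n \<le> rr (Suc n)" "\<And>b. b < 1 \<Longrightarrow> \<exists>n. b \<le> rr n"
    and d: "\<And>n \<zeta>. norm \<zeta> \<le> rr n \<Longrightarrow> dist (H (Suc n) \<zeta>) (H n \<zeta>) \<le> e / 2 ^ Suc n"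
    and e: "e > 0"
  obtains f where "holomorphic_map_on f unit_disc"
    "\<And>n \<zeta>. norm \<zeta> < 1 \<Longrightarrow> norm \<zeta> \<le> rr n \<Longrightarrow> dist (f \<zeta>) (H n \<zeta>) \<le> e / 2 ^ n"
    "\<And>\<zeta>. norm \<zeta> < 1 \<Longrightarrow> (\<lambda>n. H n \<zeta>) \<longlonglongrightarrow> f \<zeta>"
proof -
  have mono: "rr n \<le> rr (n + j)" for n j
    by (induction j) (auto intro: order_trans[OF _ rr(1)])
  have close: "dist (H (n + j) \<zeta>) (H n \<zeta>) \<le> e / 2 ^ n - e / 2 ^ (n + j)" if "norm \<zeta> \<le> rr n" for n j \<zeta>
  proof (induction j)
    case (Suc j)
    have "dist (H (Suc (n + j)) \<zeta>) (H (n + j) \<zeta>) \<le> e / 2 ^ Suc (n + j)"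
      using that mono[of n j] by (intro d) linarith
    moreover have "e / 2 ^ (n + j) = 2 * (e / 2 ^ Suc (n + j))" by simp
    ultimately show ?case
      using Suc dist_triangle[of "H (Suc (n + j)) \<zeta>" "H n \<zeta>" "H (n + j) \<zeta>"] by simp
  qed simp
  have close': "dist (H j \<zeta>) (H n \<zeta>) \<le> e / 2 ^ n" if "norm \<zeta> \<le> rr n" "n \<le> j" for n j \<zeta>
  proof -
    have "dist (H j \<zeta>) (H n \<zeta>) \<le> e / 2 ^ n - e / 2 ^ j" using close[OF that(1), of "j - n"] that(2) by simp
    moreover have "e / 2 ^ j \<ge> 0" using e by simp
    ultimately show ?thesis by linarith
  qed
  have small: "\<exists>n. e / 2 ^ n < \<delta>" if "\<delta> > 0" for \<delta>
  proof -
    have "\<delta> / e > 0" using that e by simp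
    then obtain n where "(1 / 2) ^ n < \<delta> / e" using real_arch_pow_inv[of "\<delta> / e" "1/2"] by auto
    then show ?thesis using e by (intro exI[of _ n]) (simp add: power_one_over field_simps)
  qed
  have "convergent (\<lambda>n. H n \<zeta>)" if \<zeta>: "norm \<zeta> < 1" for \<zeta>
  proof -
    obtain n0 where n0: "norm \<zeta> \<le> rr n0" using rr(2)[OF \<zeta>] by blast
    have "Cauchy (\<lambda>n. H n \<zeta>)"
    proof (rule metric_CauchyI)
      fix \<delta> :: real assume "\<delta> > 0"
      then obtain n1 where n1: "e / 2 ^ n1 < \<delta> / 2" using small[of "\<delta> / 2"] by auto
      let ?n = "n0 + n1"
      have "e / 2 ^ ?n \<le> e / 2 ^ n1" using e by (simp add: divide_left_mono power_increasing)
      then have *: "dist (H j \<zeta>) (H ?n \<zeta>) < \<delta> / 2" if "j \<ge> ?n" for j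
        using close'[OF _ that, of \<zeta>] n0 mono[of n0 n1] n1 by linarith
      show "\<exists>M. \<forall>m\<ge>M. \<forall>n\<ge>M. dist (H m \<zeta>) (H n \<zeta>) < \<delta>"
      proof (intro exI[of _ ?n] allI impI)
        fix m n assume "m \<ge> ?n" "n \<ge> ?n"
        then show "dist (H m \<zeta>) (H n \<zeta>) < \<delta>"
          using *[of m] *[of n] dist_triangle2[of "H m \<zeta>" "H n \<zeta>" "H ?n \<zeta>"] by linarith
      qed
    qed
    then show ?thesis by (simp add: Cauchy_convergent_iff)
  qed
  then have lim: "(\<lambda>n. H n \<zeta>) \<longlonglongrightarrow> lim (\<lambda>n. H n \<zeta>)" if "norm \<zeta> < 1" for \<zeta>
    using that by (simp add: convergent_LIMSEQ_iff)
  define f where "f = (\<lambda>\<zeta>. lim (\<lambda>n. H n \<zeta>))"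
  have fd: "dist (f \<zeta>) (H n \<zeta>) \<le> e / 2 ^ n" if "norm \<zeta> < 1" "norm \<zeta> \<le> rr n" for n \<zeta>
    unfolding f_def
  proof (rule tendsto_upperbound[OF tendsto_dist[OF lim[OF that(1)] tendsto_const]])
    show "\<forall>\<^sub>F j in sequentially. dist (H j \<zeta>) (H n \<zeta>) \<le> e / 2 ^ n"
      using eventually_ge_at_top[of n] by eventually_elim (rule close'[OF that(2)])
  qed simp
  have unif: "uniform_limit (cball x \<delta>) H f sequentially" if sub: "cball x \<delta> \<subseteq> unit_disc" and pos: "\<delta> > 0" for x \<delta>
  proof -
    obtain b where b: "b < 1" "cball x \<delta> \<subseteq> ball 0 b"
      using compact_subset_disc_radius[OF compact_cball sub] by metis
    obtain n0 where n0: "b \<le> rr n0" using rr(2)[OF b(1)] by blast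
    show ?thesis
      unfolding uniform_limit_iff
    proof (intro allI impI)
      fix \<epsilon> :: real assume "\<epsilon> > 0"
      then obtain n1 where n1: "e / 2 ^ n1 < \<epsilon>" using small by blast
      show "\<forall>\<^sub>F n in sequentially. \<forall>y\<in>cball x \<delta>. dist (H n y) (f y) < \<epsilon>"
        using eventually_ge_at_top[of "n0 + n1"]
      proof eventually_elim
        case (elim n)
        show ?case
        proof
          fix y assume y: "y \<in> cball x \<delta>"
          have "norm y < b" "norm y < 1" using y b sub by auto
          moreover have "b \<le> rr n" using n0 mono[of n0 "n - n0"] elim by simp
          ultimately have "dist (f y) (H n y) \<le> e / 2 ^ n" by (intro fd) auto
          also have "\<dots> \<le> e / 2 ^ n1" using e elim by (simp add: divide_left_mono power_increasing)
          finally show "dist (H n y) (f y) < \<epsilon>" using n1 by (simp add: dist_commute)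
        qed
      qed
    qed
  qed
  have ball_in: "\<exists>\<delta>>0. cball x \<delta> \<subseteq> unit_disc" if "x \<in> unit_disc" for x :: complex
    using that open_contains_cball[of unit_disc] by auto
  have "holomorphic_map_on f unit_disc"
    unfolding holomorphic_map_on_def
  proof
    show "(\<lambda>\<zeta>. fst (f \<zeta>)) holomorphic_on unit_disc"
    proof (rule holomorphic_uniform_sequence[of _ "\<lambda>n \<zeta>. fst (H n \<zeta>)"])
      fix x :: complex assume "x \<in> unit_disc"
      then obtain \<delta> where "\<delta> > 0" "cball x \<delta> \<subseteq> unit_disc" using ball_in by blast
      moreover have "uniform_limit (cball x \<delta>) (\<lambda>n \<zeta>. fst (H n \<zeta>)) (\<lambda>\<zeta>. fst (f \<zeta>)) sequentially"
        by (rule bounded_linear.uniform_limit[OF bounded_linear_fst unif]) (use calculation in auto)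
      ultimately show "\<exists>d>0. cball x d \<subseteq> unit_disc \<and> uniform_limit (cball x d) (\<lambda>n \<zeta>. fst (H n \<zeta>)) (\<lambda>\<zeta>. fst (f \<zeta>)) sequentially"
        by blast
    qed (use hol in \<open>auto simp: holomorphic_map_on_def\<close>)
    show "(\<lambda>\<zeta>. snd (f \<zeta>)) holomorphic_on unit_disc"
    proof (rule holomorphic_uniform_sequence[of _ "\<lambda>n \<zeta>. snd (H n \<zeta>)"])
      fix x :: complex assume "x \<in> unit_disc"
      then obtain \<delta> where "\<delta> > 0" "cball x \<delta> \<subseteq> unit_disc" using ball_in by blast
      moreover have "uniform_limit (cball x \<delta>) (\<lambda>n \<zeta>. snd (H n \<zeta>)) (\<lambda>\<zeta>. snd (f \<zeta>)) sequentially"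
        by (rule bounded_linear.uniform_limit[OF bounded_linear_snd unif]) (use calculation in auto)
      ultimately show "\<exists>d>0. cball x d \<subseteq> unit_disc \<and> uniform_limit (cball x d) (\<lambda>n \<zeta>. snd (H n \<zeta>)) (\<lambda>\<zeta>. snd (f \<zeta>)) sequentially"
        by blast
    qed (use hol in \<open>auto simp: holomorphic_map_on_def\<close>)
  qed
  moreover have "(\<lambda>n. H n \<zeta>) \<longlonglongrightarrow> f \<zeta>" if "norm \<zeta> < 1" for \<zeta>
    using lim[OF that] by (simp add: f_def)
  ultimately show ?thesis using that[OF _ fd] by blast
qed

lemma push_gain_pos: "-1 < k \<Longrightarrow> k < 1 \<Longrightarrow> \<kappa> > 0 \<Longrightarrow> push_gain k \<kappa> > 0"
  by (auto simp: push_gain_def intro!: divide_pos_pos mult_pos_pos zero_less_power)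

text \<open>
  The hypothesis \<open>low\<close> says that \<open>\<tau>\<close> has, at every point, a quadratic minorant with the same positive
  Levi form. It is a global inequality, so pushes need not be small.
\<close>
locale pushable =
  fixes k :: real and \<tau> :: "complex \<times> complex \<Rightarrow> real" and \<Lambda> :: "complex \<times> complex \<Rightarrow> complex \<times> complex"
  assumes k: "-1 < k" "k < 1"
    and cont: "continuous_on UNIV \<tau>" "continuous_on UNIV \<Lambda>"
    and low: "\<tau> (z + w) \<ge> \<tau> z + Re (bilin (\<Lambda> z) w) + rho k w"
begin

text \<open>
  The new map is \<open>h \<zeta>\<close> plus the point with parameter \<open>\<zeta>\<^sup>N\<^sup>+\<^sup>n P \<zeta>\<close> on the conic of the Laurent polynomial \<open>L\<close>
  that approximates \<open>\<Lambda> \<circ> h\<close> on the circle. On the circle no parameter loses height except through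
  that approximation, so by uniform continuity at most \<open>e\<close> is lost on a thin annulus next to it,
  whatever the parameter. The annulus is chosen before \<open>N\<close>, and on the remaining disc the change
  is uniformly small for large \<open>N\<close>.
\<close>
lemma push_step:
  assumes P: "disc_weight P \<kappa>" and h: "disc_map h" and e: "e > 0" and r: "r < 1"
  obtains h' where "disc_map h'"
    "\<And>\<zeta>. norm \<zeta> = 1 \<Longrightarrow> \<tau> (h' \<zeta>) > \<tau> (h \<zeta>) + push_gain k \<kappa> * (norm (\<Lambda> (h \<zeta>)))\<^sup>2 - e"
    "\<And>\<zeta>. norm \<zeta> \<le> 1 \<Longrightarrow> \<tau> (h' \<zeta>) > \<tau> (h \<zeta>) - e"
    "\<And>\<zeta>. norm \<zeta> \<le> r \<Longrightarrow> dist (h' \<zeta>) (h \<zeta>) < e"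
    "\<And>\<zeta>. P \<zeta> = 0 \<Longrightarrow> h' \<zeta> = h \<zeta>"
proof -
  have P: "P holomorphic_on UNIV" "\<And>\<zeta>. norm \<zeta> \<le> 1 \<Longrightarrow> norm (P \<zeta>) \<le> 1 / 4"
      "\<And>\<zeta>. norm \<zeta> = 1 \<Longrightarrow> \<kappa> \<le> norm (P \<zeta>)" "\<kappa> > 0"
    using P by (auto simp: disc_weight_def)
  define b where "b = (1 + k) / 2"
  have b: "b > 0" using k by (simp add: b_def)
  have hc: "continuous_on (cball 0 1) h" using h by (simp add: disc_map_def)
  have hs: "continuous_on (sphere 0 1) h" by (rule continuous_on_subset[OF hc]) auto
  have ch: "compact (h ` cball 0 1)" using hc by (intro compact_continuous_image) auto
  then obtain M0 where M0: "\<And>\<zeta>. norm \<zeta> \<le> 1 \<Longrightarrow> norm (h \<zeta>) \<le> M0"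
    by (rule compact_image_norm_bound) auto
  have cL: "continuous_on (sphere 0 1) (\<lambda>\<zeta>. \<Lambda> (h \<zeta>))"
    by (rule continuous_on_compose2[OF cont(2) hs]) auto
  then have "compact ((\<lambda>\<zeta>. \<Lambda> (h \<zeta>)) ` sphere 0 1)" by (intro compact_continuous_image) auto
  then obtain M1 where M1: "\<And>\<zeta>. norm \<zeta> = 1 \<Longrightarrow> norm (\<Lambda> (h \<zeta>)) \<le> M1"
    by (rule compact_image_norm_bound) auto
  define F where "F = (\<lambda>(z, l, s). \<tau> (z + conic b l s))"
  have cF: "continuous_on UNIV F"
    unfolding F_def case_prod_unfold
    by (intro continuous_on_compose2[OF cont(1)] continuous_intros) auto
  have "uniformly_continuous_on (cball 0 M0 \<times> cball 0 (M1 + 1) \<times> cball 0 1) F"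
    by (intro compact_uniformly_continuous continuous_on_subset[OF cF] compact_Times compact_cball) auto
  then obtain d1 where d1: "d1 > 0" "\<And>x y. \<lbrakk>x \<in> cball 0 M0 \<times> cball 0 (M1 + 1) \<times> cball 0 1;
      y \<in> cball 0 M0 \<times> cball 0 (M1 + 1) \<times> cball 0 1; dist y x < d1\<rbrakk> \<Longrightarrow> dist (F y) (F x) < e / 3"
    unfolding uniformly_continuous_on_def using e by (metis divide_pos_pos zero_less_numeral)
  have "min d1 1 > 0" using d1 by simp
  from circle_laurent_approximation_pair[OF cL this]
  obtain n A B where AB: "A holomorphic_on UNIV" "B holomorphic_on UNIV"
    "\<And>\<zeta>. norm \<zeta> = 1 \<Longrightarrow> dist (A \<zeta> / \<zeta> ^ n, B \<zeta> / \<zeta> ^ n) (\<Lambda> (h \<zeta>)) < min d1 1" by (metis mem_sphere_0)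
  define L where "L = (\<lambda>\<zeta>. (A \<zeta> / \<zeta> ^ n, B \<zeta> / \<zeta> ^ n))"
  have near: "F (h \<zeta>, L \<zeta>, s) > \<tau> (h \<zeta>) + (1 - k) / 2 * ((norm (\<Lambda> (h \<zeta>)) * norm s)\<^sup>2 / (64 * b\<^sup>2)) - e / 3"
    if \<zeta>: "norm \<zeta> = 1" and s: "norm s \<le> 1 / 4" for \<zeta> s
  proof -
    have dL: "dist (L \<zeta>) (\<Lambda> (h \<zeta>)) < d1" "dist (L \<zeta>) (\<Lambda> (h \<zeta>)) < 1" using AB(3)[OF \<zeta>] by (auto simp: L_def)
    have "norm (L \<zeta>) \<le> M1 + 1"
      using norm_triangle_ineq[of "L \<zeta> - \<Lambda> (h \<zeta>)" "\<Lambda> (h \<zeta>)"] dL(2) M1[OF \<zeta>] by (simp add: dist_norm)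
    moreover have "norm (\<Lambda> (h \<zeta>)) \<le> M1 + 1" using M1[OF \<zeta>] by simp
    moreover have "dist (h \<zeta>, L \<zeta>, s) (h \<zeta>, \<Lambda> (h \<zeta>), s) < d1" using dL(1) by (simp add: dist_Pair_Pair)
    ultimately have "dist (F (h \<zeta>, L \<zeta>, s)) (F (h \<zeta>, \<Lambda> (h \<zeta>), s)) < e / 3"
      using M0[of \<zeta>] \<zeta> s by (intro d1(2)) auto
    then have 1: "F (h \<zeta>, L \<zeta>, s) > F (h \<zeta>, \<Lambda> (h \<zeta>), s) - e / 3" unfolding dist_real_def by linarith
    let ?w = "conic b (\<Lambda> (h \<zeta>)) s"
    have "F (h \<zeta>, \<Lambda> (h \<zeta>), s) \<ge> \<tau> (h \<zeta>) + (Re (bilin (\<Lambda> (h \<zeta>)) ?w) + rho k ?w)"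
      using low[of "h \<zeta>" ?w] by (simp add: F_def)
    also have "Re (bilin (\<Lambda> (h \<zeta>)) ?w) + rho k ?w = (1 - k) / 2 * (norm ?w)\<^sup>2"
      unfolding b_def by (rule bilin_conic[OF k(1)])
    finally have 2: "F (h \<zeta>, \<Lambda> (h \<zeta>), s) \<ge> \<tau> (h \<zeta>) + (1 - k) / 2 * (norm ?w)\<^sup>2" .
    have "(1 - k) / 2 * ((norm (\<Lambda> (h \<zeta>)) * norm s)\<^sup>2 / (64 * b\<^sup>2)) \<le> (1 - k) / 2 * (norm ?w)\<^sup>2"
      using k norm_conic_ge[OF b s] by (intro mult_left_mono) auto
    with 1 2 show ?thesis by linarith
  qed
  let ?ann = "cball (0::complex) 1 - ball 0 (1 / 2)"
  define \<Psi> where "\<Psi> = (\<lambda>(\<zeta>, s). F (h \<zeta>, L \<zeta>, s) - \<tau> (h \<zeta>))"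
  have cAB: "continuous_on S A" "continuous_on S B" for S
    using AB(1,2) by (auto intro: holomorphic_on_imp_continuous_on holomorphic_on_subset)
  have c\<Psi>: "continuous_on (?ann \<times> cball 0 1) \<Psi>"
    unfolding \<Psi>_def L_def case_prod_unfold
    by (intro continuous_intros continuous_on_compose2[OF cF] continuous_on_compose2[OF cont(1)]
        continuous_on_compose2[OF hc] continuous_on_compose2[OF cAB(1)[of UNIV]] continuous_on_compose2[OF cAB(2)[of UNIV]]) auto
  have "compact (?ann \<times> cball (0::complex) 1)" by (intro compact_Times compact_diff compact_cball) auto
  then have "uniformly_continuous_on (?ann \<times> cball 0 1) \<Psi>"
    using c\<Psi> by (intro compact_uniformly_continuous)
  then obtain d2 where d2: "d2 > 0" "\<And>x y. \<lbrakk>x \<in> ?ann \<times> cball 0 1; y \<in> ?ann \<times> cball 0 1; dist y x < d2\<rbrakk>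
      \<Longrightarrow> dist (\<Psi> y) (\<Psi> x) < e / 3"
    unfolding uniformly_continuous_on_def using e by (metis divide_pos_pos zero_less_numeral)
  \<comment> \<open>The inner radius of the annulus: at least \<open>r\<close>, for the approximation on \<open>|\<zeta>| \<le> r\<close>, and at
    least \<open>1/2\<close>, to stay away from the poles of the Laurent polynomial.\<close>
  define r' where "r' = max (max r (1/2)) (1 - d2 / 2)"
  have r': "r \<le> r'" "1 / 2 \<le> r'" "1 - d2 < r'" "r' < 1"
    using r d2(1) unfolding r'_def by linarith+
  have annulus: "F (h \<zeta>, L \<zeta>, s) > \<tau> (h \<zeta>) - e" if \<zeta>: "r' \<le> norm \<zeta>" "norm \<zeta> \<le> 1" and s: "norm s \<le> 1 / 4" for \<zeta> s
  proof -
    have nz: "norm \<zeta> > 0" using \<zeta> r' by linarith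
    have n1: "norm (sgn \<zeta>) = 1" using nz by (simp add: norm_sgn)
    have "\<zeta> = of_real (norm \<zeta>) * sgn \<zeta>" using nz by (simp add: sgn_eq)
    then have "\<zeta> - sgn \<zeta> = of_real (norm \<zeta> - 1) * sgn \<zeta>" by (simp add: algebra_simps)
    then have "norm (\<zeta> - sgn \<zeta>) = \<bar>norm \<zeta> - 1\<bar>" by (simp only: norm_mult n1 norm_of_real) simp
    then have "dist (\<zeta>, s) (sgn \<zeta>, s) < d2" using \<zeta> r' by (simp add: dist_Pair_Pair dist_norm)
    then have "dist (\<Psi> (\<zeta>, s)) (\<Psi> (sgn \<zeta>, s)) < e / 3"
      using \<zeta> s r' n1 by (intro d2(2)) auto
    then have "\<Psi> (\<zeta>, s) > \<Psi> (sgn \<zeta>, s) - e / 3" unfolding dist_real_def by linarith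
    moreover have "(1 - k) / 2 * ((norm (\<Lambda> (h (sgn \<zeta>))) * norm s)\<^sup>2 / (64 * b\<^sup>2)) \<ge> 0"
      using k by (intro mult_nonneg_nonneg) auto
    then have "\<Psi> (sgn \<zeta>, s) > - e / 3" using near[OF n1 s] by (simp add: \<Psi>_def)
    ultimately show ?thesis using e by (simp add: \<Psi>_def)
  qed
  have "uniformly_continuous_on (cball 0 (M0 + 1)) \<tau>"
    by (intro compact_uniformly_continuous continuous_on_subset[OF cont(1)]) auto
  then obtain d3 where d3: "d3 > 0" "\<And>x y. \<lbrakk>x \<in> cball 0 (M0 + 1); y \<in> cball 0 (M0 + 1); dist y x < d3\<rbrakk> \<Longrightarrow> dist (\<tau> y) (\<tau> x) < e"
    unfolding uniformly_continuous_on_def using e by metis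
  obtain E :: "complex \<Rightarrow> complex" where E: "E holomorphic_on UNIV" "\<And>s. exp s - 1 = s * E s"
    using exp_minus_one_factor by metis
  have cE: "continuous_on UNIV E" "continuous_on UNIV P"
    using E(1) P(1) by (auto intro: holomorphic_on_imp_continuous_on)
  \<comment> \<open>The isotropic coordinates of the conic point, with the factor \<open>\<zeta>\<^sup>N\<close> removed and the pole at \<open>0\<close> cancelled.\<close>
  define p where "p = (\<lambda>\<zeta> s. (A \<zeta> + \<i> * B \<zeta>) / (2 * of_real b) * P \<zeta> * E s)"
  define q where "q = (\<lambda>\<zeta> s. - ((A \<zeta> - \<i> * B \<zeta>) / (2 * of_real b) * P \<zeta> * E (- s)))"
  have "continuous_on (cball 0 1 \<times> cball 0 1) (\<lambda>(\<zeta>, s). isotropic_vec (p \<zeta> s) (q \<zeta> s))"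
    unfolding p_def q_def case_prod_unfold divide_inverse
    by (intro continuous_intros continuous_on_compose2[OF cE(1)] continuous_on_compose2[OF cE(2)]
       continuous_on_compose2[OF cAB(1)[of UNIV]] continuous_on_compose2[OF cAB(2)[of UNIV]]) auto
  then have "compact ((\<lambda>(\<zeta>, s). isotropic_vec (p \<zeta> s) (q \<zeta> s)) ` (cball 0 1 \<times> cball 0 1))"
    by (intro compact_continuous_image compact_Times compact_cball)
  then obtain C where C: "\<And>\<zeta> s. norm \<zeta> \<le> 1 \<Longrightarrow> norm s \<le> 1 \<Longrightarrow> norm (isotropic_vec (p \<zeta> s) (q \<zeta> s)) \<le> C"
    by (rule compact_image_norm_bound) fastforce
  have "min (min e d3) 1 / (\<bar>C\<bar> + 1) > 0" using e d3 by simp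
  then obtain N where N: "r' ^ N < min (min e d3) 1 / (\<bar>C\<bar> + 1)"
    using real_arch_pow_inv[of _ r'] r' by blast
  define s where "s = (\<lambda>\<zeta>. \<zeta> ^ (N + n) * P \<zeta>)"
  define D where "D = (\<lambda>\<zeta>. isotropic_vec (\<zeta> ^ N * p \<zeta> (s \<zeta>)) (\<zeta> ^ N * q \<zeta> (s \<zeta>)))"
  have s_le: "norm (s \<zeta>) \<le> 1 / 4" if "norm \<zeta> \<le> 1" for \<zeta>
  proof -
    have "norm \<zeta> ^ (N + n) * norm (P \<zeta>) \<le> 1 * (1 / 4)"
      using P(2)[OF that] that by (intro mult_mono power_le_one) auto
    then show ?thesis by (simp add: s_def norm_mult norm_power)
  qed
  have Dconic: "D \<zeta> = conic b (L \<zeta>) (s \<zeta>)" if "\<zeta> \<noteq> 0" for \<zeta>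
  proof -
    have cancel: "a / \<zeta> ^ n / c * (s \<zeta> * x) = \<zeta> ^ N * (a / c * P \<zeta> * x)" for a c x
      using that by (simp add: s_def power_add)
    have sum: "A \<zeta> / \<zeta> ^ n + \<i> * (B \<zeta> / \<zeta> ^ n) = (A \<zeta> + \<i> * B \<zeta>) / \<zeta> ^ n"
      "A \<zeta> / \<zeta> ^ n - \<i> * (B \<zeta> / \<zeta> ^ n) = (A \<zeta> - \<i> * B \<zeta>) / \<zeta> ^ n"
      by (simp_all add: add_divide_distrib diff_divide_distrib)
    have "\<zeta> ^ N * p \<zeta> (s \<zeta>) = (A \<zeta> / \<zeta> ^ n + \<i> * (B \<zeta> / \<zeta> ^ n)) / (2 * of_real b) * (s \<zeta> * E (s \<zeta>))"
      unfolding sum cancel p_def by simp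
    moreover have "\<zeta> ^ N * q \<zeta> (s \<zeta>) = (A \<zeta> / \<zeta> ^ n - \<i> * (B \<zeta> / \<zeta> ^ n)) / (2 * of_real b) * (- s \<zeta> * E (- s \<zeta>))"
      unfolding sum using cancel[of "A \<zeta> - \<i> * B \<zeta>" "2 * of_real b" "- E (- s \<zeta>)"]
      by (simp add: q_def)
    ultimately show ?thesis unfolding D_def conic_def E(2) by (simp add: L_def)
  qed
  have D_small: "norm (D \<zeta>) < min (min e d3) 1" if "norm \<zeta> \<le> r'" for \<zeta>
  proof -
    have n1: "norm \<zeta> \<le> 1" using that r' by simp
    have "norm (D \<zeta>) = norm \<zeta> ^ N * norm (isotropic_vec (p \<zeta> (s \<zeta>)) (q \<zeta> (s \<zeta>)))"
      by (simp add: D_def norm_isotropic_vec_scale norm_power)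
    also have "\<dots> \<le> r' ^ N * (\<bar>C\<bar> + 1)"
      using C[OF n1, of "s \<zeta>"] s_le[OF n1] that r' by (intro mult_mono power_mono) auto
    also have "\<dots> < min (min e d3) 1" using N by (simp add: pos_less_divide_eq)
    finally show ?thesis .
  qed
  define h' where "h' = (\<lambda>\<zeta>. h \<zeta> + D \<zeta>)"
  have holD: "(\<lambda>\<zeta>. fst (D \<zeta>)) holomorphic_on UNIV" "(\<lambda>\<zeta>. snd (D \<zeta>)) holomorphic_on UNIV"
  proof -
    have hE: "(\<lambda>\<zeta>. E (s \<zeta>)) holomorphic_on UNIV" "(\<lambda>\<zeta>. E (- s \<zeta>)) holomorphic_on UNIV"
      unfolding s_def by (rule holomorphic_on_compose_gen[OF _ E(1), unfolded o_def]; (intro holomorphic_intros P)?; simp)+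
    then show "(\<lambda>\<zeta>. fst (D \<zeta>)) holomorphic_on UNIV" "(\<lambda>\<zeta>. snd (D \<zeta>)) holomorphic_on UNIV"
      using b by (auto simp: D_def isotropic_vec_def p_def q_def intro!: holomorphic_intros AB P)
  qed
  have cD: "continuous_on UNIV D"
    using continuous_on_Pair[OF holD[THEN holomorphic_on_imp_continuous_on]] by simp
  have F_eq: "\<tau> (h' \<zeta>) = F (h \<zeta>, L \<zeta>, s \<zeta>)" if "\<zeta> \<noteq> 0" for \<zeta>
    using Dconic[OF that] by (simp add: h'_def F_def)
  show ?thesis
  proof (rule that[of h'])
    show "disc_map h'"
      using h holD hc continuous_on_subset[OF cD]
      by (auto simp: disc_map_def h'_def holomorphic_map_on_def intro!: continuous_intros holomorphic_intros
          intro: holomorphic_on_subset)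
    show "\<tau> (h \<zeta>) + push_gain k \<kappa> * (norm (\<Lambda> (h \<zeta>)))\<^sup>2 - e < \<tau> (h' \<zeta>)" if \<zeta>: "norm \<zeta> = 1" for \<zeta>
    proof -
      have nz: "\<zeta> \<noteq> 0" using \<zeta> by auto
      have ns: "norm (s \<zeta>) \<ge> \<kappa>" using P(3)[OF \<zeta>] \<zeta> by (simp add: s_def norm_mult norm_power)
      then have "\<kappa>\<^sup>2 \<le> (norm (s \<zeta>))\<^sup>2" using P(4) by (intro power_mono) auto
      then have "(1 - k) / (128 * b\<^sup>2) * (norm (\<Lambda> (h \<zeta>)))\<^sup>2 * \<kappa>\<^sup>2 \<le> (1 - k) / (128 * b\<^sup>2) * (norm (\<Lambda> (h \<zeta>)))\<^sup>2 * (norm (s \<zeta>))\<^sup>2"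
        using k by (intro mult_left_mono mult_nonneg_nonneg) auto
      then have "push_gain k \<kappa> * (norm (\<Lambda> (h \<zeta>)))\<^sup>2
          \<le> (1 - k) / 2 * ((norm (\<Lambda> (h \<zeta>)) * norm (s \<zeta>))\<^sup>2 / (64 * b\<^sup>2))"
        unfolding push_gain_def b_def[symmetric] by (simp add: power_mult_distrib mult_ac)
      then show ?thesis using near[OF \<zeta>, of "s \<zeta>"] s_le[of \<zeta>] \<zeta> e unfolding F_eq[OF nz] by simp
    qed
    show "\<tau> (h \<zeta>) - e < \<tau> (h' \<zeta>)" if \<zeta>: "norm \<zeta> \<le> 1" for \<zeta>
    proof (cases "norm \<zeta> \<le> r'")
      case True
      have "dist (\<tau> (h' \<zeta>)) (\<tau> (h \<zeta>)) < e"
      proof (rule d3(2))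
        show "h' \<zeta> \<in> cball 0 (M0 + 1)" "h \<zeta> \<in> cball 0 (M0 + 1)"
          unfolding mem_cball_0 h'_def
          using D_small[OF True] M0[OF \<zeta>] norm_triangle_ineq[of "h \<zeta>" "D \<zeta>"] by linarith+
        show "dist (h' \<zeta>) (h \<zeta>) < d3" using D_small[OF True] by (simp add: h'_def dist_norm)
      qed
      then show ?thesis unfolding dist_real_def by linarith
    next
      case False
      then have "\<zeta> \<noteq> 0" using r' by auto
      then show ?thesis using annulus[OF _ \<zeta> s_le[OF \<zeta>]] False F_eq by simp
    qed
    show "dist (h' \<zeta>) (h \<zeta>) < e" if "norm \<zeta> \<le> r" for \<zeta>
      using D_small[of \<zeta>] that r' by (simp add: h'_def dist_norm)
    show "h' \<zeta> = h \<zeta>" if "P \<zeta> = 0" for \<zeta>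
      using that by (simp add: h'_def D_def p_def q_def isotropic_vec_def zero_prod_def)
  qed
qed

text \<open>
  Each step either gains \<open>g / 2\<close> at a boundary point or finds it above the level \<open>s\<close>, where it can lose at
  most \<open>\<delta>\<close>; finitely many steps suffice.
\<close>
lemma push_above_level:
  assumes P: "disc_weight P \<kappa>" and h: "disc_map h" and e: "e > 0" and r: "r < 1"
    and g: "g > 0" "\<And>z. \<tau> z \<le> s \<Longrightarrow> g \<le> push_gain k \<kappa> * (norm (\<Lambda> z))\<^sup>2" and \<delta>: "\<delta> > 0"
  obtains h' where "disc_map h'"
    "\<And>\<zeta>. norm \<zeta> = 1 \<Longrightarrow> \<tau> (h' \<zeta>) > s - \<delta>"
    "\<And>\<zeta>. norm \<zeta> \<le> 1 \<Longrightarrow> \<tau> (h' \<zeta>) > \<tau> (h \<zeta>) - e"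
    "\<And>\<zeta>. norm \<zeta> \<le> r \<Longrightarrow> dist (h' \<zeta>) (h \<zeta>) < e"
    "\<And>\<zeta>. P \<zeta> = 0 \<Longrightarrow> h' \<zeta> = h \<zeta>"
proof -
  obtain M where M: "\<And>\<zeta>. norm \<zeta> = 1 \<Longrightarrow> \<tau> (h \<zeta>) > M"
  proof -
    have "continuous_on (cball 0 1) h" using h by (simp add: disc_map_def)
    then have "continuous_on (cball 0 1) (\<lambda>\<zeta>. \<tau> (h \<zeta>))"
      by (rule continuous_on_compose2[OF cont(1)]) auto
    then have "compact ((\<lambda>\<zeta>. \<tau> (h \<zeta>)) ` cball 0 1)" by (rule compact_continuous_image) auto
    then obtain B where B: "\<And>\<zeta>. \<zeta> \<in> cball 0 1 \<Longrightarrow> norm (\<tau> (h \<zeta>)) \<le> B"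
      by (rule compact_image_norm_bound) blast
    have "\<tau> (h \<zeta>) > - B - 1" if "norm \<zeta> = 1" for \<zeta> using B[of \<zeta>] that by (auto simp: abs_le_iff)
    then show ?thesis by (rule that)
  qed
  have "\<exists>h'. disc_map h' \<and> (\<forall>\<zeta>. norm \<zeta> = 1 \<longrightarrow> \<tau> (h' \<zeta>) > min (s - \<delta>) (M + n * (g / 2))) \<and>
    (\<forall>\<zeta>. norm \<zeta> \<le> 1 \<longrightarrow> \<tau> (h' \<zeta>) > \<tau> (h \<zeta>) - e) \<and>
    (\<forall>\<zeta>. norm \<zeta> \<le> r \<longrightarrow> dist (h' \<zeta>) (h \<zeta>) < e) \<and> (\<forall>\<zeta>. P \<zeta> = 0 \<longrightarrow> h' \<zeta> = h \<zeta>)" for n :: nat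
    using e
  proof (induction n arbitrary: e)
    case 0
    show ?case using h 0 M by (intro exI[of _ h]) (auto intro: min.strict_coboundedI2)
  next
    case (Suc n)
    then have "e / 2 > 0" by simp
    from Suc.IH[OF this] obtain h1 where h1: "disc_map h1"
      "\<And>\<zeta>. norm \<zeta> = 1 \<Longrightarrow> \<tau> (h1 \<zeta>) > min (s - \<delta>) (M + n * (g / 2))"
      "\<And>\<zeta>. norm \<zeta> \<le> 1 \<Longrightarrow> \<tau> (h1 \<zeta>) > \<tau> (h \<zeta>) - e / 2"
      "\<And>\<zeta>. norm \<zeta> \<le> r \<Longrightarrow> dist (h1 \<zeta>) (h \<zeta>) < e / 2" "\<And>\<zeta>. P \<zeta> = 0 \<Longrightarrow> h1 \<zeta> = h \<zeta>" by blast
    define e1 where "e1 = min (e / 2) (min (g / 2) \<delta>)"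
    have e1: "e1 > 0" "e1 \<le> e / 2" "e1 \<le> g / 2" "e1 \<le> \<delta>" using Suc.prems g \<delta> by (auto simp: e1_def)
    from push_step[OF P h1(1) e1(1) r] obtain h2 where h2: "disc_map h2"
      "\<And>\<zeta>. norm \<zeta> = 1 \<Longrightarrow> \<tau> (h2 \<zeta>) > \<tau> (h1 \<zeta>) + push_gain k \<kappa> * (norm (\<Lambda> (h1 \<zeta>)))\<^sup>2 - e1"
      "\<And>\<zeta>. norm \<zeta> \<le> 1 \<Longrightarrow> \<tau> (h2 \<zeta>) > \<tau> (h1 \<zeta>) - e1"
      "\<And>\<zeta>. norm \<zeta> \<le> r \<Longrightarrow> dist (h2 \<zeta>) (h1 \<zeta>) < e1" "\<And>\<zeta>. P \<zeta> = 0 \<Longrightarrow> h2 \<zeta> = h1 \<zeta>" by blast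
    have "\<tau> (h2 \<zeta>) > min (s - \<delta>) (M + Suc n * (g / 2))" if \<zeta>: "norm \<zeta> = 1" for \<zeta>
    proof (cases "\<tau> (h1 \<zeta>) \<le> s")
      case True
      then have "\<tau> (h2 \<zeta>) > \<tau> (h1 \<zeta>) + g / 2" using h2(2)[OF \<zeta>] g(2)[OF True] e1 by linarith
      moreover have "M + Suc n * (g / 2) = M + n * (g / 2) + g / 2" by (simp add: algebra_simps)
      ultimately show ?thesis using h1(2)[OF \<zeta>] g(1) by linarith
    next
      case False
      then show ?thesis using h2(3)[of \<zeta>] \<zeta> e1 by linarith
    qed
    moreover have "\<tau> (h2 \<zeta>) > \<tau> (h \<zeta>) - e" if "norm \<zeta> \<le> 1" for \<zeta>
      using h1(3)[OF that] h2(3)[OF that] e1 by linarith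
    moreover have "dist (h2 \<zeta>) (h \<zeta>) < e" if "norm \<zeta> \<le> r" for \<zeta>
      using h1(4)[OF that] h2(4)[OF that] e1 dist_triangle[of "h2 \<zeta>" "h \<zeta>" "h1 \<zeta>"] by linarith
    ultimately show ?case using h2(1,5) h1(5) by (intro exI[of _ h2]) auto
  qed
  moreover obtain n :: nat where "(s - M) / (g / 2) < n" using reals_Archimedean2 by blast
  then have "s < M + n * (g / 2)" using g(1) by (simp add: pos_divide_less_eq)
  then have "min (s - \<delta>) (M + n * (g / 2)) = s - \<delta>" using \<delta> by simp
  ultimately show ?thesis using that by metis
qed

text \<open>
  The \<open>n\<close>-th map has boundary above the level \<open>m + n g / 2\<close>, hence also a collar \<open>rr n \<le> |\<zeta>| \<le> 1\<close>
  above it. All later steps together lower \<open>\<tau>\<close> by at most \<open>e0\<close> at any point, so the limit is above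
  \<open>m + n g / 2 - e0\<close> on that collar.
\<close>
lemma push_to_infinity:
  assumes P: "disc_weight P \<kappa>" and h: "disc_map h" and e: "e > 0" and r: "r < 1"
    and g: "g > 0" "\<And>z. \<tau> z \<ge> m \<Longrightarrow> g \<le> push_gain k \<kappa> * (norm (\<Lambda> z))\<^sup>2"
    and m: "\<And>\<zeta>. norm \<zeta> = 1 \<Longrightarrow> \<tau> (h \<zeta>) > m"
  obtains f where "holomorphic_map_on f unit_disc"
    "filterlim (\<lambda>\<zeta>. \<tau> (f \<zeta>)) at_top at_disc_boundary"
    "\<And>\<zeta>. norm \<zeta> < 1 \<Longrightarrow> \<tau> (f \<zeta>) > \<tau> (h \<zeta>) - e"
    "\<And>\<zeta>. norm \<zeta> \<le> r \<Longrightarrow> dist (f \<zeta>) (h \<zeta>) < e"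
    "\<And>\<zeta>. norm \<zeta> < 1 \<Longrightarrow> P \<zeta> = 0 \<Longrightarrow> f \<zeta> = h \<zeta>"
proof -
  \<comment> \<open>The total loss \<open>e0\<close> stays below \<open>e\<close>, and each single loss is at most half of the gain \<open>g\<close>.\<close>
  define e0 where "e0 = min e g / 2"
  have e0: "e0 > 0" "e0 < e" "e0 \<le> g / 2" using e g by (auto simp: e0_def)
  define Q where "Q = (\<lambda>n x. disc_map (fst x) \<and> r \<le> snd x \<and> snd x < 1 \<and> 1 - 1 / Suc n \<le> snd x \<and>
     (\<forall>\<zeta>. snd x \<le> norm \<zeta> \<and> norm \<zeta> \<le> 1 \<longrightarrow> \<tau> (fst x \<zeta>) > m + real n * (g / 2)) \<and> (n = 0 \<longrightarrow> fst x = h))"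
  define R where "R = (\<lambda>n (x :: (complex \<Rightarrow> complex \<times> complex) \<times> real) y. snd x \<le> snd y \<and>
     (\<forall>\<zeta>. norm \<zeta> \<le> 1 \<longrightarrow> \<tau> (fst y \<zeta>) > \<tau> (fst x \<zeta>) - e0 / 2 ^ Suc n) \<and>
     (\<forall>\<zeta>. norm \<zeta> \<le> snd x \<longrightarrow> dist (fst y \<zeta>) (fst x \<zeta>) < e0 / 2 ^ Suc n) \<and>
     (\<forall>\<zeta>. P \<zeta> = 0 \<longrightarrow> fst y \<zeta> = fst x \<zeta>))"
  have start: "\<exists>x. Q 0 x"
  proof -
    have "continuous_on (cball 0 1) h" using h by (simp add: disc_map_def)
    from boundary_collar[OF this cont(1) m, of "max r 0"] r obtain b where
      "max r 0 \<le> b" "0 < b" "b < 1" "\<And>\<zeta>. b \<le> norm \<zeta> \<Longrightarrow> norm \<zeta> \<le> 1 \<Longrightarrow> \<tau> (h \<zeta>) > m" by auto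
    then show ?thesis using h by (intro exI[of _ "(h, b)"]) (auto simp: Q_def)
  qed
  have next_step: "\<exists>y. Q (Suc n) y \<and> R n x y" if Qx: "Q n x" for n x
  proof -
    obtain h1 b where x: "x = (h1, b)" by (cases x)
    have h1: "disc_map h1" "r \<le> b" "b < 1" "\<And>\<zeta>. b \<le> norm \<zeta> \<Longrightarrow> norm \<zeta> \<le> 1 \<Longrightarrow> \<tau> (h1 \<zeta>) > m + real n * (g / 2)"
      using Qx by (auto simp: Q_def x)
    have e1: "e0 / 2 ^ Suc n > 0" "e0 / 2 ^ Suc n \<le> g / 2"
    proof -
      show "e0 / 2 ^ Suc n > 0" using e0 by simp
      have "e0 / 2 ^ Suc n \<le> e0 / 1" using e0 by (intro divide_left_mono one_le_power) auto
      then show "e0 / 2 ^ Suc n \<le> g / 2" using e0 by linarith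
    qed
    from push_step[OF P h1(1) e1(1) h1(3)] obtain h2 where h2: "disc_map h2"
      "\<And>\<zeta>. norm \<zeta> = 1 \<Longrightarrow> \<tau> (h2 \<zeta>) > \<tau> (h1 \<zeta>) + push_gain k \<kappa> * (norm (\<Lambda> (h1 \<zeta>)))\<^sup>2 - e0 / 2 ^ Suc n"
      "\<And>\<zeta>. norm \<zeta> \<le> 1 \<Longrightarrow> \<tau> (h2 \<zeta>) > \<tau> (h1 \<zeta>) - e0 / 2 ^ Suc n"
      "\<And>\<zeta>. norm \<zeta> \<le> b \<Longrightarrow> dist (h2 \<zeta>) (h1 \<zeta>) < e0 / 2 ^ Suc n" "\<And>\<zeta>. P \<zeta> = 0 \<Longrightarrow> h2 \<zeta> = h1 \<zeta>" by blast
    have "\<tau> (h2 \<zeta>) > m + real (Suc n) * (g / 2)" if \<zeta>: "norm \<zeta> = 1" for \<zeta>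
    proof -
      have t: "\<tau> (h1 \<zeta>) > m + real n * (g / 2)" using h1(3) h1(4)[of \<zeta>] \<zeta> by simp
      moreover have "real n * (g / 2) \<ge> 0" using g by simp
      ultimately have "\<tau> (h1 \<zeta>) \<ge> m" by linarith
      then have "\<tau> (h2 \<zeta>) > \<tau> (h1 \<zeta>) + g - e0 / 2 ^ Suc n" using h2(2)[OF \<zeta>] g(2)[of "h1 \<zeta>"] by linarith
      moreover have "real (Suc n) * (g / 2) = real n * (g / 2) + g / 2" by (simp add: algebra_simps)
      ultimately show ?thesis using t e1 by linarith
    qed
    moreover have "max b (1 - 1 / Suc (Suc n)) < 1" using h1 by simp
    moreover have "continuous_on (cball 0 1) h2" using h2 by (simp add: disc_map_def)
    ultimately obtain b2 where "max b (1 - 1 / Suc (Suc n)) \<le> b2" "0 < b2" "b2 < 1"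
      "\<And>\<zeta>. b2 \<le> norm \<zeta> \<Longrightarrow> norm \<zeta> \<le> 1 \<Longrightarrow> \<tau> (h2 \<zeta>) > m + real (Suc n) * (g / 2)"
      using boundary_collar[OF _ cont(1)] by metis
    then show ?thesis using h1 h2 by (intro exI[of _ "(h2, b2)"]) (auto simp: Q_def R_def x)
  qed
  obtain X where X: "\<And>n. Q n (X n)" "\<And>n. R n (X n) (X (Suc n))"
    using dependent_nat_choice[of Q R] start next_step by metis
  define H where "H = (\<lambda>n. fst (X n))"
  define rr where "rr = (\<lambda>n. snd (X n))"
  have H0: "H 0 = h" using X(1)[of 0] by (simp add: Q_def H_def)
  have Hlow: "\<tau> (H n \<zeta>) > m + real n * (g / 2)" if "rr n \<le> norm \<zeta>" "norm \<zeta> \<le> 1" for n \<zeta>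
    using X(1)[of n] that by (auto simp: Q_def H_def rr_def)
  have Hdm: "disc_map (H n)" and rrb: "r \<le> rr n" "rr n < 1" "1 - 1 / Suc n \<le> rr n" for n
    using X(1)[of n] by (auto simp: Q_def H_def rr_def)
  have step: "rr n \<le> rr (Suc n)" "\<And>\<zeta>. norm \<zeta> \<le> 1 \<Longrightarrow> \<tau> (H (Suc n) \<zeta>) > \<tau> (H n \<zeta>) - e0 / 2 ^ Suc n"
    "\<And>\<zeta>. norm \<zeta> \<le> rr n \<Longrightarrow> dist (H (Suc n) \<zeta>) (H n \<zeta>) < e0 / 2 ^ Suc n"
    "\<And>\<zeta>. P \<zeta> = 0 \<Longrightarrow> H (Suc n) \<zeta> = H n \<zeta>" for n
    using X(2)[of n] by (auto simp: R_def H_def rr_def)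
  have "\<exists>n. b \<le> rr n" if b: "b < 1" for b
  proof -
    obtain n where "1 / Suc n < 1 - b" by (rule nat_approx_posE[of "1 - b"]) (use b in auto)
    then show ?thesis using rrb(3)[of n] by (intro exI[of _ n]) linarith
  qed
  then obtain f where f: "holomorphic_map_on f unit_disc"
    "\<And>n \<zeta>. norm \<zeta> < 1 \<Longrightarrow> norm \<zeta> \<le> rr n \<Longrightarrow> dist (f \<zeta>) (H n \<zeta>) \<le> e0 / 2 ^ n"
    "\<And>\<zeta>. norm \<zeta> < 1 \<Longrightarrow> (\<lambda>n. H n \<zeta>) \<longlonglongrightarrow> f \<zeta>"
    using limit_of_disc_maps[of H rr e0] Hdm step(1,3) e0(1) less_imp_le unfolding disc_map_def by metis
  have loss: "\<tau> (H (n + j) \<zeta>) \<ge> \<tau> (H n \<zeta>) - (e0 / 2 ^ n - e0 / 2 ^ (n + j))" if "norm \<zeta> \<le> 1" for n j \<zeta>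
  proof (induction j)
    case (Suc j)
    have "e0 / 2 ^ (n + j) = 2 * (e0 / 2 ^ Suc (n + j))" by simp
    then show ?case using Suc step(2)[OF that, of "n + j"] by simp
  qed simp
  have flow: "\<tau> (f \<zeta>) \<ge> \<tau> (H n \<zeta>) - e0" if \<zeta>: "norm \<zeta> < 1" for n \<zeta>
  proof -
    have "isCont \<tau> (f \<zeta>)" using cont(1) continuous_on_eq_continuous_at[OF open_UNIV] by blast
    then have "(\<lambda>j. \<tau> (H j \<zeta>)) \<longlonglongrightarrow> \<tau> (f \<zeta>)" by (rule isCont_tendsto_compose) (rule f(3)[OF \<zeta>])
    then show ?thesis
    proof (rule tendsto_lowerbound)
      show "\<forall>\<^sub>F j in sequentially. \<tau> (H n \<zeta>) - e0 \<le> \<tau> (H j \<zeta>)"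
        using eventually_ge_at_top[of n]
      proof eventually_elim
        case (elim j)
        have "e0 / 2 ^ n \<le> e0 / 1" using e0 by (intro divide_left_mono) auto
        moreover have "e0 / 2 ^ j \<ge> 0" using e0 by simp
        ultimately show ?case using loss[of \<zeta> n "j - n"] \<zeta> elim by simp
      qed
    qed simp
  qed
  show ?thesis
  proof (rule that[OF f(1)])
    show "filterlim (\<lambda>\<zeta>. \<tau> (f \<zeta>)) at_top at_disc_boundary"
      unfolding filterlim_at_top
    proof
      fix Z :: real
      obtain n :: nat where "(Z + e0 - m) / (g / 2) < n" using reals_Archimedean2 by blast
      then have n: "Z + e0 < m + real n * (g / 2)" using g(1) by (simp add: pos_divide_less_eq)
      have "Z \<le> \<tau> (f \<zeta>)" if "rr n < norm \<zeta>" "norm \<zeta> < 1" for \<zeta>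
        using Hlow[of n \<zeta>] flow[OF that(2), of n] that n by linarith
      then show "\<forall>\<^sub>F \<zeta> in at_disc_boundary. Z \<le> \<tau> (f \<zeta>)"
        unfolding eventually_at_disc_boundary using rrb(2)[of n] by blast
    qed
    show "\<tau> (f \<zeta>) > \<tau> (h \<zeta>) - e" if "norm \<zeta> < 1" for \<zeta>
      using flow[OF that, of 0] e0 by (simp add: H0)
    show "dist (f \<zeta>) (h \<zeta>) < e" if "norm \<zeta> \<le> r" for \<zeta>
      using f(2)[of \<zeta> 0] that r rrb(1)[of 0] e0 by (simp add: H0)
    show "f \<zeta> = h \<zeta>" if "norm \<zeta> < 1" "P \<zeta> = 0" for \<zeta>
    proof -
      have "H n \<zeta> = h \<zeta>" for n by (induction n) (auto simp: H0 step(4)[OF that(2)])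
      then have "(\<lambda>n. H n \<zeta>) \<longlonglongrightarrow> h \<zeta>" by simp
      then show ?thesis using f(3)[OF that(1)] LIMSEQ_unique by blast
    qed
  qed
qed

end

lemma tau_pushable:
  assumes "0 < k" "k < 1" "c < k" "0 \<le> R"
  shows "pushable k (tau k c R) (tau_grad k c R)"
  using assms by unfold_locales (auto intro!: continuous_tau tau_lower)

section \<open>Moving the boundary off the plane of purely imaginary points\<close>

lemma interpolating_basis:
  assumes "finite (A :: complex set)"
  obtains L C where "\<And>a. L a holomorphic_on UNIV" "\<And>a b. a \<in> A \<Longrightarrow> b \<in> A \<Longrightarrow> L a b = (if a = b then 1 else 0)"
    "C \<ge> 0" "\<And>\<zeta>. norm \<zeta> \<le> 1 \<Longrightarrow> (\<Sum>a\<in>A. norm (L a \<zeta> :: complex)) \<le> C"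
proof -
  define L where "L = (\<lambda>a \<zeta>. \<Prod>b\<in>A - {a}. (\<zeta> - b) / (a - b))"
  have hol: "L a holomorphic_on UNIV" for a
    unfolding L_def divide_inverse by (intro holomorphic_intros)
  have "continuous_on (cball 0 1) (\<lambda>\<zeta>. \<Sum>a\<in>A. norm (L a \<zeta>))"
    by (intro continuous_intros holomorphic_on_imp_continuous_on holomorphic_on_subset[OF hol]) auto
  then have "compact ((\<lambda>\<zeta>. \<Sum>a\<in>A. norm (L a \<zeta>)) ` cball 0 1)" by (rule compact_continuous_image) auto
  then obtain C where C: "\<And>\<zeta>. \<zeta> \<in> cball 0 1 \<Longrightarrow> norm (\<Sum>a\<in>A. norm (L a \<zeta>)) \<le> C"
    by (rule compact_image_norm_bound) blast
  have C': "(\<Sum>a\<in>A. norm (L a \<zeta>)) \<le> C" if "norm \<zeta> \<le> 1" for \<zeta>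
    using C[of \<zeta>] that by (auto simp: abs_le_iff)
  have "0 \<le> (\<Sum>a\<in>A. norm (L a 0))" by (rule sum_nonneg) simp
  then have C0: "C \<ge> 0" using C'[of 0] by simp
  have "L a b = (if a = b then 1 else 0)" if "a \<in> A" "b \<in> A" for a b
    using that assms by (auto simp: L_def intro!: prod.neutral)
  then show ?thesis using hol C0 C' by (intro that)
qed

text \<open>Dilate the argument slightly, and repair the values on \<open>A\<close> by Lagrange interpolation.\<close>
lemma holomorphic_past_boundary_approximation:
  fixes \<phi> :: "complex \<Rightarrow> complex"
  assumes c: "continuous_on (cball 0 1) \<phi>" and hol: "\<phi> holomorphic_on unit_disc"
    and A: "finite A" "A \<subseteq> unit_disc" and e: "e > 0"
  obtains \<psi> R where "R > 1" "\<psi> holomorphic_on ball 0 R"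
    "\<And>\<zeta>. norm \<zeta> \<le> 1 \<Longrightarrow> norm (\<psi> \<zeta> - \<phi> \<zeta>) < e" "\<And>a. a \<in> A \<Longrightarrow> \<psi> a = \<phi> a"
proof -
  obtain L C where L: "\<And>a. L a holomorphic_on UNIV" "\<And>a b. a \<in> A \<Longrightarrow> b \<in> A \<Longrightarrow> L a b = (if a = b then 1 else 0)"
    "C \<ge> 0" "\<And>\<zeta>. norm \<zeta> \<le> 1 \<Longrightarrow> (\<Sum>a\<in>A. norm (L a \<zeta> :: complex)) \<le> C"
    by (rule interpolating_basis[OF A(1)]) blast
  define \<eta> where "\<eta> = e / (C + 2)"
  have \<eta>: "\<eta> > 0" "\<eta> + \<eta> * C < e"
  proof -
    show pos: "\<eta> > 0" using e L(3) by (simp add: \<eta>_def)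
    have "\<eta> * (C + 2) = e" using L(3) by (simp add: \<eta>_def)
    then show "\<eta> + \<eta> * C < e" using pos by (simp add: algebra_simps)
  qed
  have "uniformly_continuous_on (cball 0 1) \<phi>" using c by (intro compact_uniformly_continuous) auto
  then obtain \<delta> where \<delta>: "\<delta> > 0" "\<And>x y. \<lbrakk>x \<in> cball 0 1; y \<in> cball 0 1; dist y x < \<delta>\<rbrakk> \<Longrightarrow> dist (\<phi> y) (\<phi> x) < \<eta>"
    using \<eta>(1) unfolding uniformly_continuous_on_def by metis
  define s where "s = 1 - min (\<delta> / 2) (1 / 2)"
  have s: "0 < s" "s < 1" "1 - s < \<delta>" using \<delta>(1) unfolding s_def by linarith+
  have close: "norm (\<phi> (of_real s * \<zeta>) - \<phi> \<zeta>) < \<eta>" if \<zeta>: "norm \<zeta> \<le> 1" for \<zeta>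
  proof -
    have "of_real s * \<zeta> - \<zeta> = of_real (s - 1) * \<zeta>" by (simp add: algebra_simps)
    then have "norm (of_real s * \<zeta> - \<zeta>) = (1 - s) * norm \<zeta>" using s by (simp only: norm_mult norm_of_real) simp
    also have "\<dots> \<le> (1 - s) * 1" using s \<zeta> by (intro mult_left_mono) auto
    finally have "dist (of_real s * \<zeta>) \<zeta> < \<delta>" using s by (simp add: dist_norm)
    moreover have "norm (of_real s * \<zeta>) \<le> 1" using s \<zeta> by (simp add: norm_mult mult_le_one)
    ultimately show ?thesis using \<delta>(2)[of \<zeta> "of_real s * \<zeta>"] \<zeta> by (simp add: dist_norm)
  qed
  define \<psi> where "\<psi> = (\<lambda>\<zeta>. \<phi> (of_real s * \<zeta>) + (\<Sum>a\<in>A. (\<phi> a - \<phi> (of_real s * a)) * L a \<zeta>))"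
  show ?thesis
  proof (rule that[of "1 / s" \<psi>])
    show "1 / s > 1" using s by simp
    have "(\<lambda>\<zeta>. \<phi> (of_real s * \<zeta>)) holomorphic_on ball 0 (1 / s)"
      by (rule holomorphic_on_compose_gen[OF _ hol, unfolded o_def])
         (use s in \<open>auto intro!: holomorphic_intros simp: norm_mult field_simps\<close>)
    then show "\<psi> holomorphic_on ball 0 (1 / s)"
      unfolding \<psi>_def by (intro holomorphic_intros holomorphic_on_subset[OF L(1)]) auto
    show "norm (\<psi> \<zeta> - \<phi> \<zeta>) < e" if \<zeta>: "norm \<zeta> \<le> 1" for \<zeta>
    proof -
      have "norm (\<Sum>a\<in>A. (\<phi> a - \<phi> (of_real s * a)) * L a \<zeta>) \<le> (\<Sum>a\<in>A. \<eta> * norm (L a \<zeta>))"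
      proof (rule sum_norm_le)
        fix a assume "a \<in> A"
        then have "norm (\<phi> a - \<phi> (of_real s * a)) < \<eta>" using close[of a] A(2) by (force simp: norm_minus_commute)
        then show "norm ((\<phi> a - \<phi> (of_real s * a)) * L a \<zeta>) \<le> \<eta> * norm (L a \<zeta>)"
          by (simp add: norm_mult mult_right_mono)
      qed
      also have "\<dots> \<le> \<eta> * C" using L(4)[OF \<zeta>] \<eta>(1) by (simp flip: sum_distrib_left)
      finally have "norm (\<Sum>a\<in>A. (\<phi> a - \<phi> (of_real s * a)) * L a \<zeta>) \<le> \<eta> * C" .
      moreover have "\<psi> \<zeta> - \<phi> \<zeta> = (\<phi> (of_real s * \<zeta>) - \<phi> \<zeta>) + (\<Sum>a\<in>A. (\<phi> a - \<phi> (of_real s * a)) * L a \<zeta>)"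
        by (simp add: \<psi>_def)
      ultimately show ?thesis
        using close[OF \<zeta>] \<eta>(2)
          norm_triangle_ineq[of "\<phi> (of_real s * \<zeta>) - \<phi> \<zeta>" "\<Sum>a\<in>A. (\<phi> a - \<phi> (of_real s * a)) * L a \<zeta>"]
        by (simp only:)
    qed
    show "\<psi> b = \<phi> b" if "b \<in> A" for b
    proof -
      have "(\<Sum>a\<in>A. (\<phi> a - \<phi> (of_real s * a)) * L a b) = (\<Sum>a\<in>A. if a = b then \<phi> b - \<phi> (of_real s * b) else 0)"
        using that by (intro sum.cong) (auto simp: L(2))
      then show ?thesis using that A(1) by (simp add: \<psi>_def)
    qed
  qed
qed

lemma differentiable_along_circle:
  assumes "g holomorphic_on ball 0 R" "R > 1"
  shows "(\<lambda>x::real \<times> 'a::euclidean_space. g (cis (fst x))) differentiable (at x)"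
proof -
  have "(\<lambda>x::real \<times> 'a. \<i> * of_real (fst x)) differentiable (at x)"
    by (intro bounded_linear_imp_differentiable bounded_linear_intros)
       (auto intro!: bounded_linear_compose[OF bounded_linear_mult_right] bounded_linear_compose[OF bounded_linear_of_real] bounded_linear_fst)
  moreover have "exp differentiable (at (\<i> * of_real (fst x) :: complex))"
    by (intro field_differentiable_imp_differentiable holomorphic_on_imp_differentiable_at[of exp UNIV]) (auto intro: holomorphic_intros)
  ultimately have "(exp \<circ> (\<lambda>x::real \<times> 'a. \<i> * of_real (fst x))) differentiable (at x)"
    by (rule differentiable_chain_at)
  then have "(\<lambda>x::real \<times> 'a. cis (fst x)) differentiable (at x)" by (simp add: o_def cis_conv_exp)
  moreover have "g differentiable (at (cis (fst x)))"
    using assms by (intro field_differentiable_imp_differentiable holomorphic_on_imp_differentiable_at[of g "ball 0 R"]) auto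
  ultimately have "(g \<circ> (\<lambda>x::real \<times> 'a. cis (fst x))) differentiable (at x)"
    by (rule differentiable_chain_at)
  then show ?thesis by (simp add: o_def)
qed

text \<open>
  The plane \<open>x = 0\<close> has codimension two and the boundary curve has dimension one, so a generic
  perturbation \<open>v P\<close> separates them: the vectors \<open>v \<in> \<complex>\<^sup>2\<close> that fail form the image of a
  differentiable map from \<open>\<real>\<^sup>3\<close>, parametrised by the angle and by the imaginary parts of \<open>v P\<close>, and
  this is a null set. Replacing \<open>h\<close> by a map that is holomorphic past the circle makes the curve
  differentiable.
\<close>
lemma avoid_imaginary_plane:
  assumes h: "disc_map h" and A: "finite A" "A \<subseteq> unit_disc" and e: "e > 0"
  obtains h' where "disc_map h'" "\<And>\<zeta>. norm \<zeta> \<le> 1 \<Longrightarrow> dist (h' \<zeta>) (h \<zeta>) < e"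
    "\<And>a. a \<in> A \<Longrightarrow> h' a = h a" "\<And>\<zeta>. norm \<zeta> = 1 \<Longrightarrow> re_part (h' \<zeta>) \<noteq> 0"
proof -
  obtain P \<kappa> where P: "disc_weight P \<kappa>" "\<And>a. a \<in> A \<Longrightarrow> P a = 0" by (rule disc_weight_exists[OF A]) blast
  have hc: "continuous_on (cball 0 1) h" and hh: "(\<lambda>\<zeta>. fst (h \<zeta>)) holomorphic_on unit_disc" "(\<lambda>\<zeta>. snd (h \<zeta>)) holomorphic_on unit_disc"
    using h by (auto simp: disc_map_def holomorphic_map_on_def)
  have e4: "e / 4 > 0" using e by simp
  obtain g1 R1 where g1: "R1 > 1" "g1 holomorphic_on ball 0 R1"
    "\<And>\<zeta>. norm \<zeta> \<le> 1 \<Longrightarrow> norm (g1 \<zeta> - fst (h \<zeta>)) < e / 4" "\<And>a. a \<in> A \<Longrightarrow> g1 a = fst (h a)"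
    by (rule holomorphic_past_boundary_approximation[OF continuous_on_fst[OF hc] hh(1) A e4]) blast
  obtain g2 R2 where g2: "R2 > 1" "g2 holomorphic_on ball 0 R2"
    "\<And>\<zeta>. norm \<zeta> \<le> 1 \<Longrightarrow> norm (g2 \<zeta> - snd (h \<zeta>)) < e / 4" "\<And>a. a \<in> A \<Longrightarrow> g2 a = snd (h a)"
    by (rule holomorphic_past_boundary_approximation[OF continuous_on_snd[OF hc] hh(2) A e4]) blast
  have holP: "P holomorphic_on UNIV" using P by (simp add: disc_weight_def)
  have Pnz: "P (cis \<theta>) \<noteq> 0" for \<theta>
  proof -
    have "\<kappa> > 0" "\<kappa> \<le> norm (P (cis \<theta>))" using P(1) by (auto simp: disc_weight_def)
    then show ?thesis by auto
  qed
  \<comment> \<open>The vector \<open>v\<close> for which \<open>g\<^sub>j + v\<^sub>j P\<close> is purely imaginary at \<open>cis \<theta>\<close>, with prescribed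
    imaginary parts of \<open>v\<^sub>j P\<close>.\<close>
  define bad :: "real \<times> real \<times> real \<Rightarrow> complex \<times> complex" where
    "bad = (\<lambda>x. ((\<i> * of_real (fst (snd x)) - of_real (Re (g1 (cis (fst x))))) / P (cis (fst x)),
                 (\<i> * of_real (snd (snd x)) - of_real (Re (g2 (cis (fst x))))) / P (cis (fst x))))"
  have "bad differentiable_on UNIV"
    unfolding differentiable_on_def
  proof
    fix x :: "real \<times> real \<times> real"
    have dP: "(\<lambda>x::real \<times> real \<times> real. P (cis (fst x))) differentiable (at x)"
      by (rule differentiable_along_circle[of _ 2]) (auto intro: holomorphic_on_subset[OF holP])
    have dRe: "(\<lambda>x::real \<times> real \<times> real. complex_of_real (Re (g (cis (fst x))))) differentiable (at x)"
      if "g holomorphic_on ball 0 R" "R > 1" for g R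
    proof -
      have "bounded_linear (\<lambda>z. complex_of_real (Re z))"
        by (intro bounded_linear_compose[OF bounded_linear_of_real] bounded_linear_Re)
      then have "(\<lambda>z. complex_of_real (Re z)) differentiable (at (g (cis (fst x))))"
        by (rule bounded_linear_imp_differentiable)
      from differentiable_chain_at[OF differentiable_along_circle[OF that] this]
      show ?thesis by (simp add: o_def)
    qed
    have lin: "(\<lambda>x::real \<times> real \<times> real. \<i> * complex_of_real (fst (snd x))) differentiable (at x)"
      "(\<lambda>x::real \<times> real \<times> real. \<i> * complex_of_real (snd (snd x))) differentiable (at x)"
      by (intro bounded_linear_imp_differentiable bounded_linear_compose[OF bounded_linear_mult_right]
         bounded_linear_compose[OF bounded_linear_of_real] bounded_linear_compose[OF bounded_linear_fst]
         bounded_linear_compose[OF bounded_linear_snd] bounded_linear_fst bounded_linear_snd)+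
    have "(\<lambda>x. (\<i> * of_real (fst (snd x)) - of_real (Re (g1 (cis (fst x))))) / P (cis (fst x))) differentiable (at x)"
      "(\<lambda>x. (\<i> * of_real (snd (snd x)) - of_real (Re (g2 (cis (fst x))))) / P (cis (fst x))) differentiable (at x)"
      using Pnz by (intro differentiable_divide differentiable_diff lin dP dRe[OF g1(2,1)] dRe[OF g2(2,1)]; simp)+
    then show "bad differentiable (at x)"
      unfolding bad_def differentiable_def by (elim exE) (rule exI, rule has_derivative_Pair)
  qed
  then have "negligible (bad ` UNIV)"
    by (intro negligible_differentiable_image_lowdim) simp_all
  moreover have "\<not> negligible (ball (0 :: complex \<times> complex) (e / 2))"
    using e by (intro open_not_negligible) auto
  ultimately have "\<not> ball 0 (e / 2) \<subseteq> range bad" by (metis negligible_subset)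
  then obtain v where "v \<in> ball 0 (e / 2)" and v_bad: "v \<notin> range bad" by blast
  then have v: "norm v < e / 2" by simp
  define h' where "h' = (\<lambda>\<zeta>. (g1 \<zeta> + fst v * P \<zeta>, g2 \<zeta> + snd v * P \<zeta>))"
  have sub: "cball (0::complex) 1 \<subseteq> ball 0 R1" "cball (0::complex) 1 \<subseteq> ball 0 R2" using g1(1) g2(1) by auto
  show ?thesis
  proof (rule that[of h'])
    show "disc_map h'"
      unfolding disc_map_def holomorphic_map_on_def h'_def fst_conv snd_conv
    proof (intro conjI)
      show "continuous_on (cball 0 1) (\<lambda>\<zeta>. (g1 \<zeta> + fst v * P \<zeta>, g2 \<zeta> + snd v * P \<zeta>))"
        by (intro continuous_intros holomorphic_on_imp_continuous_on holomorphic_on_subset[OF g1(2) sub(1)]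
             holomorphic_on_subset[OF g2(2) sub(2)] holomorphic_on_subset[OF holP]) auto
      show "(\<lambda>\<zeta>. g1 \<zeta> + fst v * P \<zeta>) holomorphic_on unit_disc"
        using sub by (intro holomorphic_intros holomorphic_on_subset[OF g1(2)] holomorphic_on_subset[OF holP]) force+
      show "(\<lambda>\<zeta>. g2 \<zeta> + snd v * P \<zeta>) holomorphic_on unit_disc"
        using sub by (intro holomorphic_intros holomorphic_on_subset[OF g2(2)] holomorphic_on_subset[OF holP]) force+
    qed
    show "dist (h' \<zeta>) (h \<zeta>) < e" if \<zeta>: "norm \<zeta> \<le> 1" for \<zeta>
    proof -
      have P1: "norm (P \<zeta>) \<le> 1 / 4" using P \<zeta> by (auto simp: disc_weight_def)
      have small: "norm (c * P \<zeta>) \<le> e / 4" if "norm c \<le> norm v" for c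
      proof -
        have "norm c * norm (P \<zeta>) \<le> (e / 2) * (1 / 4)" using that v P1 e by (intro mult_mono) auto
        then show ?thesis using e by (simp add: norm_mult)
      qed
      have "h' \<zeta> - h \<zeta> = ((g1 \<zeta> - fst (h \<zeta>)) + fst v * P \<zeta>, (g2 \<zeta> - snd (h \<zeta>)) + snd v * P \<zeta>)"
        by (cases "h \<zeta>") (simp add: h'_def)
      then have "norm (h' \<zeta> - h \<zeta>) \<le> norm ((g1 \<zeta> - fst (h \<zeta>)) + fst v * P \<zeta>) + norm ((g2 \<zeta> - snd (h \<zeta>)) + snd v * P \<zeta>)"
        by (simp add: norm_Pair_le)
      also have "\<dots> \<le> (norm (g1 \<zeta> - fst (h \<zeta>)) + norm (fst v * P \<zeta>)) + (norm (g2 \<zeta> - snd (h \<zeta>)) + norm (snd v * P \<zeta>))"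
        by (intro add_mono norm_triangle_ineq)
      also have "\<dots> < e"
      proof -
        have "norm (fst v) \<le> norm v" "norm (snd v) \<le> norm v"
          using norm_fst_le[of "fst v" "snd v"] norm_snd_le[of "snd v" "fst v"] by simp_all
        then show ?thesis using g1(3)[OF \<zeta>] g2(3)[OF \<zeta>] small[of "fst v"] small[of "snd v"] by linarith
      qed
      finally show ?thesis by (simp add: dist_norm)
    qed
    show "h' a = h a" if "a \<in> A" for a using that g1(4) g2(4) P(2) by (simp add: h'_def)
    show "re_part (h' \<zeta>) \<noteq> 0" if \<zeta>: "norm \<zeta> = 1" for \<zeta>
    proof
      assume "re_part (h' \<zeta>) = 0"
      then have re: "Re (g1 \<zeta> + fst v * P \<zeta>) = 0" "Re (g2 \<zeta> + snd v * P \<zeta>) = 0"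
        by (auto simp: re_part_def h'_def zero_prod_def)
      obtain \<theta> where \<theta>: "\<zeta> = cis \<theta>" using cis_Arg[of \<zeta>] \<zeta> by (metis norm_zero sgn_eq div_by_1 of_real_1 zero_neq_one)
      have solve: "c = (\<i> * of_real (Im (c * P \<zeta>)) - of_real (Re x)) / P \<zeta>" if "Re (x + c * P \<zeta>) = 0" for c x
      proof -
        have "c * P \<zeta> = \<i> * of_real (Im (c * P \<zeta>)) - of_real (Re x)"
          using that by (simp add: complex_eq_iff)
        then show ?thesis using Pnz[of \<theta>] \<theta> by (metis nonzero_mult_div_cancel_right)
      qed
      have "v = bad (\<theta>, Im (fst v * P \<zeta>), Im (snd v * P \<zeta>))"
        using solve[OF re(1)] solve[OF re(2)] unfolding bad_def fst_conv snd_conv \<theta>[symmetric]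
        by (metis prod.collapse)
      then show False using v_bad by blast
    qed
  qed
qed

section \<open>Approximation by proper discs for c below 1\<close>

text \<open>For \<open>c \<le> 0\<close> there are no critical points of positive value, so \<open>rho c\<close> itself can be pushed.\<close>
lemma rho_approximation_nonpos:
  assumes c: "c \<le> 0" and h: "disc_map h" and A: "finite A" "A \<subseteq> unit_disc" and e: "e > 0" and r: "r < 1"
  obtains f where "holomorphic_map_on f unit_disc"
    "filterlim (\<lambda>\<zeta>. rho c (f \<zeta>)) at_top at_disc_boundary"
    "\<And>\<zeta>. norm \<zeta> < 1 \<Longrightarrow> rho c (f \<zeta>) > rho c (h \<zeta>) - e"
    "\<And>\<zeta>. norm \<zeta> \<le> r \<Longrightarrow> dist (f \<zeta>) (h \<zeta>) < e"
    "\<And>a. a \<in> A \<Longrightarrow> f a = h a"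
proof -
  obtain P \<kappa> where P: "disc_weight P \<kappa>" "\<And>a. a \<in> A \<Longrightarrow> P a = 0" by (rule disc_weight_exists[OF A]) blast
  have "tau (1/2) c 0 = rho c" using c by (intro ext tau_0) simp
  then interpret pushable "1/2" "rho c" "tau_grad (1/2) c 0"
    using tau_pushable[of "1/2" c 0] c by simp
  have hc: "continuous_on (cball 0 1) h" using h by (simp add: disc_map_def)
  obtain \<delta> where \<delta>: "\<delta> > 0" "\<And>\<zeta> w. \<zeta> \<in> cball 0 1 \<Longrightarrow> dist w (h \<zeta>) < \<delta> \<Longrightarrow> \<bar>rho c w - rho c (h \<zeta>)\<bar> < e / 2"
    using continuous_near_compact_image[OF compact_cball hc continuous_rho, of "e / 2"] e by auto
  have "min \<delta> (e / 2) > 0" using \<delta> e by simp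
  from avoid_imaginary_plane[OF h A this] obtain h1 where h1: "disc_map h1"
    "\<And>\<zeta>. norm \<zeta> \<le> 1 \<Longrightarrow> dist (h1 \<zeta>) (h \<zeta>) < min \<delta> (e / 2)"
    "\<And>a. a \<in> A \<Longrightarrow> h1 a = h a" "\<And>\<zeta>. norm \<zeta> = 1 \<Longrightarrow> re_part (h1 \<zeta>) \<noteq> 0" by blast
  have pos: "rho c (h1 \<zeta>) > 0" if "norm \<zeta> = 1" for \<zeta>
  proof -
    have "(norm (re_part (h1 \<zeta>)))\<^sup>2 > 0" using h1(4)[OF that] by simp
    moreover have "c * (norm (im_part (h1 \<zeta>)))\<^sup>2 \<le> 0" using c by (simp add: mult_nonpos_nonneg)
    ultimately show ?thesis unfolding rho_parts by linarith
  qed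
  have "continuous_on (cball 0 1) h1" using h1(1) by (simp add: disc_map_def)
  from sphere_gap[OF this continuous_rho, of 0 c] pos obtain m where m: "m > 0"
    "\<And>\<zeta>. norm \<zeta> = 1 \<Longrightarrow> rho c (h1 \<zeta>) > m" by auto
  \<comment> \<open>For \<open>c < 0\<close>, \<open>|\<Lambda>|\<^sup>2\<close> contains \<open>c\<^sup>2 |y|\<^sup>2\<close> whereas \<open>rho c\<close> contains \<open>- c |y|\<^sup>2\<close>; for \<open>c = 0\<close> both terms vanish.\<close>
  define \<mu> where "\<mu> = (if c = 0 then 1 else min 1 (- c))"
  have \<mu>: "\<mu> > 0" using c by (simp add: \<mu>_def)
  have grad: "(norm (tau_grad (1/2) c 0 z))\<^sup>2 \<ge> 4 * \<mu> * rho c z" for z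
  proof -
    let ?x = "(norm (re_part z))\<^sup>2" and ?y = "(norm (im_part z))\<^sup>2"
    have "\<mu> * ?x \<le> 1 * ?x" by (intro mult_right_mono) (auto simp: \<mu>_def)
    moreover have "\<mu> * (- c) * ?y \<le> c\<^sup>2 * ?y"
    proof (intro mult_right_mono)
      show "\<mu> * (- c) \<le> c\<^sup>2"
        using c mult_right_mono[of \<mu> "- c" "- c"] by (auto simp: \<mu>_def power2_eq_square)
    qed auto
    ultimately have "\<mu> * (?x - c * ?y) \<le> ?x + c\<^sup>2 * ?y" by (simp add: algebra_simps)
    then show ?thesis by (simp add: norm_tau_grad_0 rho_parts)
  qed
  have pg: "push_gain (1/2) \<kappa> > 0" using P(1) by (intro push_gain_pos) (auto simp: disc_weight_def)
  define g where "g = push_gain (1/2) \<kappa> * (4 * \<mu> * m)"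
  have g: "g > 0" using pg \<mu> m by (simp add: g_def)
  have gain: "g \<le> push_gain (1/2) \<kappa> * (norm (tau_grad (1/2) c 0 z))\<^sup>2" if "m \<le> rho c z" for z
  proof -
    have "4 * \<mu> * m \<le> 4 * \<mu> * rho c z" using that \<mu> by (intro mult_left_mono) auto
    then show ?thesis unfolding g_def using grad[of z] pg by (intro mult_left_mono) auto
  qed
  have "e / 2 > 0" using e by simp
  from push_to_infinity[OF P(1) h1(1) this r g gain m(2)] obtain f where f: "holomorphic_map_on f unit_disc"
    "filterlim (\<lambda>\<zeta>. rho c (f \<zeta>)) at_top at_disc_boundary"
    "\<And>\<zeta>. norm \<zeta> < 1 \<Longrightarrow> rho c (f \<zeta>) > rho c (h1 \<zeta>) - e / 2"
    "\<And>\<zeta>. norm \<zeta> \<le> r \<Longrightarrow> dist (f \<zeta>) (h1 \<zeta>) < e / 2"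
    "\<And>\<zeta>. norm \<zeta> < 1 \<Longrightarrow> P \<zeta> = 0 \<Longrightarrow> f \<zeta> = h1 \<zeta>" by blast
  show ?thesis
  proof (rule that[OF f(1,2)])
    show "rho c (f \<zeta>) > rho c (h \<zeta>) - e" if "norm \<zeta> < 1" for \<zeta>
    proof -
      have "\<bar>rho c (h1 \<zeta>) - rho c (h \<zeta>)\<bar> < e / 2" using h1(2)[of \<zeta>] that by (intro \<delta>(2)) auto
      then show ?thesis using f(3)[OF that] by linarith
    qed
    show "dist (f \<zeta>) (h \<zeta>) < e" if "norm \<zeta> \<le> r" for \<zeta>
      using f(4)[OF that] h1(2)[of \<zeta>] that r dist_triangle[of "f \<zeta>" "h \<zeta>" "h1 \<zeta>"] by simp
    show "f a = h a" if "a \<in> A" for a using that A(2) f(5)[of a] P(2) h1(3) by auto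
  qed
qed

text \<open>
  The error \<open>e\<close> is spent in four equal parts: on raising the boundary close to the saddle, on moving it
  off \<open>x = 0\<close>, on replacing \<open>rho c\<close> by \<open>tau k c R\<close>, and on the final ascent.
\<close>
lemma rho_approximation_pos:
  assumes c: "0 < c" "c < 1" and h: "disc_map h" and A: "finite A" "A \<subseteq> unit_disc" and e: "e > 0" and r: "r < 1"
  obtains f where "holomorphic_map_on f unit_disc"
    "filterlim (\<lambda>\<zeta>. rho c (f \<zeta>)) at_top at_disc_boundary"
    "\<And>\<zeta>. norm \<zeta> < 1 \<Longrightarrow> rho c (f \<zeta>) > rho c (h \<zeta>) - e"
    "\<And>\<zeta>. norm \<zeta> \<le> r \<Longrightarrow> dist (f \<zeta>) (h \<zeta>) < e"
    "\<And>a. a \<in> A \<Longrightarrow> f a = h a"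
proof -
  obtain P \<kappa> where P: "disc_weight P \<kappa>" "\<And>a. a \<in> A \<Longrightarrow> P a = 0" by (rule disc_weight_exists[OF A]) blast
  define k where "k = (1 + c) / 2"
  have k: "0 < k" "k < 1" "c < k" using c by (auto simp: k_def)
  \<comment> \<open>The radius for which \<open>tau k c R\<close> and \<open>rho c\<close> differ by at most \<open>e / 4\<close>.\<close>
  define R where "R = sqrt (e / 4 * (k - c) / (k * c))"
  have arg: "e / 4 * (k - c) / (k * c) > 0" using e k c by (intro divide_pos_pos mult_pos_pos) auto
  have R: "R > 0" "R\<^sup>2 = e / 4 * (k - c) / (k * c)" using arg by (auto simp: R_def)
  have \<eta>: "k * c * R\<^sup>2 / (k - c) = e / 4" unfolding R(2) using k c by (simp add: field_simps)
  have pg: "push_gain k \<kappa> > 0" using P(1) k by (intro push_gain_pos) (auto simp: disc_weight_def)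
  have e4: "e / 4 > 0" using e by simp
  \<comment> \<open>Boundary points above \<open>- t\<close> lie above the critical level of \<open>tau k c R\<close> once \<open>x \<noteq> 0\<close>.\<close>
  define t where "t = c * R\<^sup>2"
  have t: "t > 0" using mult_pos_pos[OF c(1) zero_less_power[OF R(1)]] by (simp add: t_def)
  have "tau k c 0 = rho c" using k by (intro ext tau_0) simp
  then interpret A: pushable k "rho c" "tau_grad k c 0"
    using tau_pushable[of k c 0] k by simp
  define g where "g = push_gain k \<kappa> * (4 * c * (t / 2))"
  have g: "g > 0" using pg c t by (simp add: g_def)
  have gain: "g \<le> push_gain k \<kappa> * (norm (tau_grad k c 0 z))\<^sup>2" if "rho c z \<le> - (t / 2)" for z
  proof -
    have "c * (t / 2) \<le> c * (c * (norm (im_part z))\<^sup>2 - (norm (re_part z))\<^sup>2)"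
      using that c by (intro mult_left_mono) (auto simp: rho_parts)
    also have "\<dots> \<le> (norm (re_part z))\<^sup>2 + c\<^sup>2 * (norm (im_part z))\<^sup>2"
      using c by (simp add: power2_eq_square algebra_simps)
    finally have "4 * c * (t / 2) \<le> (norm (tau_grad k c 0 z))\<^sup>2" by (simp add: norm_tau_grad_0)
    then show ?thesis unfolding g_def using pg by (intro mult_left_mono) auto
  qed
  have t2: "t / 2 > 0" using t by simp
  from A.push_above_level[OF P(1) h e4 r g gain t2] obtain h1 where h1: "disc_map h1"
    "\<And>\<zeta>. norm \<zeta> = 1 \<Longrightarrow> rho c (h1 \<zeta>) > - (t / 2) - t / 2"
    "\<And>\<zeta>. norm \<zeta> \<le> 1 \<Longrightarrow> rho c (h1 \<zeta>) > rho c (h \<zeta>) - e / 4"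
    "\<And>\<zeta>. norm \<zeta> \<le> r \<Longrightarrow> dist (h1 \<zeta>) (h \<zeta>) < e / 4"
    "\<And>\<zeta>. P \<zeta> = 0 \<Longrightarrow> h1 \<zeta> = h \<zeta>" by blast
  have h1t: "rho c (h1 \<zeta>) > - t" if "norm \<zeta> = 1" for \<zeta> using h1(2)[OF that] by simp
  have h1c: "continuous_on (cball 0 1) h1" using h1(1) by (simp add: disc_map_def)
  obtain \<delta>1 where \<delta>1: "\<delta>1 > 0" "\<And>\<zeta>. norm \<zeta> = 1 \<Longrightarrow> rho c (h1 \<zeta>) > - t + \<delta>1"
    by (rule sphere_gap[OF h1c continuous_rho h1t]) (assumption, rule that)
  have "min (e / 4) \<delta>1 > 0" using e \<delta>1 by simp
  from continuous_near_compact_image[OF compact_cball h1c continuous_rho this]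
  obtain \<delta> where \<delta>: "\<delta> > 0"
    "\<And>\<zeta> w. \<zeta> \<in> cball 0 1 \<Longrightarrow> dist w (h1 \<zeta>) < \<delta> \<Longrightarrow> \<bar>rho c w - rho c (h1 \<zeta>)\<bar> < min (e / 4) \<delta>1" by blast
  have "min \<delta> (e / 4) > 0" using \<delta> e by simp
  from avoid_imaginary_plane[OF h1(1) A this] obtain h2 where h2: "disc_map h2"
    "\<And>\<zeta>. norm \<zeta> \<le> 1 \<Longrightarrow> dist (h2 \<zeta>) (h1 \<zeta>) < min \<delta> (e / 4)"
    "\<And>a. a \<in> A \<Longrightarrow> h2 a = h1 a" "\<And>\<zeta>. norm \<zeta> = 1 \<Longrightarrow> re_part (h2 \<zeta>) \<noteq> 0" by blast
  have near: "\<bar>rho c (h2 \<zeta>) - rho c (h1 \<zeta>)\<bar> < min (e / 4) \<delta>1" if "norm \<zeta> \<le> 1" for \<zeta>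
    using \<delta>(2)[of \<zeta> "h2 \<zeta>"] h2(2)[OF that] that by auto
  let ?\<tau> = "tau k c R"
  interpret B: pushable k ?\<tau> "tau_grad k c R" using tau_pushable k R by simp
  note bounds = tau_rho_bounds[OF c(1) k(3) less_imp_le[OF R(1)]]
  have pos: "?\<tau> (h2 \<zeta>) > 0" if "norm \<zeta> = 1" for \<zeta>
  proof (rule bounds(4))
    show "re_part (h2 \<zeta>) \<noteq> 0" by (rule h2(4)[OF that])
    show "rho c (h2 \<zeta>) > - c * R\<^sup>2" using near[of \<zeta>] \<delta>1(2)[OF that] that by (simp add: t_def abs_less_iff)
  qed
  have h2c: "continuous_on (cball 0 1) h2" using h2(1) by (simp add: disc_map_def)
  obtain m where m: "m > 0" "\<And>\<zeta>. norm \<zeta> = 1 \<Longrightarrow> ?\<tau> (h2 \<zeta>) > m"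
    using sphere_gap[OF h2c B.cont(1) pos] by auto
  define g' where "g' = push_gain k \<kappa> * (4 * m)"
  have g': "g' > 0" using pg m by (simp add: g'_def)
  have gain': "g' \<le> push_gain k \<kappa> * (norm (tau_grad k c R z))\<^sup>2" if "m \<le> ?\<tau> z" for z
  proof -
    have "4 * m \<le> 4 * (norm (re_part z))\<^sup>2" using that bounds(3)[of z] by simp
    also have "\<dots> \<le> (norm (tau_grad k c R z))\<^sup>2" unfolding norm_tau_grad by simp
    finally show ?thesis unfolding g'_def using pg by (intro mult_left_mono) auto
  qed
  from B.push_to_infinity[OF P(1) h2(1) e4 r g' gain' m(2)] obtain f where f: "holomorphic_map_on f unit_disc"
    "filterlim (\<lambda>\<zeta>. ?\<tau> (f \<zeta>)) at_top at_disc_boundary"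
    "\<And>\<zeta>. norm \<zeta> < 1 \<Longrightarrow> ?\<tau> (f \<zeta>) > ?\<tau> (h2 \<zeta>) - e / 4"
    "\<And>\<zeta>. norm \<zeta> \<le> r \<Longrightarrow> dist (f \<zeta>) (h2 \<zeta>) < e / 4"
    "\<And>\<zeta>. norm \<zeta> < 1 \<Longrightarrow> P \<zeta> = 0 \<Longrightarrow> f \<zeta> = h2 \<zeta>" by blast
  show ?thesis
  proof (rule that[OF f(1)])
    show "filterlim (\<lambda>\<zeta>. rho c (f \<zeta>)) at_top at_disc_boundary"
      unfolding filterlim_at_top
    proof
      fix Z :: real
      have "\<forall>\<^sub>F \<zeta> in at_disc_boundary. Z + e / 4 \<le> ?\<tau> (f \<zeta>)" using f(2) by (simp add: filterlim_at_top)
      then show "\<forall>\<^sub>F \<zeta> in at_disc_boundary. Z \<le> rho c (f \<zeta>)"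
      proof eventually_elim
        case (elim \<zeta>)
        then show ?case using bounds(2)[of "f \<zeta>"] unfolding \<eta> by linarith
      qed
    qed
    show "rho c (f \<zeta>) > rho c (h \<zeta>) - e" if \<zeta>: "norm \<zeta> < 1" for \<zeta>
    proof -
      have "rho c (f \<zeta>) \<ge> ?\<tau> (f \<zeta>) - e / 4" using bounds(2)[of "f \<zeta>"] unfolding \<eta> by linarith
      moreover have "?\<tau> (f \<zeta>) > ?\<tau> (h2 \<zeta>) - e / 4" by (rule f(3)[OF \<zeta>])
      moreover have "?\<tau> (h2 \<zeta>) \<ge> rho c (h2 \<zeta>)" by (rule bounds(1))
      moreover have "rho c (h2 \<zeta>) > rho c (h1 \<zeta>) - e / 4" using near[OF less_imp_le[OF \<zeta>]] by linarith
      moreover have "rho c (h1 \<zeta>) > rho c (h \<zeta>) - e / 4" using h1(3)[of \<zeta>] \<zeta> by simp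
      ultimately show ?thesis by linarith
    qed
    show "dist (f \<zeta>) (h \<zeta>) < e" if \<zeta>: "norm \<zeta> \<le> r" for \<zeta>
    proof -
      have "dist (h2 \<zeta>) (h1 \<zeta>) < e / 4" using h2(2)[of \<zeta>] \<zeta> r by simp
      then show ?thesis
        using f(4)[OF \<zeta>] h1(4)[OF \<zeta>] dist_triangle[of "f \<zeta>" "h \<zeta>" "h2 \<zeta>"]
          dist_triangle[of "h2 \<zeta>" "h \<zeta>" "h1 \<zeta>"] e by linarith
    qed
    show "f a = h a" if "a \<in> A" for a using that A(2) f(5)[of a] P(2) h1(5) h2(3) by auto
  qed
qed

theorem theorem1p2:
  fixes c :: real
  shows
    "(c < 1 \<longrightarrow>
       (\<forall>(M::real) (d :: complex \<times> complex \<Rightarrow> complex \<times> complex \<Rightarrow> real)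
          (h :: complex \<Rightarrow> complex \<times> complex).
          compatible_metric d \<and>
          continuous_on (closure unit_disc) h \<and> holomorphic_map_on h unit_disc \<and>
          (\<forall>\<zeta>\<in>sphere 0 1. rho c (h \<zeta>) > M) \<longrightarrow>
          (\<forall>(r::real) (\<epsilon>::real) (A::complex set).
             0 < r \<and> r < 1 \<and> \<epsilon> > 0 \<and> finite A \<and> A \<subseteq> unit_disc \<longrightarrow>
             (\<exists>f :: complex \<Rightarrow> complex \<times> complex.
                holomorphic_map_on f unit_disc \<and> proper_on_disc f \<and>
                filterlim (\<lambda>\<zeta>. rho c (f \<zeta>)) at_top at_disc_boundary \<and>
                (\<forall>\<zeta>\<in>unit_disc. rho c (f \<zeta>) > rho c (h \<zeta>) - \<epsilon>) \<and>
                (\<forall>\<zeta>. norm \<zeta> \<le> r \<longrightarrow> d (f \<zeta>) (h \<zeta>) < \<epsilon>) \<and>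
                (\<forall>\<zeta>\<in>A. f \<zeta> = h \<zeta>))))) \<and>
     (c \<ge> 1 \<longrightarrow>
       (\<forall>f :: complex \<Rightarrow> complex \<times> complex.
          holomorphic_map_on f unit_disc \<and> proper_on_disc f \<longrightarrow>
          \<not> bdd_below ((\<lambda>\<zeta>. rho c (f \<zeta>)) ` unit_disc)) \<and>
       \<not> (\<exists>f :: complex \<Rightarrow> complex \<times> complex.
            holomorphic_map_on f unit_disc \<and> proper_on_disc f \<and>
            filterlim (\<lambda>\<zeta>. rho c (f \<zeta>)) at_top at_disc_boundary))"
proof (intro conjI impI allI; (elim conjE)?)
  fix M :: real and d :: "complex \<times> complex \<Rightarrow> complex \<times> complex \<Rightarrow> real"
    and h :: "complex \<Rightarrow> complex \<times> complex" and r \<epsilon> :: real and A :: "complex set"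
  assume c: "c < 1" and d: "compatible_metric d" and hc: "continuous_on (closure unit_disc) h"
    and hh: "holomorphic_map_on h unit_disc" and r: "0 < r" "r < 1" and e: "\<epsilon> > 0" and A: "finite A" "A \<subseteq> unit_disc"
  have h: "disc_map h" using hc hh by (simp add: disc_map_def)
  have hr: "continuous_on (cball 0 r) h" using hc r by (auto intro: continuous_on_subset)
  obtain \<delta> where \<delta>: "\<delta> > 0" "\<And>\<zeta> w. \<zeta> \<in> cball 0 r \<Longrightarrow> dist w (h \<zeta>) < \<delta> \<Longrightarrow> d w (h \<zeta>) < \<epsilon>"
    using compatible_metric_near_compact_image[OF d compact_cball hr e] by metis
  define e where "e = min \<epsilon> \<delta>"
  have e0: "e > 0" using \<delta> e by (simp add: e_def)
  obtain f where f: "holomorphic_map_on f unit_disc"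
    "filterlim (\<lambda>\<zeta>. rho c (f \<zeta>)) at_top at_disc_boundary"
    "\<And>\<zeta>. norm \<zeta> < 1 \<Longrightarrow> rho c (f \<zeta>) > rho c (h \<zeta>) - e"
    "\<And>\<zeta>. norm \<zeta> \<le> r \<Longrightarrow> dist (f \<zeta>) (h \<zeta>) < e"
    "\<And>a. a \<in> A \<Longrightarrow> f a = h a"
  proof (cases "c > 0")
    case True
    then show ?thesis by (rule rho_approximation_pos[OF _ c h A e0 r(2)]) (rule that; assumption)
  next
    case False
    then have "c \<le> 0" by simp
    then show ?thesis by (rule rho_approximation_nonpos[OF _ h A e0 r(2)]) (rule that; assumption)
  qed
  have "rho c (f \<zeta>) > rho c (h \<zeta>) - \<epsilon>" if "\<zeta> \<in> unit_disc" for \<zeta>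
    using f(3)[of \<zeta>] that by (simp add: e_def)
  moreover have "d (f \<zeta>) (h \<zeta>) < \<epsilon>" if "norm \<zeta> \<le> r" for \<zeta>
    using f(4)[OF that] \<delta>(2)[of \<zeta> "f \<zeta>"] that by (simp add: e_def)
  ultimately show "\<exists>f. holomorphic_map_on f unit_disc \<and> proper_on_disc f \<and>
                filterlim (\<lambda>\<zeta>. rho c (f \<zeta>)) at_top at_disc_boundary \<and>
                (\<forall>\<zeta>\<in>unit_disc. rho c (f \<zeta>) > rho c (h \<zeta>) - \<epsilon>) \<and>
                (\<forall>\<zeta>. norm \<zeta> \<le> r \<longrightarrow> d (f \<zeta>) (h \<zeta>) < \<epsilon>) \<and>
                (\<forall>\<zeta>\<in>A. f \<zeta> = h \<zeta>)"
    using f(1,2,5) proper_if_rho_tends_to_infinity[OF f(1,2)] by blast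
next
  fix f :: "complex \<Rightarrow> complex \<times> complex"
  assume "c \<ge> 1" "holomorphic_map_on f unit_disc" "proper_on_disc f"
  then show "\<not> bdd_below ((\<lambda>\<zeta>. rho c (f \<zeta>)) ` unit_disc)" by (intro rho_comp_unbounded_below)
next
  assume c: "c \<ge> 1"
  show "\<not> (\<exists>f :: complex \<Rightarrow> complex \<times> complex.
            holomorphic_map_on f unit_disc \<and> proper_on_disc f \<and>
            filterlim (\<lambda>\<zeta>. rho c (f \<zeta>)) at_top at_disc_boundary)"
  proof (intro notI, elim exE conjE)
    fix f :: "complex \<Rightarrow> complex \<times> complex"
    assume f: "holomorphic_map_on f unit_disc" "proper_on_disc f"
      and lim: "filterlim (\<lambda>\<zeta>. rho c (f \<zeta>)) at_top at_disc_boundary"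
    have "\<forall>\<^sub>F \<zeta> in at_disc_boundary. rho c (f \<zeta>) \<ge> 0" using lim by (simp add: filterlim_at_top)
    then obtain b where b: "b < 1" "\<And>\<zeta>. b < norm \<zeta> \<Longrightarrow> norm \<zeta> < 1 \<Longrightarrow> rho c (f \<zeta>) \<ge> 0"
      unfolding eventually_at_disc_boundary by blast
    have "continuous_on unit_disc f"
      by (rule holomorphic_map_on_imp_continuous_on[OF f(1)])
    then have "continuous_on (cball 0 b) (\<lambda>\<zeta>. rho c (f \<zeta>))"
      using b(1) by (intro continuous_on_compose2[OF continuous_rho]) (auto intro: continuous_on_subset)
    then have "compact ((\<lambda>\<zeta>. rho c (f \<zeta>)) ` cball 0 b)" by (rule compact_continuous_image) auto
    then obtain B where B: "\<And>\<zeta>. \<zeta> \<in> cball 0 b \<Longrightarrow> norm (rho c (f \<zeta>)) \<le> B"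
      by (rule compact_image_norm_bound) blast
    have "rho c (f \<zeta>) \<ge> - \<bar>B\<bar>" if "norm \<zeta> < 1" for \<zeta>
      using B[of \<zeta>] b(2)[of \<zeta>] that by (cases "norm \<zeta> \<le> b") auto
    then have "bdd_below ((\<lambda>\<zeta>. rho c (f \<zeta>)) ` unit_disc)" by (intro bdd_belowI[of _ "- \<bar>B\<bar>"]) auto
    then show False using rho_comp_unbounded_below[OF f c] by blast
  qed
qed

end
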